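(* Let $\lambda\in\mathbb R$, $a\in L^\infty(\Omega)$, $K,Q\in L^\infty(\Omega\times\Omega)$ (no symmetry or sign assumptions) and $f\in X^{-s}(\Omega)$. Set $$\eta=C_{S,2}^2\bigl(\|a\|_\infty+|\Omega|\,\|K\|_\infty\bigr),\qquad \gamma=|\lambda|\,\|Q\|_\infty C_{S,q}^{2q}.$$ Assume that $\eta<1$ and that there exists $r>0$ such that $$\gamma r^{2q-2}+\frac{\|f\|_{X^{-s}}}{r}\le 1-\eta.$$ Then problem (P) admits a weak solution $u^*\in X_0^s(\Omega)$ with $\|u^*\|_{X_0^s}\le r$. If $f\neq 0$, this solution is nontrivial.
   Context: Throughout, $\Omega\subset\mathbb R^N$, $N\ge 2$, is a bounded domain with Lipschitz boundary, $s\in(0,1)$, $2_s^*=\frac{2N}{N-2s}$ and $1<q<2_s^*$. $X_0^s(\Omega)=\{u\in H^s(\mathbb R^N): u=0 \text{ a.e. in }\mathbb R^N\setminus\Omega\}$, with the form $$\mathcal E_s(u,v)=\frac{C_{N,s}}2\iint_{\mathbb R^{2N}}\frac{(u(x)-u(y))(v(x)-v(y))}{|x-y|^{N+2s}}\,dx\,dy,\qquad C_{N,s}=\frac{4^s s\,\Gamma(N/2+s)}{\pi^{N/2}\Gamma(1-s)},$$ and norm $\|u\|_{X_0^s}=\mathcal E_s(u,u)^{1/2}$, which makes it a Hilbert space. $X^{-s}(\Omega)$ is its dual, with the dual norm and pairing $\langle\cdot,\cdot\rangle$. For $1\le p\le 2_s^*$, $C_{S,p}>0$ denotes a fixed constant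 with $\|u\|_{L^p(\Omega)}\le C_{S,p}\|u\|_{X_0^s}$ for all $u\in X_0^s(\Omega)$. $\|K\|_\infty,\|Q\|_\infty$ are $L^\infty(\Omega\times\Omega)$ norms, $\|a\|_\infty$ is the $L^\infty(\Omega)$ norm, $|\Omega|$ is the Lebesgue measure. $(T_Ku)(x)=\int_\Omega K(x,y)u(y)\,dy$, $B_Q(u)(x)=\int_\Omega Q(x,y)|u(y)|^q\,dy$, $\mathcal N_Q(u)=|u|^{q-2}u\,B_Q(u)$ (with $|u|^{q-2}u:=0$ where $u=0$), and $$\mathcal A_s(u,v)=\mathcal E_s(u,v)-\int_\Omega (T_Ku)v\,dx-\int_\Omega a\,uv\,dx.$$ Problem (P) is: $(-\Delta)^su-T_Ku=au+\lambda\mathcal N_Q(u)+f$ in $\Omega$, $u=0$ in $\mathbb R^N\setminus\Omega$. A weak solution of (P) is a function $u\in X_0^s(\Omega)$ with $\mathcal A_s(u,\varphi)=\lambda\int_\Omega\mathcal N_Q(u)\varphi\,dx+\langle f,\varphi\rangle$ for every $\varphi\in X_0^s(\Omega)$. *)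

theory Defs
  imports "HOL-Probability.Probability"
begin

(* Elements of the L^p and Sobolev spaces are represented by Lebesgue measurable functions;
   functions that agree almost everywhere stand for the same element. *)

text \<open>Near every boundary point, the set is the strict epigraph of a Lipschitz function over the
  hyperplane orthogonal to some unit vector \<open>e\<close>.\<close>

definition lipschitz_boundary :: "'a::euclidean_space set \<Rightarrow> bool" where
  "lipschitz_boundary \<Omega> \<longleftrightarrow>
     (\<forall>p\<in>frontier \<Omega>. \<exists>\<rho> e g L. \<rho> > 0 \<and> norm e = 1 \<and>
        L-lipschitz_on {z. z \<bullet> e = 0} (g :: 'a \<Rightarrow> real) \<and>
        \<Omega> \<inter> ball p \<rho> = {y \<in> ball p \<rho>. g (y - (y \<bullet> e) *\<^sub>R e) < y \<bullet> e})"

definition bounded_lipschitz_domain :: "'a::euclidean_space set \<Rightarrow> bool" where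
  "bounded_lipschitz_domain \<Omega> \<longleftrightarrow>
     open \<Omega> \<and> connected \<Omega> \<and> \<Omega> \<noteq> {} \<and> bounded \<Omega> \<and> lipschitz_boundary \<Omega>"

definition crit_exponent :: "nat \<Rightarrow> real \<Rightarrow> real" where
  "crit_exponent N s = 2 * real N / (real N - 2 * s)"

definition frac_const :: "nat \<Rightarrow> real \<Rightarrow> real" where
  "frac_const N s =
     4 powr s * s * Gamma (real N / 2 + s) / (pi powr (real N / 2) * Gamma (1 - s))"

definition Lp :: "real \<Rightarrow> 'a::euclidean_space set \<Rightarrow> ('a \<Rightarrow> real) set" where
  "Lp p S = {u \<in> borel_measurable (lebesgue_on S). integrable (lebesgue_on S) (\<lambda>x. \<bar>u x\<bar> powr p)}"

definition Lp_norm :: "real \<Rightarrow> 'a::euclidean_space set \<Rightarrow> ('a \<Rightarrow> real) \<Rightarrow> real" where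
  "Lp_norm p S u = (LINT x|lebesgue_on S. \<bar>u x\<bar> powr p) powr (1 / p)"

definition Linf :: "'a::euclidean_space set \<Rightarrow> ('a \<Rightarrow> real) set" where
  "Linf S = {u \<in> borel_measurable (lebesgue_on S). esssup (lebesgue_on S) (\<lambda>x. ereal \<bar>u x\<bar>) < \<infinity>}"

definition Linf_norm :: "'a::euclidean_space set \<Rightarrow> ('a \<Rightarrow> real) \<Rightarrow> real" where
  "Linf_norm S u = real_of_ereal (esssup (lebesgue_on S) (\<lambda>x. ereal \<bar>u x\<bar>))"

text \<open>The fractional Sobolev space on the whole space, i.e. square integrable functions with finite
  Gagliardo seminorm. In the integrands below the quotient takes the value \<open>0\<close> on the diagonal
  \<open>x = y\<close>, a null set.\<close>

definition Hs :: "real \<Rightarrow> ('a::euclidean_space \<Rightarrow> real) set" where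
  "Hs s = {u \<in> Lp 2 UNIV.
     integrable lebesgue
       (\<lambda>(x, y). (u x - u y)\<^sup>2 / norm (x - y) powr (real DIM('a) + 2 * s))}"

definition X0 :: "real \<Rightarrow> 'a::euclidean_space set \<Rightarrow> ('a \<Rightarrow> real) set" where
  "X0 s \<Omega> = {u \<in> Hs s. AE x in lebesgue. x \<notin> \<Omega> \<longrightarrow> u x = 0}"

definition energy :: "real \<Rightarrow> ('a::euclidean_space \<Rightarrow> real) \<Rightarrow> ('a \<Rightarrow> real) \<Rightarrow> real" where
  "energy s u v = frac_const DIM('a) s / 2 *
     (LINT (x, y)|lebesgue.
        (u x - u y) * (v x - v y) / norm (x - y) powr (real DIM('a) + 2 * s))"

definition X0_norm :: "real \<Rightarrow> ('a::euclidean_space \<Rightarrow> real) \<Rightarrow> real" where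
  "X0_norm s u = sqrt (energy s u u)"

text \<open>The dual space. A bounded linear functional takes the same value on functions that agree almost
  everywhere, as their difference has norm \<open>0\<close>; the pairing of \<open>f\<close> with \<open>u\<close> is the value \<open>f u\<close>.
  Values of \<open>f\<close> outside \<open>X0 s \<Omega>\<close> are irrelevant.\<close>

definition dual_X0 :: "real \<Rightarrow> 'a::euclidean_space set \<Rightarrow> (('a \<Rightarrow> real) \<Rightarrow> real) set" where
  "dual_X0 s \<Omega> = {f.
     (\<forall>u\<in>X0 s \<Omega>. \<forall>v\<in>X0 s \<Omega>. f (\<lambda>x. u x + v x) = f u + f v) \<and>
     (\<forall>c. \<forall>u\<in>X0 s \<Omega>. f (\<lambda>x. c * u x) = c * f u) \<and>
     (\<exists>C. \<forall>u\<in>X0 s \<Omega>. \<bar>f u\<bar> \<le> C * X0_norm s u)}"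

definition dual_norm ::
    "real \<Rightarrow> 'a::euclidean_space set \<Rightarrow> (('a \<Rightarrow> real) \<Rightarrow> real) \<Rightarrow> real" where
  "dual_norm s \<Omega> f = (SUP u\<in>{u \<in> X0 s \<Omega>. X0_norm s u \<le> 1}. \<bar>f u\<bar>)"

text \<open>Membership in \<open>Lp\<close> is part of the bound: the Bochner integral in \<open>Lp_norm\<close> would be \<open>0\<close>
  for a function that is not in \<open>Lp\<close>.\<close>

definition embedding_const :: "real \<Rightarrow> 'a::euclidean_space set \<Rightarrow> real \<Rightarrow> real \<Rightarrow> bool" where
  "embedding_const s \<Omega> p C \<longleftrightarrow>
     C > 0 \<and> (\<forall>u\<in>X0 s \<Omega>. u \<in> Lp p \<Omega> \<and> Lp_norm p \<Omega> u \<le> C * X0_norm s u)"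

definition T_op :: "'a::euclidean_space set \<Rightarrow> ('a \<times> 'a \<Rightarrow> real) \<Rightarrow> ('a \<Rightarrow> real) \<Rightarrow> 'a \<Rightarrow> real" where
  "T_op \<Omega> K u x = (LINT y|lebesgue_on \<Omega>. K (x, y) * u y)"

definition B_op ::
    "'a::euclidean_space set \<Rightarrow> real \<Rightarrow> ('a \<times> 'a \<Rightarrow> real) \<Rightarrow> ('a \<Rightarrow> real) \<Rightarrow> 'a \<Rightarrow> real" where
  "B_op \<Omega> q Q u x = (LINT y|lebesgue_on \<Omega>. Q (x, y) * \<bar>u y\<bar> powr q)"

definition N_op ::
    "'a::euclidean_space set \<Rightarrow> real \<Rightarrow> ('a \<times> 'a \<Rightarrow> real) \<Rightarrow> ('a \<Rightarrow> real) \<Rightarrow> 'a \<Rightarrow> real" where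
  "N_op \<Omega> q Q u x = \<bar>u x\<bar> powr (q - 2) * u x * B_op \<Omega> q Q u x"

definition A_form ::
    "real \<Rightarrow> 'a::euclidean_space set \<Rightarrow> ('a \<times> 'a \<Rightarrow> real) \<Rightarrow> ('a \<Rightarrow> real)
      \<Rightarrow> ('a \<Rightarrow> real) \<Rightarrow> ('a \<Rightarrow> real) \<Rightarrow> real" where
  "A_form s \<Omega> K a u v = energy s u v - (LINT x|lebesgue_on \<Omega>. T_op \<Omega> K u x * v x)
     - (LINT x|lebesgue_on \<Omega>. a x * u x * v x)"

definition weak_solution ::
    "real \<Rightarrow> 'a::euclidean_space set \<Rightarrow> ('a \<times> 'a \<Rightarrow> real) \<Rightarrow> ('a \<Rightarrow> real) \<Rightarrow> real \<Rightarrow> real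
      \<Rightarrow> ('a \<times> 'a \<Rightarrow> real) \<Rightarrow> (('a \<Rightarrow> real) \<Rightarrow> real) \<Rightarrow> ('a \<Rightarrow> real) \<Rightarrow> bool" where
  "weak_solution s \<Omega> K a lam q Q f u \<longleftrightarrow>
     u \<in> X0 s \<Omega> \<and>
     (\<forall>\<phi>\<in>X0 s \<Omega>.
        A_form s \<Omega> K a u \<phi> = lam * (LINT x|lebesgue_on \<Omega>. N_op \<Omega> q Q u x * \<phi> x) + f \<phi>)"

end

theory Submission
  imports Defs "HOL-Library.Diagonal_Subsequence"
begin

text \<open>The solution is a fixed point of the map that sends \<open>w\<close> to the Riesz representative of the linear
  functional \<open>F w + f\<close>, where \<open>F w \<phi>\<close> collects the lower-order terms of the weak formulation. The smallness
  condition says that this map sends functions satisfying the \<open>L\<^sup>2\<close> and \<open>L\<^sup>q\<close> bounds of the ball of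
  radius \<open>r\<close> into that ball. To find the fixed point, replace \<open>F u\<close> by \<open>F (P u)\<close>, with \<open>P u\<close> the average
  of \<open>u\<close> over a grid of cubes. By Jensen's inequality \<open>P\<close> preserves the bounds, so Brouwer's theorem,
  applied to the finite vector of averages, gives solutions of the discretized problems. A
  fractional Poincare inequality on cubes, \<open>\<parallel>u - P u\<parallel> = O(h powr s)\<close>, yields both the compactness of the
  embedding and the convergence of the discrete solutions. The passage to the limit in \<open>F\<close> uses only
  almost everywhere convergence and boundedness in the critical Lebesgue space.\<close>

section \<open>Subsequences and fixed points\<close>

text \<open>Existence has to come from compactness: for q < 2 the map t |-> |t|^(q-2) t is not
  Lipschitz at 0, the smallness condition controls the size of the right-hand side but not
  differences, and K and Q need not be symmetric, so neither a contraction nor a variational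
  argument is at hand. The averaging acts on the argument of \<open>F\<close> and not on the
  equation. Riesz representation still takes place in the whole energy space, and the only
  finite-dimensional object is the vector of averages. The price is that step functions jump across
  cube faces and, for s >= 1/2, leave the energy space. Hence \<open>F\<close> is defined on
  L^sigma, sigma being the critical exponent, and the bounds to be preserved are those in L^2 and
  L^q instead of the energy norm. Multiplied by r, the smallness condition reads eta r + gamma
  r^(2q-1) + ||f|| <= r: the functional \<open>F w + f\<close> has dual norm at most r. The strict
  inequality q < sigma bounds the nonlinear integrand in L^(sigma/q) with an exponent above 1, which
  prevents concentration.\<close>

lemma diagonal_convergent_subsequence:
  fixes a :: "nat \<Rightarrow> nat \<Rightarrow> real"
  assumes "\<And>i. bounded (range (\<lambda>n. a n i))"
  shows "\<exists>r. strict_mono r \<and> (\<forall>i. convergent (\<lambda>n. a (r n) i))"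
proof -
  interpret subseqs "\<lambda>i r. convergent (\<lambda>n. a (r n) i)"
  proof
    fix i and s :: "nat \<Rightarrow> nat"
    have "bounded (range (\<lambda>n. a (s n) i))"
      by (rule bounded_subset[OF assms[of i]]) auto
    then obtain l r where "strict_mono r" "((\<lambda>n. a (s n) i) \<circ> r) \<longlonglongrightarrow> l"
      using bounded_imp_convergent_subsequence by blast
    then show "\<exists>r'. strict_mono r' \<and> convergent (\<lambda>n. a ((s \<circ> r') n) i)"
      by (auto simp: o_def convergent_def)
  qed
  have "convergent (\<lambda>n. a (diagseq n) i)" for i
  proof -
    have "convergent (\<lambda>m. a ((s \<circ> r) m) k)"
      if "strict_mono r" "convergent (\<lambda>m. a (s m) k)" for r s :: "nat \<Rightarrow> nat" and k
      using convergent_subseq_convergent[OF that(2,1)] by (simp add: o_def)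
    \<comment> \<open>From index \<open>Suc i\<close> on, the diagonal sequence is a subsequence of
      the one chosen for coordinate \<open>i\<close>; the finitely many earlier terms do not affect
      convergence.\<close>
    then have "convergent (\<lambda>n. a ((diagseq \<circ> (+) (Suc i)) n) i)"
      by (rule diagseq_holds)
    then have "convergent (\<lambda>n. a (diagseq (n + Suc i)) i)"
      by (simp only: o_def add.commute[of "Suc i"])
    then show ?thesis
      using convergent_ignore_initial_segment[of "\<lambda>n. a (diagseq n) i" "Suc i"] by simp
  qed
  then show ?thesis using subseq_diagseq by blast
qed

text \<open>The dimension is the number of cubes of a grid, hence a variable: points are coded as
  sequences of which \<open>n\<close> coordinates are to be fixed, and continuity is sequential.
  Kuhn's labelling lemma is applied on grids of mesh 1/p. For each coordinate it yields two vertices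
  of one cell that \<open>G\<close> pushes in opposite directions, and these inequalities survive
  the limit.\<close>

lemma brouwer_unit_box:
  fixes G :: "(nat \<Rightarrow> real) \<Rightarrow> nat \<Rightarrow> real" and n :: nat
  assumes G: "\<And>x i. \<lbrakk>\<And>j. 0 \<le> x j \<and> x j \<le> 1; i < n\<rbrakk> \<Longrightarrow> 0 \<le> G x i \<and> G x i \<le> 1"
    and cont: "\<And>X x i. \<lbrakk>\<And>k j. 0 \<le> X k j \<and> X k j \<le> 1; \<And>j. 0 \<le> x j \<and> x j \<le> 1;
      \<And>j. (\<lambda>k. X k j) \<longlonglongrightarrow> x j; i < n\<rbrakk> \<Longrightarrow> (\<lambda>k. G (X k) i) \<longlonglongrightarrow> G x i"
  shows "\<exists>x. (\<forall>j. 0 \<le> x j \<and> x j \<le> 1) \<and> (\<forall>i<n. G x i = x i)"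
proof -
  define pt :: "nat \<Rightarrow> (nat \<Rightarrow> nat) \<Rightarrow> nat \<Rightarrow> real"
    where "pt p z j = (if j < n then min 1 (real (z j) / real p) else 0)" for p z j
  define near :: "(nat \<Rightarrow> nat) \<Rightarrow> (nat \<Rightarrow> nat) \<Rightarrow> bool"
    where "near q r \<longleftrightarrow> (\<forall>j<n. q j \<le> r j \<and> r j \<le> q j + 1)" for q r
  have pt01: "0 \<le> pt p z j \<and> pt p z j \<le> 1" for p z j
    by (auto simp: pt_def)
  have "\<exists>q R S. \<forall>i<n. near q (R i) \<and> near q (S i) \<and>
      pt p (R i) i \<le> G (pt p (R i)) i \<and> G (pt p (S i)) i \<le> pt p (S i) i" if p: "p > 0" for p
  proof -
    \<comment> \<open>Label 0 means that \<open>G\<close> does not decrease coordinate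
      \<open>i\<close>, label 1 that it does not increase it. On the faces \<open>z i = 0\<close>
      and \<open>z i = p\<close> Kuhn's lemma prescribes the label; the prescribed value is correct
      there because \<open>G\<close> takes values in [0,1].\<close>
    define label :: "(nat \<Rightarrow> nat) \<Rightarrow> nat \<Rightarrow> nat" where
      "label z i = (if z i = 0 \<or> (z i \<noteq> p \<and> pt p z i \<le> G (pt p z) i) then 0 else 1)" for z i
    have G01: "i < n \<Longrightarrow> 0 \<le> G (pt p z) i \<and> G (pt p z) i \<le> 1" for z i
      by (rule G[OF pt01])
    have pt0: "z i = 0 \<Longrightarrow> pt p z i = 0" for z i
      by (simp add: pt_def)
    have pt1: "z i = p \<Longrightarrow> i < n \<Longrightarrow> pt p z i = 1" for z i
      using p by (simp add: pt_def)
    have l0: "label z i = 0 \<Longrightarrow> i < n \<Longrightarrow> pt p z i \<le> G (pt p z) i" for z i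
      using G01[of i z] pt0[of z i] by (cases "z i = 0") (simp_all add: label_def split: if_splits)
    have l1: "label z i = 1 \<Longrightarrow> i < n \<Longrightarrow> G (pt p z) i \<le> pt p z i" for z i
      using G01[of i z] pt1[of z i] by (cases "z i = p") (simp_all add: label_def split: if_splits)
    have l01: "label z i = 0 \<or> label z i = 1" for z i
      by (simp add: label_def)
    have "\<exists>q. \<forall>i<n. \<exists>r s. near q r \<and> near q s \<and> label r i \<noteq> label s i"
      unfolding near_def
    proof (rule kuhn_lemma[OF p, of n label])
      show "\<forall>x. (\<forall>i<n. x i \<le> p) \<longrightarrow> (\<forall>i<n. x i = 0 \<longrightarrow> label x i = 0)"
        "\<forall>x. (\<forall>i<n. x i \<le> p) \<longrightarrow> (\<forall>i<n. x i = p \<longrightarrow> label x i = 1)"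
        using p by (simp_all add: label_def)
    qed (use l01 in blast)+
    then obtain q where q: "\<And>i. i < n \<Longrightarrow> \<exists>r s. near q r \<and> near q s \<and> label r i \<noteq> label s i"
      by auto
    have "\<exists>r s. near q r \<and> near q s \<and> pt p r i \<le> G (pt p r) i \<and> G (pt p s) i \<le> pt p s i"
      if i: "i < n" for i
    proof -
      obtain r s where rs: "near q r" "near q s" "label r i \<noteq> label s i"
        using q[OF i] by blast
      then have "label r i = 0 \<and> label s i = 1 \<or> label s i = 0 \<and> label r i = 1"
        using l01[of r i] l01[of s i] by auto
      then show ?thesis
        using rs l0[OF _ i] l1[OF _ i] by blast
    qed
    then have "\<forall>i. \<exists>r s. i < n \<longrightarrow> near q r \<and> near q s \<and> pt p r i \<le> G (pt p r) i \<and> G (pt p s) i \<le> pt p s i"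
      by blast
    from choice[OF this] obtain R where "\<forall>i. \<exists>s. i < n \<longrightarrow> near q (R i) \<and> near q s \<and>
      pt p (R i) i \<le> G (pt p (R i)) i \<and> G (pt p s) i \<le> pt p s i" ..
    from choice[OF this] show ?thesis by blast
  qed
  then have "\<forall>p. \<exists>q R S. \<forall>i<n. near q (R i) \<and> near q (S i) \<and>
      pt (Suc p) (R i) i \<le> G (pt (Suc p) (R i)) i \<and> G (pt (Suc p) (S i)) i \<le> pt (Suc p) (S i) i"
    by simp
  from choice[OF this] obtain q where "\<forall>p. \<exists>R S. \<forall>i<n. near (q p) (R i) \<and> near (q p) (S i) \<and>
      pt (Suc p) (R i) i \<le> G (pt (Suc p) (R i)) i \<and> G (pt (Suc p) (S i)) i \<le> pt (Suc p) (S i) i" ..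
  from choice[OF this] obtain R where "\<forall>p. \<exists>S. \<forall>i<n. near (q p) (R p i) \<and> near (q p) (S i) \<and>
      pt (Suc p) (R p i) i \<le> G (pt (Suc p) (R p i)) i \<and> G (pt (Suc p) (S i)) i \<le> pt (Suc p) (S i) i" ..
  from choice[OF this] obtain S where qRS: "\<And>p i. i < n \<Longrightarrow> near (q p) (R p i) \<and> near (q p) (S p i) \<and>
      pt (Suc p) (R p i) i \<le> G (pt (Suc p) (R p i)) i \<and> G (pt (Suc p) (S p i)) i \<le> pt (Suc p) (S p i) i"
    by blast
  define X where "X p = pt (Suc p) (q p)" for p
  have "bounded (range (\<lambda>p. X p j))" for j
    using pt01 by (intro boundedI[where B = 1]) (force simp: X_def)
  then obtain \<sigma> where \<sigma>: "strict_mono \<sigma>" "\<And>j. convergent (\<lambda>p. X (\<sigma> p) j)"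
    using diagonal_convergent_subsequence[of X] by blast
  define x where "x j = lim (\<lambda>p. X (\<sigma> p) j)" for j
  have Xx: "(\<lambda>p. X (\<sigma> p) j) \<longlonglongrightarrow> x j" for j
    using \<sigma>(2)[of j] by (simp add: x_def convergent_LIMSEQ_iff)
  have x01: "0 \<le> x j \<and> x j \<le> 1" for j
    using LIMSEQ_le_const[OF Xx[of j], of 0] LIMSEQ_le_const2[OF Xx[of j], of 1] pt01
    by (auto simp: X_def)
  \<comment> \<open>Vertices of a cell are within 1/(p+1) of its base corner in each coordinate, so
    any choice of vertices has the same limit as the corners.\<close>
  have close: "(\<lambda>p. pt (Suc (\<sigma> p)) (Z (\<sigma> p)) j) \<longlonglongrightarrow> x j"
    if Z: "\<And>p. near (q p) (Z p)" for Z j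
  proof -
    have d: "\<bar>pt (Suc p) (Z p) j - X p j\<bar> \<le> inverse (real (Suc p))" for p
    proof (cases "j < n")
      case True
      have "real (q p j) \<le> real (Z p j)" "real (Z p j) \<le> real (q p j) + 1"
        using Z[of p] True unfolding near_def by auto
      then have "real (q p j) / real (Suc p) \<le> real (Z p j) / real (Suc p)"
        "real (Z p j) / real (Suc p) \<le> real (q p j) / real (Suc p) + inverse (real (Suc p))"
        by (auto simp: inverse_eq_divide add_divide_distrib[symmetric] intro!: divide_right_mono)
      then show ?thesis using True by (simp add: pt_def X_def)
    qed (simp add: pt_def X_def)
    have "(\<lambda>p. inverse (real (Suc (\<sigma> p)))) \<longlonglongrightarrow> 0"
      using LIMSEQ_subseq_LIMSEQ[OF LIMSEQ_inverse_real_of_nat \<sigma>(1)] by (simp add: o_def)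
    then have "(\<lambda>p. pt (Suc (\<sigma> p)) (Z (\<sigma> p)) j - X (\<sigma> p) j) \<longlonglongrightarrow> 0"
      by (rule Lim_null_comparison[rotated]) (use d in auto)
    from tendsto_add[OF this Xx[of j]] show ?thesis by simp
  qed
  have "G x i = x i" if "i < n" for i
  proof (rule antisym)
    have c1: "\<And>j. (\<lambda>p. pt (Suc (\<sigma> p)) (R (\<sigma> p) i) j) \<longlonglongrightarrow> x j"
      using qRS[OF that] by (intro close[of "\<lambda>p. R p i"]) blast
    have "(\<lambda>p. G (pt (Suc (\<sigma> p)) (R (\<sigma> p) i)) i) \<longlonglongrightarrow> G x i"
      by (intro cont pt01 x01 c1 that)
    then show "x i \<le> G x i"
      using qRS[OF that] by (intro LIMSEQ_le[OF c1]) blast+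
    have c2: "\<And>j. (\<lambda>p. pt (Suc (\<sigma> p)) (S (\<sigma> p) i) j) \<longlonglongrightarrow> x j"
      using qRS[OF that] by (intro close[of "\<lambda>p. S p i"]) blast
    have "(\<lambda>p. G (pt (Suc (\<sigma> p)) (S (\<sigma> p) i)) i) \<longlonglongrightarrow> G x i"
      by (intro cont pt01 x01 c2 that)
    then show "G x i \<le> x i"
      using qRS[OF that] by (intro LIMSEQ_le[OF _ c2]) blast+
  qed
  with x01 show ?thesis by blast
qed

lemma brouwer_box:
  fixes G :: "(nat \<Rightarrow> real) \<Rightarrow> nat \<Rightarrow> real" and n :: nat
  assumes "M > 0"
    and G: "\<And>x i. \<lbrakk>\<And>j. \<bar>x j\<bar> \<le> M; i < n\<rbrakk> \<Longrightarrow> \<bar>G x i\<bar> \<le> M"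
    and cont: "\<And>X x i. \<lbrakk>\<And>k j. \<bar>X k j\<bar> \<le> M; \<And>j. \<bar>x j\<bar> \<le> M;
      \<And>j. (\<lambda>k. X k j) \<longlonglongrightarrow> x j; i < n\<rbrakk> \<Longrightarrow> (\<lambda>k. G (X k) i) \<longlonglongrightarrow> G x i"
  shows "\<exists>x. (\<forall>j. \<bar>x j\<bar> \<le> M) \<and> (\<forall>i<n. G x i = x i)"
proof -
  define T :: "(nat \<Rightarrow> real) \<Rightarrow> nat \<Rightarrow> real" where "T x j = M * (2 * x j - 1)" for x j
  have T: "\<bar>T x j\<bar> \<le> M" if "0 \<le> x j \<and> x j \<le> 1" for x :: "nat \<Rightarrow> real" and j
  proof -
    have "\<bar>2 * x j - 1\<bar> \<le> 1" using that by auto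
    then show ?thesis using \<open>M > 0\<close> by (auto simp: T_def abs_mult intro: mult_left_le)
  qed
  have "\<exists>x. (\<forall>j. 0 \<le> x j \<and> x j \<le> 1) \<and> (\<forall>i<n. (G (T x) i / M + 1) / 2 = x i)"
  proof (rule brouwer_unit_box)
    fix x :: "nat \<Rightarrow> real" and i assume "\<And>j. 0 \<le> x j \<and> x j \<le> 1" "i < n"
    then have "\<bar>G (T x) i\<bar> \<le> M" by (intro G T) auto
    then have "G (T x) i / M \<le> 1" "- 1 \<le> G (T x) i / M"
      using \<open>M > 0\<close> by (auto simp: field_simps)
    then show "0 \<le> (G (T x) i / M + 1) / 2 \<and> (G (T x) i / M + 1) / 2 \<le> 1" by auto
  next
    fix X :: "nat \<Rightarrow> nat \<Rightarrow> real" and x i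
    assume *: "\<And>k j. 0 \<le> X k j \<and> X k j \<le> 1" "\<And>j. 0 \<le> x j \<and> x j \<le> 1"
      "\<And>j. (\<lambda>k. X k j) \<longlonglongrightarrow> x j" "i < n"
    have "(\<lambda>k. G (T (X k)) i) \<longlonglongrightarrow> G (T x) i"
    proof (rule cont)
      show "\<And>j. (\<lambda>k. T (X k) j) \<longlonglongrightarrow> T x j"
        unfolding T_def by (intro tendsto_intros *)
    qed (use * T in auto)
    then show "(\<lambda>k. (G (T (X k)) i / M + 1) / 2) \<longlonglongrightarrow> (G (T x) i / M + 1) / 2"
      using \<open>M > 0\<close> by (intro tendsto_intros) auto
  qed
  then obtain x where x: "\<And>j. 0 \<le> x j \<and> x j \<le> 1" "\<And>i. i < n \<Longrightarrow> (G (T x) i / M + 1) / 2 = x i" by blast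
  have "G (T x) i = T x i" if "i < n" for i
    using x(2)[OF that] \<open>M > 0\<close> unfolding T_def by (simp add: field_simps)
  then show ?thesis using T x(1) by (intro exI[of _ "T x"]) auto
qed

text \<open>The classical argument for completeness of L^1: consecutive distances below 2^(-k) along
  a subsequence make the sum of the absolute differences integrable, hence finite almost everywhere,
  and the telescoping series converges there.\<close>

lemma L1_Cauchy_AE_subseq:
  fixes u :: "nat \<Rightarrow> 'a \<Rightarrow> real"
  assumes int: "\<And>n. integrable M (u n)"
    and Cauchy: "\<And>e. e > 0 \<Longrightarrow> \<exists>N. \<forall>m\<ge>N. \<forall>n\<ge>N. (LINT x|M. \<bar>u m x - u n x\<bar>) < e"
  shows "\<exists>r v. strict_mono r \<and> v \<in> borel_measurable M \<and> (AE x in M. (\<lambda>n. u (r n) x) \<longlonglongrightarrow> v x)"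
proof -
  have "\<exists>N. \<forall>m\<ge>N. \<forall>n\<ge>N. (LINT x|M. \<bar>u m x - u n x\<bar>) < (1/2)^k" for k
    by (rule Cauchy) simp
  then obtain N where N: "\<And>k m n. m \<ge> N k \<Longrightarrow> n \<ge> N k \<Longrightarrow> (LINT x|M. \<bar>u m x - u n x\<bar>) < (1/2)^k"
    by metis
  define r where "r = rec_nat (N 0) (\<lambda>k p. max (Suc p) (N (Suc k)))"
  have r: "r 0 = N 0" "\<And>k. r (Suc k) = max (Suc (r k)) (N (Suc k))" by (auto simp: r_def)
  have sm: "strict_mono r" by (auto simp: strict_mono_Suc_iff r)
  have rN: "r k \<ge> N k" for k by (cases k) (auto simp: r)
  have d: "(LINT x|M. \<bar>u (r (Suc k)) x - u (r k) x\<bar>) < (1/2)^k" for k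
    by (rule N) (use rN[of k] r(2)[of k] in auto)
  define D where "D k x = u (r (Suc k)) x - u (r k) x" for k x
  have Dint: "integrable M (D k)" for k unfolding D_def using int by auto
  have [measurable]: "D k \<in> borel_measurable M" for k using Dint by auto
  have [measurable]: "u k \<in> borel_measurable M" for k using int by auto
  have "(\<integral>\<^sup>+x. (\<Sum>k. ennreal \<bar>D k x\<bar>) \<partial>M) = (\<Sum>k. \<integral>\<^sup>+x. ennreal \<bar>D k x\<bar> \<partial>M)"
    by (intro nn_integral_suminf) auto
  also have "\<dots> = (\<Sum>k. ennreal (LINT x|M. \<bar>D k x\<bar>))"
    using Dint by (intro suminf_cong nn_integral_eq_integral) auto
  also have "\<dots> \<le> (\<Sum>k. ennreal ((1/2)^k))"
    using d by (intro suminf_le) (auto simp: D_def less_imp_le intro!: ennreal_leI)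
  also have "\<dots> < \<infinity>"
    by (subst suminf_ennreal_eq[OF _ geometric_sums]) auto
  finally have "AE x in M. (\<Sum>k. ennreal \<bar>D k x\<bar>) \<noteq> \<infinity>"
    by (intro nn_integral_PInf_AE) auto
  then have conv: "AE x in M. convergent (\<lambda>n. u (r n) x)"
  proof eventually_elim
    case (elim x)
    then have "summable (\<lambda>k. \<bar>D k x\<bar>)"
      by (intro summable_suminf_not_top) auto
    then have "summable (\<lambda>k. D k x)" by (rule summable_rabs_cancel)
    then have "convergent (\<lambda>n. \<Sum>k<n. D k x)" by (simp add: summable_iff_convergent)
    then have "convergent (\<lambda>n. u (r n) x - u (r 0) x)"
      using sum_lessThan_telescope[of "\<lambda>k. u (r k) x"] by (simp add: D_def)
    then have "convergent (\<lambda>n. (u (r n) x - u (r 0) x) + u (r 0) x)"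
      by (intro convergent_add convergent_const)
    then show ?case by simp
  qed
  define v where "v x = lim (\<lambda>n. u (r n) x)" for x
  have "v \<in> borel_measurable M" unfolding v_def by measurable
  moreover have "AE x in M. (\<lambda>n. u (r n) x) \<longlonglongrightarrow> v x"
    using conv by eventually_elim (simp add: v_def convergent_LIMSEQ_iff)
  ultimately show ?thesis using sm by blast
qed

section \<open>Measure theory\<close>

text \<open>Fatou's lemma for Bochner integrals. Integrability of the limit belongs to the
  conclusion, since the integral of a non-integrable function is 0 and a bound on it would say
  nothing.\<close>

lemma fatou_integral_bound:
  fixes f :: "nat \<Rightarrow> 'a \<Rightarrow> real"
  assumes int: "\<And>n. integrable M (f n)" and g[measurable]: "g \<in> borel_measurable M"
    and nonneg: "\<And>n x. 0 \<le> f n x"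
    and lim: "AE x in M. (\<lambda>n. f n x) \<longlonglongrightarrow> g x"
    and bd: "\<And>n. (LINT x|M. f n x) \<le> B"
  shows "integrable M g" "(LINT x|M. g x) \<le> B"
proof -
  have [measurable]: "f n \<in> borel_measurable M" for n using int by auto
  have B0: "0 \<le> B" using bd[of 0] Bochner_Integration.integral_nonneg[of M "f 0"] nonneg by (smt (verit))
  have g0: "AE x in M. 0 \<le> g x"
    using lim by eventually_elim (use nonneg in \<open>blast intro: LIMSEQ_le_const\<close>)
  have "(\<integral>\<^sup>+x. ennreal (g x) \<partial>M) = (\<integral>\<^sup>+x. liminf (\<lambda>n. ennreal (f n x)) \<partial>M)"
  proof (rule nn_integral_cong_AE)
    show "AE x in M. ennreal (g x) = liminf (\<lambda>n. ennreal (f n x))"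
      using lim
    proof eventually_elim
      case (elim x)
      then have "(\<lambda>n. ennreal (f n x)) \<longlonglongrightarrow> ennreal (g x)" by (intro tendsto_ennrealI)
      then show ?case by (intro lim_imp_Liminf[symmetric]) auto
    qed
  qed
  also have "\<dots> \<le> liminf (\<lambda>n. \<integral>\<^sup>+x. ennreal (f n x) \<partial>M)"
    by (intro nn_integral_liminf) auto
  also have "\<dots> \<le> ennreal B"
    using int nonneg bd
    by (intro Liminf_le) (auto simp: nn_integral_eq_integral intro!: ennreal_leI always_eventually)
  finally have le: "(\<integral>\<^sup>+x. ennreal (g x) \<partial>M) \<le> ennreal B" .
  show gi: "integrable M g"
    using le g0 by (intro integrableI_nonneg) (auto simp: top.extremum_unique less_top intro: le_less_trans)
  have "ennreal (LINT x|M. g x) \<le> ennreal B"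
    using le nn_integral_eq_integral[OF gi g0] by simp
  then show "(LINT x|M. g x) \<le> B" using B0 by simp
qed

text \<open>Boundedness in \<open>L\<^sup>\<theta>\<close> with \<open>\<theta> > 1\<close> gives uniform integrability: cutting off at height \<open>M\<close> costs at
  most \<open>M powr (1 - \<theta>)\<close> times the bound.\<close>

lemma (in finite_measure) integral_tendsto_powr_bounded:
  fixes f :: "nat \<Rightarrow> 'a \<Rightarrow> real"
  assumes f[measurable]: "\<And>n. f n \<in> borel_measurable M" and g[measurable]: "g \<in> borel_measurable M"
    and lim: "AE x in M. (\<lambda>n. f n x) \<longlonglongrightarrow> g x"
    and "1 < \<theta>"
    and int: "\<And>n. integrable M (\<lambda>x. \<bar>f n x\<bar> powr \<theta>)"
    and bd: "\<And>n. (LINT x|M. \<bar>f n x\<bar> powr \<theta>) \<le> B"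
  shows "(\<lambda>n. LINT x|M. f n x) \<longlonglongrightarrow> (LINT x|M. g x)"
proof -
  have gint: "integrable M (\<lambda>x. \<bar>g x\<bar> powr \<theta>)" and gbd: "(LINT x|M. \<bar>g x\<bar> powr \<theta>) \<le> B"
  proof -
    have l: "AE x in M. (\<lambda>n. \<bar>f n x\<bar> powr \<theta>) \<longlonglongrightarrow> \<bar>g x\<bar> powr \<theta>"
      using lim by eventually_elim (use \<open>1 < \<theta>\<close> in \<open>intro tendsto_powr' tendsto_rabs, auto\<close>)
    show "integrable M (\<lambda>x. \<bar>g x\<bar> powr \<theta>)" "(LINT x|M. \<bar>g x\<bar> powr \<theta>) \<le> B"
      using fatou_integral_bound[OF int _ _ l bd] by auto
  qed
  have le1: "\<bar>y\<bar> \<le> 1 + \<bar>y\<bar> powr \<theta>" for y :: real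
  proof (cases "\<bar>y\<bar> \<le> 1")
    case False
    then have "\<bar>y\<bar> powr 1 \<le> \<bar>y\<bar> powr \<theta>" using \<open>1 < \<theta>\<close> by (intro powr_mono) auto
    then show ?thesis using False by simp
  qed (simp add: add_increasing2)
  have int1: "integrable M k" if [measurable]: "k \<in> borel_measurable M"
    and "integrable M (\<lambda>x. \<bar>k x\<bar> powr \<theta>)" for k :: "'a \<Rightarrow> real"
    by (rule Bochner_Integration.integrable_bound[of M "\<lambda>x. 1 + \<bar>k x\<bar> powr \<theta>"])
       (use le1 that in \<open>auto simp: abs_of_nonneg add_nonneg_nonneg\<close>)
  define t where "t K y = max (- K) (min K y)" for K y :: real
  have tb: "\<bar>t K y\<bar> \<le> K" if "K > 0" for K y using that by (auto simp: t_def)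
  \<comment> \<open>Above height \<open>K\<close> write |y| = |y|^theta |y|^(1 - theta); the second
    exponent is negative, so that factor is at most \<open>K powr (1 - \<theta>)\<close>.\<close>
  have td: "\<bar>y - t K y\<bar> \<le> \<bar>y\<bar> powr \<theta> * K powr (1 - \<theta>)" if "K > 0" for K y
  proof (cases "\<bar>y\<bar> \<le> K")
    case True then show ?thesis by (auto simp: t_def)
  next
    case False
    have "\<bar>y - t K y\<bar> \<le> \<bar>y\<bar>" using False that by (auto simp: t_def)
    also have "\<dots> = \<bar>y\<bar> powr \<theta> * \<bar>y\<bar> powr (1 - \<theta>)"
      using False that by (simp flip: powr_add)
    also have "\<dots> \<le> \<bar>y\<bar> powr \<theta> * K powr (1 - \<theta>)"
      using False that \<open>1 < \<theta>\<close> by (intro mult_left_mono powr_mono2') auto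
    finally show ?thesis .
  qed
  have [measurable]: "t K \<in> borel_measurable borel" for K unfolding t_def by measurable
  have it: "integrable M (\<lambda>x. t K (k x))" if "K > 0" and [measurable]: "k \<in> borel_measurable M" for k :: "'a \<Rightarrow> real" and K
    by (rule integrable_const_bound[where B = K]) (use tb that in auto)
  have tdi: "\<bar>(LINT x|M. k x) - (LINT x|M. t K (k x))\<bar> \<le> B * K powr (1 - \<theta>)"
    if "K > 0" and [measurable]: "k \<in> borel_measurable M"
    and ki: "integrable M (\<lambda>x. \<bar>k x\<bar> powr \<theta>)" and kb: "(LINT x|M. \<bar>k x\<bar> powr \<theta>) \<le> B" for k :: "'a \<Rightarrow> real" and K
  proof -
    have "\<bar>(LINT x|M. k x) - (LINT x|M. t K (k x))\<bar> = \<bar>LINT x|M. k x - t K (k x)\<bar>"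
      using int1[OF that(2) ki] it[OF that(1,2)] by simp
    also have "\<dots> \<le> (LINT x|M. \<bar>k x\<bar> powr \<theta> * K powr (1 - \<theta>))"
      by (rule order_trans[OF integral_abs_bound])
        (use ki td[OF that(1)] int1[OF that(2) ki] it[OF that(1,2)] in \<open>intro integral_mono, auto\<close>)
    also have "\<dots> \<le> B * K powr (1 - \<theta>)"
      using kb by (simp add: mult_right_mono)
    finally show ?thesis .
  qed
  show ?thesis
  proof (rule LIMSEQ_I)
    fix e :: real assume "e > 0"
    have "((\<lambda>K. B * K powr (1 - \<theta>)) \<longlongrightarrow> B * 0) at_top"
      using \<open>1 < \<theta>\<close> by (intro tendsto_mult tendsto_const tendsto_neg_powr filterlim_ident) auto
    then have "\<forall>\<^sub>F K in at_top. B * K powr (1 - \<theta>) < e / 3"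
      using \<open>e > 0\<close> by (intro order_tendstoD) auto
    then have "\<forall>\<^sub>F K in at_top. K > 0 \<and> B * K powr (1 - \<theta>) < e / 3"
      using eventually_gt_at_top[of 0] by eventually_elim simp
    then obtain K where K: "K > 0" "B * K powr (1 - \<theta>) < e / 3"
      by (auto dest: eventually_happens)
    have "(\<lambda>n. LINT x|M. t K (f n x)) \<longlonglongrightarrow> (LINT x|M. t K (g x))"
    proof (rule integral_dominated_convergence[where w = "\<lambda>_. K"])
      show "AE x in M. (\<lambda>n. t K (f n x)) \<longlonglongrightarrow> t K (g x)"
        using lim by eventually_elim (auto simp: t_def intro!: tendsto_intros)
    qed (use tb K in auto)
    from LIMSEQ_D[OF this, of "e / 3"] \<open>e > 0\<close>
    obtain N where N: "\<forall>n\<ge>N. norm ((LINT x|M. t K (f n x)) - (LINT x|M. t K (g x))) < e / 3" by auto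
    have "norm ((LINT x|M. f n x) - (LINT x|M. g x)) < e" if "n \<ge> N" for n
      using N[rule_format, OF that] tdi[OF K(1) f int bd, of n] tdi[OF K(1) g gint gbd] K(2)
      unfolding real_norm_def by linarith
    then show "\<exists>no. \<forall>n\<ge>no. norm ((LINT x|M. f n x) - (LINT x|M. g x)) < e" by blast
  qed
qed

text \<open>Hoelder's inequality for the exponents p/(p - 1) and p. Upper bounds
  \<open>\<alpha>\<close> and \<open>\<beta>\<close> replace the norms, so that the bounds supplied
  by an embedding can be inserted directly.\<close>

lemma holder_bound:
  fixes u v :: "'a \<Rightarrow> real"
  assumes [measurable]: "u \<in> borel_measurable M" "v \<in> borel_measurable M" and "1 < p"
    and u: "integrable M (\<lambda>x. \<bar>u x\<bar> powr p)" "(LINT x|M. \<bar>u x\<bar> powr p) \<le> \<alpha> powr p" "0 \<le> \<alpha>"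
    and v: "integrable M (\<lambda>x. \<bar>v x\<bar> powr p)" "(LINT x|M. \<bar>v x\<bar> powr p) \<le> \<beta> powr p" "0 \<le> \<beta>"
  shows "integrable M (\<lambda>x. \<bar>u x\<bar> powr (p - 1) * \<bar>v x\<bar>)"
    and "(LINT x|M. \<bar>u x\<bar> powr (p - 1) * \<bar>v x\<bar>) \<le> \<alpha> powr (p - 1) * \<beta>"
proof -
  have "integrable M (\<lambda>x. \<bar>u x\<bar> powr (p - 1) * \<bar>v x\<bar>) \<and>
    (LINT x|M. \<bar>u x\<bar> powr (p - 1) * \<bar>v x\<bar>) \<le> \<alpha> powr (p - 1) * \<beta>"
  proof (cases "\<alpha> = 0 \<or> \<beta> = 0")
    case True
    \<comment> \<open>A vanishing bound rules out the normalization used in the other case; here one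
      of the two functions is zero almost everywhere.\<close>
    have z: "AE x in M. k x = 0" if "integrable M (\<lambda>x. \<bar>k x\<bar> powr p)" "(LINT x|M. \<bar>k x\<bar> powr p) \<le> 0 powr p"
      for k :: "'a \<Rightarrow> real"
    proof -
      have "(LINT x|M. \<bar>k x\<bar> powr p) = 0"
        using that(2) by (intro antisym) (auto intro: integral_nonneg_AE)
      then show ?thesis using that(1) by (subst (asm) integral_nonneg_eq_0_iff_AE) auto
    qed
    have "(AE x in M. u x = 0) \<or> (AE x in M. v x = 0)"
      using True z[of u] z[of v] u v by auto
    then have ae: "AE x in M. \<bar>u x\<bar> powr (p - 1) * \<bar>v x\<bar> = 0"
      by (auto elim: eventually_mono)
    then have "integrable M (\<lambda>x. \<bar>u x\<bar> powr (p - 1) * \<bar>v x\<bar>) \<longleftrightarrow> integrable M (\<lambda>x. 0::real)"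
      "(LINT x|M. \<bar>u x\<bar> powr (p - 1) * \<bar>v x\<bar>) = (LINT x|M. (0::real))"
      by (intro integrable_cong_AE integral_cong_AE; auto)+
    then show ?thesis using v(3) by simp
  next
    case False
    then have a: "\<alpha> > 0" and b: "\<beta> > 0" using u v by auto
    \<comment> \<open>Right-hand side of Young's inequality for |v| / \<beta> and (|u| /
      \<alpha>)^(p - 1); its integral is at most 1/p + (p - 1)/p = 1.\<close>
    define w where "w x = (\<bar>v x\<bar> powr p / \<beta> powr p) / p + (\<bar>u x\<bar> powr p / \<alpha> powr p) / (p / (p - 1))" for x
    have young: "\<bar>u x\<bar> powr (p - 1) * \<bar>v x\<bar> \<le> \<alpha> powr (p - 1) * \<beta> * w x" for x
    proof -
      have "(\<bar>v x\<bar> / \<beta>) * ((\<bar>u x\<bar> / \<alpha>) powr (p - 1)) \<le>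
          (\<bar>v x\<bar> / \<beta>) powr p / p + ((\<bar>u x\<bar> / \<alpha>) powr (p - 1)) powr (p / (p - 1)) / (p / (p - 1))"
        using \<open>1 < p\<close> a b by (intro Youngs_inequality) (auto simp: field_simps)
      also have "\<dots> = w x"
        using \<open>1 < p\<close> a b by (simp add: w_def powr_powr powr_divide)
      finally have "\<alpha> powr (p - 1) * \<beta> * ((\<bar>v x\<bar> / \<beta>) * ((\<bar>u x\<bar> / \<alpha>) powr (p - 1))) \<le> \<alpha> powr (p - 1) * \<beta> * w x"
        using b by (intro mult_left_mono) auto
      also have "\<alpha> powr (p - 1) * \<beta> * ((\<bar>v x\<bar> / \<beta>) * ((\<bar>u x\<bar> / \<alpha>) powr (p - 1))) = \<bar>u x\<bar> powr (p - 1) * \<bar>v x\<bar>"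
        using a b by (simp add: powr_divide)
      finally show ?thesis .
    qed
    have wi: "integrable M w" unfolding w_def using u v by simp
    have "(LINT x|M. w x) = ((LINT x|M. \<bar>v x\<bar> powr p) / \<beta> powr p) / p + ((LINT x|M. \<bar>u x\<bar> powr p) / \<alpha> powr p) / (p / (p - 1))"
      unfolding w_def using u v by (subst Bochner_Integration.integral_add) auto
    also have "\<dots> \<le> 1 / p + 1 / (p / (p - 1))"
      using u v a b \<open>1 < p\<close> by (intro add_mono divide_right_mono) (auto simp: divide_le_eq_1)
    also have "\<dots> = 1" using \<open>1 < p\<close> by (simp add: field_simps)
    finally have w1: "(LINT x|M. w x) \<le> 1" .
    have yn: "norm (\<bar>u x\<bar> powr (p - 1) * \<bar>v x\<bar>) \<le> norm (\<alpha> powr (p - 1) * \<beta> * w x)" for x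
      using young[of x] by (simp add: abs_of_nonneg del: abs_mult)
    have i: "integrable M (\<lambda>x. \<bar>u x\<bar> powr (p - 1) * \<bar>v x\<bar>)"
      by (rule Bochner_Integration.integrable_bound[of M "\<lambda>x. \<alpha> powr (p - 1) * \<beta> * w x"])
        (use wi yn in auto)
    have "(LINT x|M. \<bar>u x\<bar> powr (p - 1) * \<bar>v x\<bar>) \<le> (LINT x|M. \<alpha> powr (p - 1) * \<beta> * w x)"
      by (intro integral_mono i young integrable_mult_right wi)
    also have "\<dots> \<le> \<alpha> powr (p - 1) * \<beta>"
      using w1 b by (simp add: mult_left_le)
    finally show ?thesis using i by blast
  qed
  then show "integrable M (\<lambda>x. \<bar>u x\<bar> powr (p - 1) * \<bar>v x\<bar>)"
    "(LINT x|M. \<bar>u x\<bar> powr (p - 1) * \<bar>v x\<bar>) \<le> \<alpha> powr (p - 1) * \<beta>" by auto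
qed

text \<open>Jensen's inequality for the mean over \<open>A\<close>, multiplied out so that
  \<open>A\<close> may be a null set. It is Hoelder's inequality with the indicator as the factor
  that carries the power p - 1.\<close>

lemma (in finite_measure) set_integral_powr_le:
  fixes u :: "'a \<Rightarrow> real"
  assumes [measurable]: "u \<in> borel_measurable M" "A \<in> sets M" and "1 < p"
    and u: "integrable M (\<lambda>x. \<bar>u x\<bar> powr p)"
  shows "integrable M (\<lambda>x. indicator A x * u x)"
    and "\<bar>LINT x|M. indicator A x * u x\<bar> powr p \<le>
      measure M A powr (p - 1) * (LINT x|M. indicator A x * \<bar>u x\<bar> powr p)"
proof -
  let ?I = "LINT x|M. indicator A x * \<bar>u x\<bar> powr p"
  have ia: "(\<lambda>x. \<bar>indicator A x :: real\<bar> powr p) = indicator A"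
    using \<open>1 < p\<close> by (auto simp: indicator_def)
  have iu: "(\<lambda>x. \<bar>indicator A x * u x\<bar> powr p) = (\<lambda>x. indicator A x * \<bar>u x\<bar> powr p)"
    using \<open>1 < p\<close> by (auto simp: indicator_def)
  have ui: "integrable M (\<lambda>x. indicator A x * \<bar>u x\<bar> powr p)"
    using integrable_mult_indicator[OF assms(2) u] by simp
  have I0: "0 \<le> ?I" by (intro integral_nonneg_AE) auto
  have ii: "integrable M (indicator A :: 'a \<Rightarrow> real)"
    by (intro integrable_real_indicator) (auto simp: less_top[symmetric])
  have eq: "\<bar>indicator A x :: real\<bar> powr (p - 1) * \<bar>indicator A x * u x\<bar> = \<bar>indicator A x * u x\<bar>" for x
    by (auto simp: indicator_def)
  have h: "integrable M (\<lambda>x. \<bar>indicator A x * u x\<bar>)"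
    "(LINT x|M. \<bar>indicator A x * u x\<bar>) \<le> (measure M A powr (1/p)) powr (p - 1) * ?I powr (1/p)"
    using holder_bound[of "indicator A" M "\<lambda>x. indicator A x * u x" p "measure M A powr (1/p)" "?I powr (1/p)"]
      \<open>1 < p\<close> I0 ui ii unfolding ia iu eq by (auto simp: powr_powr)
  show i: "integrable M (\<lambda>x. indicator A x * u x)"
    using h(1) by (subst (asm) integrable_abs_iff) auto
  have "\<bar>LINT x|M. indicator A x * u x\<bar> powr p \<le> ((measure M A powr (1/p)) powr (p - 1) * ?I powr (1/p)) powr p"
    using \<open>1 < p\<close> order_trans[OF integral_abs_bound h(2)] by (intro powr_mono2) auto
  also have "\<dots> = measure M A powr (p - 1) * ?I"
    using \<open>1 < p\<close> I0 by (simp add: powr_mult powr_powr)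
  finally show "\<bar>LINT x|M. indicator A x * u x\<bar> powr p \<le> measure M A powr (p - 1) * ?I" .
qed

text \<open>The dominating function has separated variables, so its integral factors. The kernel
  terms below are estimated in this form.\<close>

lemma (in pair_sigma_finite) integral_pair_bound:
  fixes g :: "'a \<times> 'b \<Rightarrow> real"
  assumes [measurable]: "g \<in> borel_measurable (M1 \<Otimes>\<^sub>M M2)"
    and a: "integrable M1 a" "\<And>x. 0 \<le> a x" and b: "integrable M2 b" "\<And>y. 0 \<le> b y"
    and le: "\<And>x y. \<bar>g (x, y)\<bar> \<le> a x * b y"
  shows "integrable (M1 \<Otimes>\<^sub>M M2) g"
    and "\<bar>LINT z|(M1 \<Otimes>\<^sub>M M2). g z\<bar> \<le> (LINT x|M1. a x) * (LINT y|M2. b y)"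
proof -
  have [measurable]: "a \<in> borel_measurable M1" "b \<in> borel_measurable M2" using a b by auto
  have ab: "integrable (M1 \<Otimes>\<^sub>M M2) (\<lambda>(x, y). a x * b y)"
    by (rule Fubini_integrable) (use a b in \<open>auto simp: abs_mult\<close>)
  show g: "integrable (M1 \<Otimes>\<^sub>M M2) g"
    by (rule Bochner_Integration.integrable_bound[OF ab])
       (auto intro!: AE_I2 order_trans[OF le])
  have "\<bar>LINT z|(M1 \<Otimes>\<^sub>M M2). g z\<bar> \<le> (LINT z|(M1 \<Otimes>\<^sub>M M2). \<bar>g z\<bar>)" by (rule integral_abs_bound)
  also have "\<dots> \<le> (LINT (x, y)|(M1 \<Otimes>\<^sub>M M2). a x * b y)"
    using g ab le by (intro integral_mono) auto
  also have "\<dots> = (LINT x|M1. a x) * (LINT y|M2. b y)"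
    by (subst integral_fst'[OF ab, symmetric]) (use b in simp)
  finally show "\<bar>LINT z|(M1 \<Otimes>\<^sub>M M2). g z\<bar> \<le> (LINT x|M1. a x) * (LINT y|M2. b y)" .
qed

section \<open>Half-open cubes covering a bounded set\<close>

lemma finite_bounded_integer_points:
  "finite {k :: 'a::euclidean_space. \<forall>b\<in>Basis. k \<bullet> b \<in> \<int> \<and> \<bar>k \<bullet> b\<bar> \<le> M}" (is "finite ?S")
proof -
  \<comment> \<open>An integer point is determined by the floors of its coordinates, which range
    over a finite product of integer intervals.\<close>
  define F :: "'a \<Rightarrow> 'a \<Rightarrow> int" where "F k = restrict (\<lambda>b. \<lfloor>k \<bullet> b\<rfloor>) Basis" for k
  have "F ` ?S \<subseteq> PiE Basis (\<lambda>_. {- \<lceil>M\<rceil>..\<lceil>M\<rceil>})"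
  proof (auto simp: F_def)
    fix k b :: 'a
    assume "\<forall>b\<in>Basis. k \<bullet> b \<in> \<int> \<and> \<bar>k \<bullet> b\<bar> \<le> M" "b \<in> Basis"
    then have "k \<bullet> b \<in> \<int>" "\<bar>k \<bullet> b\<bar> \<le> M" by auto
    then obtain z where "k \<bullet> b = of_int z" "\<bar>real_of_int z\<bar> \<le> M" by (auto elim: Ints_cases)
    then show "- \<lceil>M\<rceil> \<le> \<lfloor>k \<bullet> b\<rfloor>" "\<lfloor>k \<bullet> b\<rfloor> \<le> \<lceil>M\<rceil>" by (simp; linarith)+
  qed
  moreover have "inj_on F ?S"
  proof (rule inj_onI)
    fix k l assume k: "k \<in> ?S" and l: "l \<in> ?S" and eq: "F k = F l"
    show "k = l"
    proof (rule euclidean_eqI)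
      fix b :: 'a assume b: "b \<in> Basis"
      have "\<lfloor>k \<bullet> b\<rfloor> = \<lfloor>l \<bullet> b\<rfloor>" using fun_cong[OF eq, of b] b by (simp add: F_def)
      then show "k \<bullet> b = l \<bullet> b" using k l b by (auto elim!: Ints_cases)
    qed
  qed
  moreover have "finite (PiE (Basis :: 'a set) (\<lambda>_. {- \<lceil>M\<rceil>..\<lceil>M\<rceil>}))"
    by (intro finite_PiE) auto
  ultimately show ?thesis by (meson finite_imageD finite_subset)
qed

text \<open>The cubes are the cells of a grid of mesh \<open>h\<close> that meet
  \<open>\<Omega>\<close>. Because \<open>h \<le> 1\<close>, they stay in one ball for all
  \<open>h\<close>, which later bounds their total volume uniformly. Measure and diameter are
  claimed for every index, also beyond \<open>m\<close>, which spares side conditions in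
  sums.\<close>

lemma cube_partition:
  fixes \<Omega> :: "'a::euclidean_space set"
  assumes "\<And>x. x \<in> \<Omega> \<Longrightarrow> norm x \<le> R" and "0 < h" "h \<le> 1"
  obtains m and A :: "nat \<Rightarrow> 'a set" where "\<And>i. A i \<in> sets borel"
    "\<And>i. measure lborel (A i) = h ^ DIM('a)" 
    "\<And>i. i < m \<Longrightarrow> A i \<subseteq> cball 0 (R + real DIM('a))"
    "\<And>i x y. x \<in> A i \<Longrightarrow> y \<in> A i \<Longrightarrow> norm (x - y) \<le> real DIM('a) * h"
    "disjoint_family_on A {..<m}" "\<Omega> \<subseteq> (\<Union>i<m. A i)"
proof -
  \<comment> \<open>Lower corner of the cell around \<open>x\<close>, in units of
    \<open>h\<close>.\<close>
  define \<kappa> :: "'a \<Rightarrow> 'a" where "\<kappa> x = (\<Sum>b\<in>Basis. of_int \<lfloor>x \<bullet> b / h\<rfloor> *\<^sub>R b)" for x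
  have \<kappa>b: "\<kappa> x \<bullet> b = of_int \<lfloor>x \<bullet> b / h\<rfloor>" if "b \<in> Basis" for x b
    using that by (simp add: \<kappa>_def inner_sum_left_Basis)
  define cell where "cell k = {x :: 'a. \<forall>b\<in>Basis. k \<bullet> b * h \<le> x \<bullet> b \<and> x \<bullet> b < (k \<bullet> b + 1) * h}" for k
  have \<kappa>_cell: "x \<in> cell (\<kappa> x)" for x
    using \<open>0 < h\<close> by (auto simp: cell_def \<kappa>b pos_le_divide_eq[symmetric] pos_divide_less_eq[symmetric])
  have finI: "finite (\<kappa> ` \<Omega>)"
  proof (rule finite_subset[OF _ finite_bounded_integer_points[of "R / h + 1"]], safe)
    fix x b :: 'a assume x: "x \<in> \<Omega>" and b: "b \<in> Basis"
    show "\<kappa> x \<bullet> b \<in> \<int>" using b by (simp add: \<kappa>b)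
    have "\<bar>x \<bullet> b\<bar> \<le> R" using Basis_le_norm[OF b, of x] assms(1)[OF x] by linarith
    then have "\<bar>x \<bullet> b / h\<bar> \<le> R / h" using \<open>0 < h\<close> by (simp add: divide_right_mono)
    then show "\<bar>\<kappa> x \<bullet> b\<bar> \<le> R / h + 1" unfolding \<kappa>b[OF b] by linarith
  qed
  have meas[measurable]: "cell k \<in> sets borel" for k
    unfolding cell_def by measurable
  have lm: "measure lborel (cell k) = h ^ DIM('a)" for k
  proof -
    have "box (h *\<^sub>R k) (h *\<^sub>R (k + One)) \<subseteq> cell k" "cell k \<subseteq> cbox (h *\<^sub>R k) (h *\<^sub>R (k + One))"
      by (fastforce simp: cell_def mem_box inner_add_left inner_sum_left_Basis algebra_simps)+
    moreover have "emeasure lborel (box (h *\<^sub>R k) (h *\<^sub>R (k + One))) = ennreal (h ^ DIM('a))"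
      "emeasure lborel (cbox (h *\<^sub>R k) (h *\<^sub>R (k + One))) = ennreal (h ^ DIM('a))"
      using \<open>0 < h\<close> by (simp_all add: emeasure_lborel_box emeasure_lborel_cbox inner_add_left algebra_simps)
    ultimately have "emeasure lborel (cell k) = ennreal (h ^ DIM('a))"
      using emeasure_mono[of "box (h *\<^sub>R k) (h *\<^sub>R (k + One))" "cell k" lborel]
        emeasure_mono[of "cell k" "cbox (h *\<^sub>R k) (h *\<^sub>R (k + One))" lborel] by simp
    then show ?thesis using \<open>0 < h\<close> by (simp add: measure_def)
  qed
  have diam: "norm (x - y) \<le> real DIM('a) * h" if "x \<in> cell k" "y \<in> cell k" for x y k
  proof -
    have "norm (x - y) \<le> (\<Sum>b\<in>Basis. \<bar>(x - y) \<bullet> b\<bar>)" by (rule norm_le_l1)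
    also have "\<dots> \<le> (\<Sum>b\<in>(Basis :: 'a set). h)"
    proof (rule sum_mono)
      fix b :: 'a assume "b \<in> Basis"
      with that have "k \<bullet> b * h \<le> x \<bullet> b" "x \<bullet> b < (k \<bullet> b + 1) * h" "k \<bullet> b * h \<le> y \<bullet> b" "y \<bullet> b < (k \<bullet> b + 1) * h"
        by (auto simp: cell_def)
      then show "\<bar>(x - y) \<bullet> b\<bar> \<le> h" by (auto simp: inner_diff_left algebra_simps)
    qed
    finally show ?thesis by simp
  qed
  have cell_inj: "\<kappa> x = \<kappa> y" if "z \<in> cell (\<kappa> x)" "z \<in> cell (\<kappa> y)" for x y z
  proof -
    \<comment> \<open>Each point of a cell recovers the corner by taking floors, so two cells with a
      common point coincide.\<close>
    have *: "\<kappa> w \<bullet> b = of_int \<lfloor>z \<bullet> b / h\<rfloor>" if "z \<in> cell (\<kappa> w)" "b \<in> Basis" for w b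
    proof -
      have "of_int \<lfloor>w \<bullet> b / h\<rfloor> \<le> z \<bullet> b / h" "z \<bullet> b / h < of_int \<lfloor>w \<bullet> b / h\<rfloor> + 1"
        using that \<open>0 < h\<close> by (auto simp: cell_def \<kappa>b pos_le_divide_eq pos_divide_less_eq)
      then have "\<lfloor>z \<bullet> b / h\<rfloor> = \<lfloor>w \<bullet> b / h\<rfloor>" by (rule floor_unique)
      then show ?thesis unfolding \<kappa>b[OF that(2)] by simp
    qed
    show ?thesis by (rule euclidean_eqI) (simp add: *[OF that(1)] *[OF that(2)])
  qed
  obtain e where e: "bij_betw e {0..<card (\<kappa> ` \<Omega>)} (\<kappa> ` \<Omega>)"
    using ex_bij_betw_nat_finite[OF finI] by blast
  show thesis
  proof (rule that[of "\<lambda>i. cell (e i)" "card (\<kappa> ` \<Omega>)"])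
    show "cell (e i) \<subseteq> cball 0 (R + real DIM('a))" if "i < card (\<kappa> ` \<Omega>)" for i
    proof
      fix y assume y: "y \<in> cell (e i)"
      have "e i \<in> \<kappa> ` \<Omega>" using e that by (auto simp: bij_betw_def)
      then obtain x where x: "x \<in> \<Omega>" "e i = \<kappa> x" by auto
      have "norm y \<le> norm x + norm (y - x)" using norm_triangle_ineq[of x "y - x"] by simp
      also have "\<dots> \<le> R + real DIM('a) * h"
        using y x \<kappa>_cell[of x] diam assms(1)[OF x(1)] by (intro add_mono) auto
      also have "\<dots> \<le> R + real DIM('a)"
        using \<open>h \<le> 1\<close> by (simp add: mult_left_le)
      finally show "y \<in> cball 0 (R + real DIM('a))" by simp
    qed
    show "disjoint_family_on (\<lambda>i. cell (e i)) {..<card (\<kappa> ` \<Omega>)}"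
      unfolding disjoint_family_on_def
    proof (intro ballI impI, rule ccontr)
      fix i j assume ij: "i \<in> {..<card (\<kappa> ` \<Omega>)}" "j \<in> {..<card (\<kappa> ` \<Omega>)}" "i \<noteq> j"
        and "cell (e i) \<inter> cell (e j) \<noteq> {}"
      moreover have "e i \<in> \<kappa> ` \<Omega>" "e j \<in> \<kappa> ` \<Omega>" using e ij by (auto simp: bij_betw_def)
      ultimately have "e i = e j" using cell_inj by (auto simp: image_iff)
      then show False using e ij by (auto simp: bij_betw_def inj_on_def)
    qed
    show "\<Omega> \<subseteq> (\<Union>i<card (\<kappa> ` \<Omega>). cell (e i))"
    proof
      fix x assume "x \<in> \<Omega>"
      then have "\<kappa> x \<in> e ` {0..<card (\<kappa> ` \<Omega>)}" using e by (auto simp: bij_betw_def)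
      then show "x \<in> (\<Union>i<card (\<kappa> ` \<Omega>). cell (e i))" using \<kappa>_cell[of x] by force
    qed
  qed (use lm diam in auto)
qed

section \<open>Riesz representation\<close>

lemma quadratic_nonneg_imp_discriminant:
  fixes a b c :: real
  assumes "\<And>t. 0 \<le> a + 2 * t * b + t\<^sup>2 * c" and "0 \<le> c"
  shows "b\<^sup>2 \<le> a * c"
proof (cases "c = 0")
  case True
  have "b = 0"
  proof (rule ccontr)
    assume "b \<noteq> 0"
    \<comment> \<open>For c = 0 the expression is affine in t, and this t makes it equal to
      -1.\<close>
    then have "2 * (- (a + 1) / (2 * b)) * b = - (a + 1)" by simp
    then show False using assms(1)[of "- (a + 1) / (2 * b)"] True by simp
  qed
  then show ?thesis using True by simp
next
  case False
  then have "c > 0" using assms(2) by simp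
  then have "a + 2 * (- b / c) * b + (- b / c)\<^sup>2 * c = a - b\<^sup>2 / c"
    by (simp add: field_simps power2_eq_square)
  then have "b\<^sup>2 / c \<le> a" using assms(1)[of "- b / c"] by linarith
  then show ?thesis using \<open>c > 0\<close> by (simp add: field_simps)
qed

text \<open>A Hilbert space made of functions instead of classes: \<open>B\<close> is only positive
  semidefinite, and limits are determined only up to functions of zero energy. This avoids forming a
  quotient.\<close>

locale complete_function_space =
  fixes V :: "('b \<Rightarrow> real) set" and B :: "('b \<Rightarrow> real) \<Rightarrow> ('b \<Rightarrow> real) \<Rightarrow> real"
  assumes zero: "(\<lambda>_. 0) \<in> V"
    and add: "\<lbrakk>u \<in> V; v \<in> V\<rbrakk> \<Longrightarrow> (\<lambda>x. u x + v x) \<in> V"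
    and scale: "u \<in> V \<Longrightarrow> (\<lambda>x. c * u x) \<in> V"
    and B_add: "\<lbrakk>u \<in> V; v \<in> V; w \<in> V\<rbrakk> \<Longrightarrow> B (\<lambda>x. u x + v x) w = B u w + B v w"
    and B_scale: "\<lbrakk>u \<in> V; w \<in> V\<rbrakk> \<Longrightarrow> B (\<lambda>x. c * u x) w = c * B u w"
    and B_sym: "\<lbrakk>u \<in> V; v \<in> V\<rbrakk> \<Longrightarrow> B u v = B v u"
    and B_nonneg: "u \<in> V \<Longrightarrow> 0 \<le> B u u"
    and complete: "\<And>u :: nat \<Rightarrow> 'b \<Rightarrow> real. \<lbrakk>\<And>n. u n \<in> V; \<And>e. e > 0 \<Longrightarrow> \<exists>N. \<forall>m\<ge>N. \<forall>n\<ge>N. B (\<lambda>x. u m x - u n x) (\<lambda>x. u m x - u n x) < e\<rbrakk>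
      \<Longrightarrow> \<exists>v\<in>V. (\<lambda>n. B (\<lambda>x. u n x - v x) (\<lambda>x. u n x - v x)) \<longlonglongrightarrow> 0"
begin

lemma diff: "\<lbrakk>u \<in> V; v \<in> V\<rbrakk> \<Longrightarrow> (\<lambda>x. u x - v x) \<in> V"
  using add[OF _ scale[of v "-1"]] by simp

lemma B_diff: "\<lbrakk>u \<in> V; v \<in> V; w \<in> V\<rbrakk> \<Longrightarrow> B (\<lambda>x. u x - v x) w = B u w - B v w"
  using B_add[of u "\<lambda>x. - 1 * v x" w] B_scale[of v w "-1"] scale[of v "-1"] by simp

lemma B_square_combination:
  assumes "u \<in> V" "v \<in> V"
  shows "B (\<lambda>x. u x + t * v x) (\<lambda>x. u x + t * v x) = B u u + 2 * t * B u v + t\<^sup>2 * B v v"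
proof -
  have *: "B (\<lambda>x. u x + t * v x) w = B u w + t * B v w" if "w \<in> V" for w
    using assms that B_add[OF assms(1) scale[OF assms(2)]] B_scale by simp
  have tv: "(\<lambda>x. u x + t * v x) \<in> V" using add[OF assms(1) scale[OF assms(2)]] .
  have "B (\<lambda>x. u x + t * v x) (\<lambda>x. u x + t * v x) =
      B (\<lambda>x. u x + t * v x) u + t * B (\<lambda>x. u x + t * v x) v"
    unfolding *[OF tv] B_sym[OF tv assms(1)] B_sym[OF tv assms(2)] ..
  also have "\<dots> = B u u + 2 * t * B u v + t\<^sup>2 * B v v"
    unfolding *[OF assms(1)] *[OF assms(2)] B_sym[OF assms(2,1)]
    by (simp add: algebra_simps power2_eq_square)
  finally show ?thesis .
qed

lemma Cauchy_Schwarz: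
  assumes "u \<in> V" "v \<in> V"
  shows "\<bar>B u v\<bar> \<le> sqrt (B u u) * sqrt (B v v)"
proof -
  have "(B u v)\<^sup>2 \<le> B u u * B v v"
  proof (rule quadratic_nonneg_imp_discriminant)
    show "0 \<le> B u u + 2 * t * B u v + t\<^sup>2 * B v v" for t
      using B_nonneg[OF add[OF assms(1) scale[OF assms(2)]]] B_square_combination[OF assms] by simp
  qed (rule B_nonneg[OF assms(2)])
  then have "sqrt ((B u v)\<^sup>2) \<le> sqrt (B u u * B v v)" by (rule real_sqrt_le_mono)
  then show ?thesis by (simp add: real_sqrt_mult)
qed

lemma B_tendsto:
  assumes "\<And>n. u n \<in> V" "v \<in> V" "w \<in> V"
    and lim: "(\<lambda>n. B (\<lambda>x. u n x - v x) (\<lambda>x. u n x - v x)) \<longlonglongrightarrow> 0"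
  shows "(\<lambda>n. B (u n) w) \<longlonglongrightarrow> B v w"
proof -
  have "(\<lambda>n. sqrt (B (\<lambda>x. u n x - v x) (\<lambda>x. u n x - v x)) * sqrt (B w w)) \<longlonglongrightarrow> sqrt 0 * sqrt (B w w)"
    by (intro tendsto_intros lim)
  then have lim0: "(\<lambda>n. sqrt (B (\<lambda>x. u n x - v x) (\<lambda>x. u n x - v x)) * sqrt (B w w)) \<longlonglongrightarrow> 0"
    by simp
  have "norm (B (u n) w - B v w) \<le> sqrt (B (\<lambda>x. u n x - v x) (\<lambda>x. u n x - v x)) * sqrt (B w w)" for n
    using Cauchy_Schwarz[OF diff[OF assms(1,2)] assms(3)] unfolding B_diff[OF assms(1-3)] by simp
  then have "(\<lambda>n. B (u n) w - B v w) \<longlonglongrightarrow> 0"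
    by (intro Lim_null_comparison[OF _ lim0] always_eventually allI)
  then show ?thesis by (rule LIM_zero_cancel)
qed

text \<open>The representative minimizes \<open>J u = B u u - 2 * G u\<close>; the parallelogram identity makes minimizing
  sequences Cauchy.\<close>

lemma riesz_representation:
  assumes G_add: "\<And>u v. \<lbrakk>u \<in> V; v \<in> V\<rbrakk> \<Longrightarrow> G (\<lambda>x. u x + v x) = G u + G v"
    and G_scale: "\<And>c u. u \<in> V \<Longrightarrow> G (\<lambda>x. c * u x) = c * G u"
    and G_bound: "\<And>u. u \<in> V \<Longrightarrow> \<bar>G u\<bar> \<le> C * sqrt (B u u)"
  shows "\<exists>u\<in>V. \<forall>w\<in>V. B u w = G w"
proof -
  define J where "J u = B u u - 2 * G u" for u
  have J_comb: "J (\<lambda>x. u x + t * w x) = J u + 2 * t * (B u w - G w) + t\<^sup>2 * B w w"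
    if "u \<in> V" "w \<in> V" for u w t
    using B_square_combination[OF that] G_add[OF that(1) scale[OF that(2)]] G_scale[OF that(2)]
    by (simp add: J_def algebra_simps)
  \<comment> \<open>Complete the square in sqrt (B u u).\<close>
  have J_lower: "- C\<^sup>2 \<le> J u" if "u \<in> V" for u
  proof -
    have "B u u = (sqrt (B u u))\<^sup>2" using B_nonneg[OF that] by simp
    moreover have "0 \<le> (sqrt (B u u))\<^sup>2 + C\<^sup>2 - 2 * (C * sqrt (B u u))"
      using zero_le_power2[of "sqrt (B u u) - C"] by (simp add: power2_diff algebra_simps)
    ultimately show ?thesis using G_bound[OF that] unfolding J_def by linarith
  qed
  define j where "j = Inf (J ` V)"
  have jle: "j \<le> J u" if "u \<in> V" for u
    unfolding j_def by (rule cINF_lower[OF bdd_belowI2[of V "- C\<^sup>2"] that]) (rule J_lower)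
  have "\<exists>u\<in>V. J u < j + e" if "e > 0" for e
  proof -
    have "\<exists>y\<in>J ` V. y < j + e"
      using that zero by (intro cInf_lessD) (auto simp: j_def)
    then show ?thesis by auto
  qed
  then have "\<forall>n. \<exists>u. u \<in> V \<and> J u < j + 1 / real (Suc n)" 
    by (meson of_nat_0_less_iff zero_less_Suc zero_less_divide_1_iff)
  from choice[OF this] obtain u where u: "\<And>n. u n \<in> V" "\<And>n. J (u n) < j + 1 / real (Suc n)" by auto
  \<comment> \<open>Compare \<open>J\<close> at the midpoint of \<open>u n\<close> and
    \<open>u m\<close> with \<open>J\<close> at \<open>u m\<close>. Eliminating the linear term
    leaves D <= 2 (J (u m) - j) + 2 (J (u n) - j) for the squared distance D.\<close>
  have par: "B (\<lambda>x. u m x - u n x) (\<lambda>x. u m x - u n x) \<le> 2 / real (Suc m) + 2 / real (Suc n)" for m n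
  proof -
    have "j \<le> J (\<lambda>x. u n x + (1/2) * (u m x - u n x))"
      by (intro jle add scale diff u)
    also have "\<dots> = J (u n) + (B (u n) (\<lambda>x. u m x - u n x) - G (\<lambda>x. u m x - u n x)) +
        B (\<lambda>x. u m x - u n x) (\<lambda>x. u m x - u n x) / 4"
      by (subst J_comb[OF u(1) diff[OF u(1) u(1)]]) (simp add: power2_eq_square)
    finally have 1: "j \<le> \<dots>" .
    have "J (u m) = J (\<lambda>x. u n x + 1 * (u m x - u n x))" by simp
    also have "\<dots> = J (u n) + 2 * (B (u n) (\<lambda>x. u m x - u n x) - G (\<lambda>x. u m x - u n x)) +
        B (\<lambda>x. u m x - u n x) (\<lambda>x. u m x - u n x)"
      by (subst J_comb[OF u(1) diff[OF u(1) u(1)]]) simp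
    finally have 2: "J (u m) = \<dots>" .
    have *: "D \<le> 2 * y + 2 * z"
      if "j \<le> Jn + a + D / 4" "Jm = Jn + 2 * a + D" "Jm < j + y" "Jn < j + z" for D Jn Jm a y z :: real
      using that by linarith
    show ?thesis using *[OF 1 2 u(2)[of m] u(2)[of n]] by simp
  qed
  have Cauchy: "\<exists>N. \<forall>m\<ge>N. \<forall>n\<ge>N. B (\<lambda>x. u m x - u n x) (\<lambda>x. u m x - u n x) < e" if "e > 0" for e
  proof -
    obtain N where N: "inverse (real (Suc N)) < e / 4" using reals_Archimedean[of "e / 4"] \<open>e > 0\<close> by auto
    have "B (\<lambda>x. u m x - u n x) (\<lambda>x. u m x - u n x) < e" if "m \<ge> N" "n \<ge> N" for m n
    proof -
      have "2 / real (Suc m) \<le> 2 / real (Suc N)" "2 / real (Suc n) \<le> 2 / real (Suc N)"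
        using that by (auto intro!: divide_left_mono)
      then show ?thesis using par[of m n] N unfolding inverse_eq_divide by linarith
    qed
    then show ?thesis by blast
  qed
  from complete[of u, OF u(1) Cauchy]
  obtain v where v: "v \<in> V" "(\<lambda>n. B (\<lambda>x. u n x - v x) (\<lambda>x. u n x - v x)) \<longlonglongrightarrow> 0" ..
  have "B v w = G w" if w: "w \<in> V" for w
  proof -
    \<comment> \<open>First variation at the minimizer, by passing to the limit in J (u n + t w) >=
      j > J (u n) - 1/(n + 1). A nonnegative quadratic polynomial in t without constant term has no
      linear term.\<close>
    have nn: "0 \<le> 2 * t * (B v w - G w) + t\<^sup>2 * B w w" for t
    proof (rule LIMSEQ_le_const)
      have "(\<lambda>n. 1 / real (Suc n) + 2 * t * (B (u n) w - G w) + t\<^sup>2 * B w w) \<longlonglongrightarrow>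
          0 + 2 * t * (B v w - G w) + t\<^sup>2 * B w w"
        by (intro tendsto_add tendsto_mult tendsto_diff tendsto_const B_tendsto[OF u(1) v(1) w v(2)]
            LIMSEQ_inverse_real_of_nat[unfolded inverse_eq_divide])
      then show "(\<lambda>n. 1 / real (Suc n) + 2 * t * (B (u n) w - G w) + t\<^sup>2 * B w w) \<longlonglongrightarrow>
          2 * t * (B v w - G w) + t\<^sup>2 * B w w" by simp
      have "0 \<le> 1 / real (Suc n) + 2 * t * (B (u n) w - G w) + t\<^sup>2 * B w w" for n
        using jle[OF add[OF u(1)[of n] scale[OF w, of t]]] u(2)[of n] J_comb[OF u(1)[of n] w, of t] by linarith
      then show "\<exists>N. \<forall>n\<ge>N. 0 \<le> 1 / real (Suc n) + 2 * t * (B (u n) w - G w) + t\<^sup>2 * B w w" by blast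
    qed
    have "(B v w - G w)\<^sup>2 \<le> 0 * B w w"
      by (rule quadratic_nonneg_imp_discriminant) (use nn B_nonneg[OF w] in auto)
    then show ?thesis by simp
  qed
  then show ?thesis using v(1) by blast
qed

end

section \<open>The Dirichlet space\<close>

text \<open>The product of a null set with the space, in either order, is null. This is needed
  because the Gagliardo integrand and the kernel terms see a function at both coordinates.\<close>

lemma AE_pair_both:
  assumes "sigma_finite_measure M" and "AE x in M. P x"
  shows "AE z in M \<Otimes>\<^sub>M M. P (fst z) \<and> P (snd z)"
proof -
  interpret sigma_finite_measure M by fact
  interpret pair_sigma_finite M M ..
  obtain N where N: "\<And>x. x \<in> space M - N \<Longrightarrow> P x" "N \<in> null_sets M"
    using AE_E3[OF assms(2)] by blast
  then have [measurable]: "N \<in> sets M" by auto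
  have nN: "AE x in M. x \<notin> N" using N(2) by (rule AE_not_in)
  have "AE z in M \<Otimes>\<^sub>M M. fst z \<notin> N \<and> snd z \<notin> N"
  proof (rule AE_pair_measure)
    show "{z \<in> space (M \<Otimes>\<^sub>M M). fst z \<notin> N \<and> snd z \<notin> N} \<in> sets (M \<Otimes>\<^sub>M M)" by measurable
    show "AE x in M. AE y in M. fst (x, y) \<notin> N \<and> snd (x, y) \<notin> N"
      using nN by eventually_elim (use nN in auto)
  qed
  then show ?thesis
    by (rule AE_mp) (auto intro!: AE_I2 N(1) simp: space_pair_measure)
qed

lemma AE_lborel_both:
  assumes "AE x in (lborel :: 'a::euclidean_space measure). P x"
  shows "AE z in (lborel :: ('a \<times> 'a) measure). P (fst z) \<and> P (snd z)"
  using AE_pair_both[OF lborel.sigma_finite_measure_axioms assms] unfolding lborel_prod .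

lemma borel_measurable_fst_snd [measurable]:
  "fst \<in> (borel :: ('a::second_countable_topology \<times> 'b::second_countable_topology) measure) \<rightarrow>\<^sub>M borel"
  "snd \<in> (borel :: ('a \<times> 'b) measure) \<rightarrow>\<^sub>M borel"
  by (auto intro!: borel_measurable_continuous_onI continuous_intros)

lemma abs_powr_2: "\<bar>x::real\<bar> powr 2 = x\<^sup>2"
  by (cases "x = 0") auto

text \<open>Integrand of the energy as a function of one variable of product type, on which
  \<open>lborel\<close> is the product measure. On the diagonal the divisor is 0, and so is the
  quotient.\<close>

definition gagliardo :: "real \<Rightarrow> ('a::euclidean_space \<Rightarrow> real) \<Rightarrow> ('a \<Rightarrow> real) \<Rightarrow> 'a \<times> 'a \<Rightarrow> real" where
  "gagliardo s u v z = (u (fst z) - u (snd z)) * (v (fst z) - v (snd z)) /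
     norm (fst z - snd z) powr (real DIM('a) + 2 * s)"

lemma gagliardo_measurable [measurable]:
  fixes u v :: "'a::euclidean_space \<Rightarrow> real"
  assumes [measurable]: "u \<in> borel_measurable borel" "v \<in> borel_measurable borel"
  shows "gagliardo s u v \<in> borel_measurable borel"
  unfolding gagliardo_def by measurable

lemma gagliardo_nonneg: "0 \<le> gagliardo s u u z"
  by (simp add: gagliardo_def)

lemma gagliardo_sym: "gagliardo s u v = gagliardo s v u"
  by (auto simp: gagliardo_def mult.commute)

lemma gagliardo_add: "gagliardo s (\<lambda>x. u x + v x) w z = gagliardo s u w z + gagliardo s v w z"
  by (simp add: gagliardo_def algebra_simps add_divide_distrib[symmetric] diff_divide_distrib[symmetric])

lemma gagliardo_scale: "gagliardo s (\<lambda>x. c * u x) w z = c * gagliardo s u w z"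
  by (simp add: gagliardo_def algebra_simps)

lemma gagliardo_le: "\<bar>gagliardo s u v z\<bar> \<le> gagliardo s u u z + gagliardo s v v z"
proof -
  have "\<bar>a * b\<bar> \<le> a * a + b * b" for a b :: real
    using sum_squares_bound[of a b] sum_squares_bound[of a "- b"] zero_le_square[of a] zero_le_square[of b]
    unfolding power2_eq_square by (auto simp: abs_if)
  then show ?thesis
    unfolding gagliardo_def abs_divide add_divide_distrib[symmetric]
    by (simp add: divide_right_mono)
qed

lemma frac_const_pos:
  assumes "0 < s" "s < 1" shows "0 < frac_const N s"
  using assms unfolding frac_const_def by (intro divide_pos_pos mult_pos_pos Gamma_real_pos) auto

text \<open>\<open>\<sigma>\<close> stands for the critical exponent and \<open>CS p\<close> for the
  embedding constant C_{S,p}. The exponents 2 and q enter the smallness condition, 1 measures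
  distances and averages, and \<open>\<sigma>\<close> provides uniform integrability.\<close>

locale dirichlet_space =
  fixes \<Omega> :: "'a::euclidean_space set" and s \<sigma> :: real and CS :: "real \<Rightarrow> real"
  assumes open_domain: "open \<Omega>" and bounded_domain: "bounded \<Omega>"
    and s_range: "0 < s" "s < 1" and two_less_\<sigma>: "2 < \<sigma>"
    and embedding: "\<And>p. \<lbrakk>1 \<le> p; p \<le> \<sigma>\<rbrakk> \<Longrightarrow> embedding_const s \<Omega> p (CS p)"
begin

text \<open>Every class in \<open>X0 s \<Omega>\<close> has a representative in \<open>X\<close>; Fubini's theorem for \<open>lborel\<close> needs Borel functions.\<close>

definition X :: "('a \<Rightarrow> real) set" where
  "X = {u \<in> X0 s \<Omega>. u \<in> borel_measurable borel \<and> (\<forall>x. x \<notin> \<Omega> \<longrightarrow> u x = 0)}"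

definition \<mu> :: "'a measure" where "\<mu> = restrict_space lborel \<Omega>"

lemma domain_borel [measurable]: "\<Omega> \<in> sets borel"
  using open_domain by simp

lemma space_\<mu> [simp]: "space \<mu> = \<Omega>"
  by (simp add: \<mu>_def space_restrict_space)

lemma measurable_\<mu> [measurable (raw)]: "u \<in> borel_measurable borel \<Longrightarrow> u \<in> borel_measurable \<mu>"
  unfolding \<mu>_def by (rule measurable_restrict_space1) simp

lemma emeasure_domain_finite: "emeasure lborel \<Omega> < \<infinity>"
  using bounded_domain by (rule emeasure_bounded_finite)

sublocale \<mu>: finite_measure \<mu>
  by standard (use emeasure_domain_finite in \<open>simp add: \<mu>_def emeasure_restrict_space space_restrict_space\<close>)

sublocale \<mu>\<mu>: pair_sigma_finite \<mu> \<mu> ..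

sublocale \<mu>\<mu>: finite_measure "\<mu> \<Otimes>\<^sub>M \<mu>"
  by (rule finite_measure_pair_measure) unfold_locales

lemma AE_\<mu>_iff: "(AE x in \<mu>. P x) \<longleftrightarrow> (AE x in lborel. x \<in> \<Omega> \<longrightarrow> P x)"
  unfolding \<mu>_def by (subst AE_restrict_space_iff) auto

lemma integrable_\<mu>_iff: "integrable \<mu> (u :: 'a \<Rightarrow> real) \<longleftrightarrow> integrable lborel (\<lambda>x. indicator \<Omega> x * u x)"
  unfolding \<mu>_def by (subst integrable_restrict_space) auto

lemma integral_\<mu>: "(LINT x|\<mu>. (u x :: real)) = (LINT x|lborel. indicator \<Omega> x * u x)"
  unfolding \<mu>_def by (subst integral_restrict_space) auto

lemma lebesgue_on_\<mu>:
  fixes u :: "'a \<Rightarrow> real"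
  assumes [measurable]: "u \<in> borel_measurable borel"
  shows "integrable (lebesgue_on \<Omega>) u \<longleftrightarrow> integrable \<mu> u"
    and "(LINT x|lebesgue_on \<Omega>. u x) = (LINT x|\<mu>. u x)"
proof -
  have m: "(\<lambda>x. indicator \<Omega> x * u x) \<in> borel_measurable lborel" by measurable
  show "integrable (lebesgue_on \<Omega>) u \<longleftrightarrow> integrable \<mu> u"
    using integrable_completion[OF m] by (simp add: integrable_\<mu>_iff integrable_restrict_space)
  show "(LINT x|lebesgue_on \<Omega>. u x) = (LINT x|\<mu>. u x)"
    using integral_completion[OF m] by (simp add: integral_\<mu> integral_restrict_space)
qed

lemma measure_\<mu>: "measure \<mu> (space \<mu>) = measure lebesgue \<Omega>"
  by (simp add: \<mu>_def measure_restrict_space)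

lemma XI:
  assumes [measurable]: "u \<in> borel_measurable borel" and "\<And>x. x \<notin> \<Omega> \<Longrightarrow> u x = 0"
    and "integrable \<mu> (\<lambda>x. \<bar>u x\<bar> powr 2)" "integrable lborel (gagliardo s u u)"
  shows "u \<in> X"
proof -
  have "(\<lambda>x. indicator \<Omega> x * \<bar>u x\<bar> powr 2) = (\<lambda>x. \<bar>u x\<bar> powr 2)"
    using assms(2) by (force simp: indicator_def)
  then have "integrable lborel (\<lambda>x. \<bar>u x\<bar> powr 2)"
    using assms(3) by (simp add: integrable_\<mu>_iff)
  then have 1: "integrable lebesgue (\<lambda>x. \<bar>u x\<bar> powr 2)"
    by (subst integrable_completion) auto
  have "integrable lebesgue (gagliardo s u u)"
    using assms(4) by (subst integrable_completion) auto
  then have 2: "integrable lebesgue (\<lambda>(x, y). (u x - u y)\<^sup>2 / norm (x - y) powr (real DIM('a) + 2 * s))"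
    by (rule back_subst[of "integrable lebesgue"]) (auto simp: gagliardo_def power2_eq_square)
  have 3: "u \<in> borel_measurable lebesgue" by (rule measurable_completion) simp
  show ?thesis
    using 1 2 3 assms(1,2) by (auto simp: X_def X0_def Hs_def Lp_def lebesgue_on_UNIV_eq)
qed

lemma XD:
  assumes "u \<in> X"
  shows X_X0: "u \<in> X0 s \<Omega>" and X_borel: "u \<in> borel_measurable borel"
    and X_outside: "x \<notin> \<Omega> \<Longrightarrow> u x = 0"
    and X_gagliardo: "integrable lborel (gagliardo s u u)"
proof -
  show "u \<in> X0 s \<Omega>" and u[measurable]: "u \<in> borel_measurable borel" and "x \<notin> \<Omega> \<Longrightarrow> u x = 0"
    using assms by (auto simp: X_def)
  have "integrable lebesgue (\<lambda>(x, y). (u x - u y)\<^sup>2 / norm (x - y) powr (real DIM('a) + 2 * s))"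
    using assms by (auto simp: X_def X0_def Hs_def)
  then have "integrable lebesgue (gagliardo s u u)"
    by (rule back_subst[of "integrable lebesgue"]) (auto simp: gagliardo_def power2_eq_square)
  then show "integrable lborel (gagliardo s u u)"
    by (subst (asm) integrable_completion) auto
qed

lemma X_powr:
  assumes "u \<in> X" "1 \<le> p" "p \<le> \<sigma>"
  shows "integrable \<mu> (\<lambda>x. \<bar>u x\<bar> powr p)"
    and "(LINT x|\<mu>. \<bar>u x\<bar> powr p) \<le> (CS p * X0_norm s u) powr p"
proof -
  have [measurable]: "u \<in> borel_measurable borel" by (rule X_borel[OF assms(1)])
  have e: "u \<in> Lp p \<Omega>" "Lp_norm p \<Omega> u \<le> CS p * X0_norm s u"
    using embedding[OF assms(2,3)] X_X0[OF assms(1)] by (auto simp: embedding_const_def)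
  then show "integrable \<mu> (\<lambda>x. \<bar>u x\<bar> powr p)"
    by (subst lebesgue_on_\<mu>(1)[symmetric]) (auto simp: Lp_def)
  have "(LINT x|\<mu>. \<bar>u x\<bar> powr p) = (LINT x|lebesgue_on \<Omega>. \<bar>u x\<bar> powr p)"
    by (subst lebesgue_on_\<mu>(2)) auto
  also have "\<dots> = Lp_norm p \<Omega> u powr p"
    using assms(2) by (simp add: Lp_norm_def powr_powr integral_nonneg_AE)
  also have "\<dots> \<le> (CS p * X0_norm s u) powr p"
    using e(2) assms(2) by (intro powr_mono2) (auto simp: Lp_norm_def)
  finally show "(LINT x|\<mu>. \<bar>u x\<bar> powr p) \<le> (CS p * X0_norm s u) powr p" .
qed

lemma CS_pos: "1 \<le> p \<Longrightarrow> p \<le> \<sigma> \<Longrightarrow> CS p > 0"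
  using embedding[of p] by (simp add: embedding_const_def)

lemma gagliardo_integrable:
  assumes "u \<in> X" "v \<in> X" shows "integrable lborel (gagliardo s u v)"
proof (rule Bochner_Integration.integrable_bound[of _ "\<lambda>z. gagliardo s u u z + gagliardo s v v z"])
  have [measurable]: "u \<in> borel_measurable borel" "v \<in> borel_measurable borel" using X_borel assms by auto
  show "gagliardo s u v \<in> borel_measurable lborel" by simp
  show "AE z in lborel. norm (gagliardo s u v z) \<le> norm (gagliardo s u u z + gagliardo s v v z)"
    using gagliardo_le[of s u v] by (intro AE_I2) (auto simp: abs_of_nonneg gagliardo_nonneg add_nonneg_nonneg)
qed (use X_gagliardo assms in auto)

lemma energy_eq:
  assumes "u \<in> X" "v \<in> X"
  shows "energy s u v = frac_const DIM('a) s / 2 * (LINT z|lborel. gagliardo s u v z)"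
proof -
  have [measurable]: "u \<in> borel_measurable borel" "v \<in> borel_measurable borel" using X_borel assms by auto
  have "(LINT (x, y)|lebesgue. (u x - u y) * (v x - v y) / norm (x - y) powr (real DIM('a) + 2 * s))
      = (LINT z|lebesgue. gagliardo s u v z)"
    by (rule arg_cong[of _ _ "integral\<^sup>L lebesgue"]) (auto simp: gagliardo_def)
  also have "\<dots> = (LINT z|lborel. gagliardo s u v z)"
    by (rule integral_completion) simp
  finally show ?thesis by (simp add: energy_def)
qed

lemma energy_const_pos: "0 < frac_const DIM('a) s / 2"
  using frac_const_pos[OF s_range] by simp

lemma X_zero: "(\<lambda>_. 0) \<in> X"
proof -
  have "gagliardo s (\<lambda>_::'a. 0) (\<lambda>_. 0) = (\<lambda>_. 0)" by (auto simp: gagliardo_def)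
  then show ?thesis by (intro XI) auto
qed

lemma X_add:
  assumes "u \<in> X" "v \<in> X" shows "(\<lambda>x. u x + v x) \<in> X"
proof (rule XI)
  have [measurable]: "u \<in> borel_measurable borel" "v \<in> borel_measurable borel" using X_borel assms by auto
  have g: "gagliardo s (\<lambda>x. u x + v x) (\<lambda>x. u x + v x) =
      (\<lambda>z. gagliardo s u u z + 2 * gagliardo s u v z + gagliardo s v v z)"
    using gagliardo_add[of s u v "\<lambda>x. u x + v x"] gagliardo_add[of s u v u] gagliardo_add[of s u v v]
    by (simp add: fun_eq_iff gagliardo_sym[of s u "\<lambda>x. u x + v x"] gagliardo_sym[of s v "\<lambda>x. u x + v x"]
        gagliardo_sym[of s v u])
  show "integrable lborel (gagliardo s (\<lambda>x. u x + v x) (\<lambda>x. u x + v x))"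
    unfolding g using gagliardo_integrable assms by auto
  show "integrable \<mu> (\<lambda>x. \<bar>u x + v x\<bar> powr 2)"
  proof (rule Bochner_Integration.integrable_bound[of _ "\<lambda>x. 2 * (\<bar>u x\<bar> powr 2) + 2 * (\<bar>v x\<bar> powr 2)"])
    show "integrable \<mu> (\<lambda>x. 2 * (\<bar>u x\<bar> powr 2) + 2 * (\<bar>v x\<bar> powr 2))"
      using X_powr(1)[OF assms(1), of 2] X_powr(1)[OF assms(2), of 2] two_less_\<sigma> by auto
    have "(a + b)\<^sup>2 \<le> 2 * a\<^sup>2 + 2 * b\<^sup>2" for a b :: real
      using zero_le_power2[of "a - b"] by (simp add: power2_sum power2_diff)
    then show "AE x in \<mu>. norm (\<bar>u x + v x\<bar> powr 2) \<le> norm (2 * (\<bar>u x\<bar> powr 2) + 2 * (\<bar>v x\<bar> powr 2))"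
      by (intro AE_I2) (simp add: abs_powr_2)
  qed simp
  show "u x + v x = 0" if "x \<notin> \<Omega>" for x using that X_outside[OF assms(1)] X_outside[OF assms(2)] by simp
  show "(\<lambda>x. u x + v x) \<in> borel_measurable borel" by measurable
qed

lemma X_scale:
  assumes "u \<in> X" shows "(\<lambda>x. c * u x) \<in> X"
proof (rule XI)
  have [measurable]: "u \<in> borel_measurable borel" using X_borel assms by auto
  have g: "gagliardo s (\<lambda>x. c * u x) (\<lambda>x. c * u x) = (\<lambda>z. c * (c * gagliardo s u u z))"
    by (simp add: fun_eq_iff gagliardo_scale gagliardo_sym[of s u "\<lambda>x. c * u x"])
  show "integrable lborel (gagliardo s (\<lambda>x. c * u x) (\<lambda>x. c * u x))"
    unfolding g using X_gagliardo assms by auto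
  show "integrable \<mu> (\<lambda>x. \<bar>c * u x\<bar> powr 2)"
    using X_powr(1)[OF assms(1), of 2] two_less_\<sigma> by (simp add: abs_mult powr_mult)
  show "c * u x = 0" if "x \<notin> \<Omega>" for x using that X_outside[OF assms] by simp
  show "(\<lambda>x. c * u x) \<in> borel_measurable borel" by measurable
qed 

lemma X_diff: "u \<in> X \<Longrightarrow> v \<in> X \<Longrightarrow> (\<lambda>x. u x - v x) \<in> X"
  using X_add[OF _ X_scale[of v "-1"]] by simp

lemma energy_add: "\<lbrakk>u \<in> X; v \<in> X; w \<in> X\<rbrakk> \<Longrightarrow> energy s (\<lambda>x. u x + v x) w = energy s u w + energy s v w"
  by (simp add: energy_eq X_add gagliardo_add gagliardo_integrable algebra_simps)

lemma energy_scale: "\<lbrakk>u \<in> X; w \<in> X\<rbrakk> \<Longrightarrow> energy s (\<lambda>x. c * u x) w = c * energy s u w"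
  by (simp add: energy_eq X_scale gagliardo_scale)

lemma energy_sym: "\<lbrakk>u \<in> X; v \<in> X\<rbrakk> \<Longrightarrow> energy s u v = energy s v u"
  by (simp add: energy_eq gagliardo_sym[of s v u])

lemma energy_nonneg: "u \<in> X \<Longrightarrow> 0 \<le> energy s u u"
  using energy_const_pos by (simp add: energy_eq gagliardo_nonneg integral_nonneg_AE)

lemma X0_norm_nonneg: "u \<in> X \<Longrightarrow> 0 \<le> X0_norm s u"
  by (simp add: X0_norm_def energy_nonneg)

text \<open>Lower semicontinuity of the energy under almost everywhere convergence. The differences
  u x - u y converge for almost every pair, so Fatou's lemma applies to the Gagliardo integrand;
  square integrability of the limit comes from the embedding with p = 2.\<close>

lemma energy_fatou:
  assumes u: "\<And>n. u n \<in> X" and B: "\<And>n. energy s (u n) (u n) \<le> B"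
    and v[measurable]: "v \<in> borel_measurable borel" and v0: "\<And>x. x \<notin> \<Omega> \<Longrightarrow> v x = 0"
    and lim: "AE x in lborel. (\<lambda>n. u n x) \<longlonglongrightarrow> v x"
  shows "v \<in> X" "energy s v v \<le> B"
proof -
  let ?c = "frac_const DIM('a) s / 2"
  have gb: "(LINT z|lborel. gagliardo s (u n) (u n) z) \<le> B / ?c" for n
    using B[of n] energy_const_pos energy_eq[OF u u, of n n] by (simp add: field_simps)
  have gl: "AE z in lborel. (\<lambda>n. gagliardo s (u n) (u n) z) \<longlonglongrightarrow> gagliardo s v v z"
    using AE_lborel_both[OF lim]
  proof eventually_elim
    case (elim z)
    then show ?case unfolding gagliardo_def divide_inverse by (intro tendsto_intros) auto
  qed
  have gi: "integrable lborel (gagliardo s v v)" "(LINT z|lborel. gagliardo s v v z) \<le> B / ?c"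
    by (rule fatou_integral_bound[OF X_gagliardo[OF u] _ gagliardo_nonneg gl gb], simp)+
  have "integrable \<mu> (\<lambda>x. \<bar>v x\<bar> powr 2)"
  proof (rule fatou_integral_bound[where f = "\<lambda>n x. \<bar>u n x\<bar> powr 2" and B = "(CS 2 * sqrt B) powr 2"])
    show "integrable \<mu> (\<lambda>x. \<bar>u n x\<bar> powr 2)" for n
      by (rule X_powr[OF u]) (use two_less_\<sigma> in auto)
    have "AE x in \<mu>. (\<lambda>n. u n x) \<longlonglongrightarrow> v x" using lim by (auto simp: AE_\<mu>_iff)
    then show "AE x in \<mu>. (\<lambda>n. \<bar>u n x\<bar> powr 2) \<longlonglongrightarrow> \<bar>v x\<bar> powr 2"
      unfolding abs_powr_2 by eventually_elim (intro tendsto_intros)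
    show "(LINT x|\<mu>. \<bar>u n x\<bar> powr 2) \<le> (CS 2 * sqrt B) powr 2" for n
    proof (rule order_trans[OF X_powr(2)[OF u]])
      have "X0_norm s (u n) \<le> sqrt B" unfolding X0_norm_def by (rule real_sqrt_le_mono[OF B])
      then show "(CS 2 * X0_norm s (u n)) powr 2 \<le> (CS 2 * sqrt B) powr 2"
        using CS_pos[of 2] two_less_\<sigma> X0_norm_nonneg[OF u, of n]
        by (intro powr_mono2 mult_left_mono) (auto simp: less_imp_le)
    qed (use two_less_\<sigma> in auto)
  qed auto
  then show vX: "v \<in> X" by (intro XI v v0 gi)
  show "energy s v v \<le> B"
    using gi(2) energy_const_pos by (simp add: energy_eq[OF vX vX] field_simps)
qed

lemma X_L1:
  assumes "u \<in> X"
  shows "integrable \<mu> u" "(LINT x|\<mu>. \<bar>u x\<bar>) \<le> CS 1 * X0_norm s u"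
proof -
  have [measurable]: "u \<in> borel_measurable borel" by (rule X_borel[OF assms])
  have "integrable \<mu> (\<lambda>x. \<bar>u x\<bar>)"
    using X_powr(1)[OF assms, of 1] two_less_\<sigma> by simp
  then show "integrable \<mu> u" by (subst (asm) integrable_abs_iff) auto
  show "(LINT x|\<mu>. \<bar>u x\<bar>) \<le> CS 1 * X0_norm s u"
    using X_powr(2)[OF assms, of 1] two_less_\<sigma> CS_pos[of 1] X0_norm_nonneg[OF assms] by (simp add: abs_mult)
qed

text \<open>The limit is extended by zero, so that it meets the pointwise requirements of
  \<open>X\<close> and only the integral conditions remain to be checked.\<close>

lemma L1_limit_representative:
  fixes u :: "nat \<Rightarrow> 'a \<Rightarrow> real"
  assumes u: "\<And>n. u n \<in> X"
    and Cauchy: "\<And>e. e > 0 \<Longrightarrow> \<exists>N. \<forall>m\<ge>N. \<forall>n\<ge>N. (LINT x|\<mu>. \<bar>u m x - u n x\<bar>) < e"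
  shows "\<exists>r v. strict_mono r \<and> v \<in> borel_measurable borel \<and> (\<forall>x. x \<notin> \<Omega> \<longrightarrow> v x = 0) \<and>
    (AE x in lborel. (\<lambda>n. u (r n) x) \<longlonglongrightarrow> v x)"
proof -
  obtain r v where r: "strict_mono r" and v: "v \<in> borel_measurable \<mu>"
    and lim: "AE x in \<mu>. (\<lambda>n. u (r n) x) \<longlonglongrightarrow> v x"
    using L1_Cauchy_AE_subseq[of \<mu> u, OF X_L1(1)[OF u] Cauchy] by blast
  have "(\<lambda>x. indicator \<Omega> x * v x) \<in> borel_measurable borel"
    using v borel_measurable_restrict_space_iff[of \<Omega> lborel v] by (simp add: \<mu>_def mult.commute)
  moreover have "AE x in lborel. (\<lambda>n. u (r n) x) \<longlonglongrightarrow> indicator \<Omega> x * v x"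
    using lim[unfolded AE_\<mu>_iff]
    by eventually_elim (auto simp: indicator_def X_outside[OF u])
  ultimately show ?thesis
    using r by (intro exI[of _ r] exI[of _ "\<lambda>x. indicator \<Omega> x * v x"]) auto
qed

text \<open>Completeness: the embedding with p = 1 turns an energy-Cauchy sequence into an
  L^1-Cauchy one, which gives an almost everywhere limit \<open>v\<close> of a subsequence. Lower
  semicontinuity in the second index, with the first one fixed, then bounds the energy of u m -
  v.\<close>

sublocale complete_function_space X "energy s"
proof
  fix u :: "nat \<Rightarrow> 'a \<Rightarrow> real"
  assume u: "\<And>n. u n \<in> X"
    and Cauchy: "\<And>e. e > 0 \<Longrightarrow> \<exists>N. \<forall>m\<ge>N. \<forall>n\<ge>N. energy s (\<lambda>x. u m x - u n x) (\<lambda>x. u m x - u n x) < e"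
  have C1: "CS 1 > 0" using CS_pos[of 1] two_less_\<sigma> by simp
  have "\<exists>N. \<forall>m\<ge>N. \<forall>n\<ge>N. (LINT x|\<mu>. \<bar>u m x - u n x\<bar>) < e" if "e > 0" for e
  proof -
    obtain N where N: "\<forall>m\<ge>N. \<forall>n\<ge>N. energy s (\<lambda>x. u m x - u n x) (\<lambda>x. u m x - u n x) < (e / CS 1)\<^sup>2"
      using Cauchy[of "(e / CS 1)\<^sup>2"] \<open>e > 0\<close> C1 by auto
    have "(LINT x|\<mu>. \<bar>u m x - u n x\<bar>) < e" if "m \<ge> N" "n \<ge> N" for m n
    proof -
      have "energy s (\<lambda>x. u m x - u n x) (\<lambda>x. u m x - u n x) < (e / CS 1)\<^sup>2" using N that by blast
      then have "X0_norm s (\<lambda>x. u m x - u n x) < e / CS 1"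
        using real_sqrt_less_mono[of _ "(e / CS 1)\<^sup>2"] \<open>e > 0\<close> C1 by (simp add: X0_norm_def)
      then have "CS 1 * X0_norm s (\<lambda>x. u m x - u n x) < e"
        using C1 by (simp add: field_simps)
      then show ?thesis using X_L1(2)[OF X_diff[OF u u]] by (rule le_less_trans[rotated])
    qed
    then show ?thesis by blast
  qed
  from L1_limit_representative[OF u this]
  obtain r v where r: "strict_mono r" and v[measurable]: "v \<in> borel_measurable borel"
    and v0: "\<And>x. x \<notin> \<Omega> \<Longrightarrow> v x = 0" and lim: "AE x in lborel. (\<lambda>n. u (r n) x) \<longlonglongrightarrow> v x"
    by blast
  have close: "(\<lambda>x. u m x - v x) \<in> X \<and> energy s (\<lambda>x. u m x - v x) (\<lambda>x. u m x - v x) \<le> e"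
    if "m \<ge> N" and N: "\<forall>m\<ge>N. \<forall>n\<ge>N. energy s (\<lambda>x. u m x - u n x) (\<lambda>x. u m x - u n x) < e" for e N m
  proof -
    have [measurable]: "u m \<in> borel_measurable borel" by (rule X_borel[OF u])
    have "r (n + N) \<ge> N" for n
      using seq_suble[OF r, of "n + N"] by simp
    then have 1: "energy s (\<lambda>x. u m x - u (r (n + N)) x) (\<lambda>x. u m x - u (r (n + N)) x) \<le> e" for n
      using N \<open>m \<ge> N\<close> less_imp_le by blast
    have 2: "AE x in lborel. (\<lambda>n. u m x - u (r (n + N)) x) \<longlonglongrightarrow> u m x - v x"
      using lim by eventually_elim (intro tendsto_diff tendsto_const LIMSEQ_ignore_initial_segment)
    have 3: "u m x - v x = 0" if "x \<notin> \<Omega>" for x using that v0 X_outside[OF u] by simp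
    show ?thesis
      using energy_fatou[OF X_diff[OF u u] 1 _ 3 2] by simp
  qed
  obtain N where "\<forall>m\<ge>N. \<forall>n\<ge>N. energy s (\<lambda>x. u m x - u n x) (\<lambda>x. u m x - u n x) < 1"
    using Cauchy[of 1] by auto
  \<comment> \<open>\<open>v\<close> is the difference of \<open>u N\<close> and u N - v, which both
    lie in \<open>X\<close>.\<close>
  from X_diff[OF u[of N] conjunct1[OF close[OF order_refl this]]] have vX: "v \<in> X" by simp
  have "(\<lambda>n. energy s (\<lambda>x. u n x - v x) (\<lambda>x. u n x - v x)) \<longlonglongrightarrow> 0"
  proof (rule LIMSEQ_I)
    fix e :: real assume "e > 0"
    then obtain N where N: "\<forall>m\<ge>N. \<forall>n\<ge>N. energy s (\<lambda>x. u m x - u n x) (\<lambda>x. u m x - u n x) < e / 2"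
      using Cauchy[of "e / 2"] by auto
    have "norm (energy s (\<lambda>x. u m x - v x) (\<lambda>x. u m x - v x) - 0) < e" if "m \<ge> N" for m
      using close[OF that N] energy_nonneg[OF X_diff[OF u vX], of m] \<open>e > 0\<close> by simp
    then show "\<exists>no. \<forall>n\<ge>no. norm (energy s (\<lambda>x. u n x - v x) (\<lambda>x. u n x - v x) - 0) < e" by blast
  qed
  then show "\<exists>v\<in>X. (\<lambda>n. energy s (\<lambda>x. u n x - v x) (\<lambda>x. u n x - v x)) \<longlonglongrightarrow> 0" using vX by blast
qed (fact X_zero X_add X_scale energy_add energy_scale energy_sym energy_nonneg)+

end

section \<open>The lower-order terms\<close>

lemma abs_signed_powr: "\<bar>\<bar>t\<bar> powr (q - 2) * t\<bar> = \<bar>t\<bar> powr (q - 1)" for t q :: real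
proof (cases "t = 0")
  case False
  then have "\<bar>t\<bar> powr (q - 2) * \<bar>t\<bar> powr 1 = \<bar>t\<bar> powr (q - 1)"
    by (subst powr_add[symmetric]) simp
  then show ?thesis by (simp add: abs_mult)
qed simp

text \<open>For q < 2 the factor |t|^(q-2) blows up at 0, so continuity there is read off from the
  absolute value |t|^(q-1).\<close>

lemma tendsto_signed_powr:
  fixes t :: "nat \<Rightarrow> real"
  assumes "t \<longlonglongrightarrow> l" "1 < q"
  shows "(\<lambda>n. \<bar>t n\<bar> powr (q - 2) * t n) \<longlonglongrightarrow> \<bar>l\<bar> powr (q - 2) * l"
proof (cases "l = 0")
  case True
  have "(\<lambda>n. \<bar>t n\<bar> powr (q - 1)) \<longlonglongrightarrow> \<bar>l\<bar> powr (q - 1)"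
    using assms by (intro tendsto_powr' tendsto_rabs) auto
  then have "(\<lambda>n. \<bar>\<bar>t n\<bar> powr (q - 2) * t n\<bar>) \<longlonglongrightarrow> 0"
    using True by (simp only: abs_signed_powr) simp
  then show ?thesis using True by (simp add: tendsto_rabs_zero_iff)
next
  case False
  then show ?thesis using assms by (intro tendsto_mult tendsto_powr tendsto_rabs) auto
qed

text \<open>The product on the left has degree q and is at most the q-th power of the larger of
  \<open>a\<close> and \<open>b\<close>. This turns bounds in L^sigma into bounds in L^(sigma/q) for
  such products.\<close>

lemma powr_product_le:
  fixes a b :: real
  assumes "1 \<le> q" "0 \<le> \<sigma>" "0 \<le> a" "0 \<le> b"
  shows "(a powr (q - 1) * b) powr (\<sigma> / q) \<le> a powr \<sigma> + b powr \<sigma>"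
proof -
  define m where "m = max a b"
  have m: "a \<le> m" "b \<le> m" "0 \<le> m" using assms by (auto simp: m_def)
  have "a powr (q - 1) * b \<le> m powr (q - 1) * m"
    using assms m by (intro mult_mono powr_mono2) auto
  also have "\<dots> = m powr q"
    using m powr_add[of m "q - 1" 1] by simp
  finally have "(a powr (q - 1) * b) powr (\<sigma> / q) \<le> (m powr q) powr (\<sigma> / q)"
    using assms by (intro powr_mono2) auto
  also have "\<dots> = m powr \<sigma>" using assms by (simp add: powr_powr)
  also have "\<dots> \<le> a powr \<sigma> + b powr \<sigma>" by (auto simp: m_def max_def)
  finally show ?thesis .
qed

lemma powr_le_one_plus:
  fixes t :: real
  assumes "p \<le> \<sigma>" "0 \<le> p" shows "\<bar>t\<bar> powr p \<le> 1 + \<bar>t\<bar> powr \<sigma>"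
proof (cases "\<bar>t\<bar> \<le> 1")
  case True
  then have "\<bar>t\<bar> powr p \<le> 1" using assms by (intro powr_le1) auto
  then show ?thesis by (simp add: add_increasing2)
next
  case False
  then have "\<bar>t\<bar> powr p \<le> \<bar>t\<bar> powr \<sigma>" using assms by (intro powr_mono) auto
  then show ?thesis by simp
qed

context dirichlet_space
begin

lemma measurable_\<mu>\<mu> [measurable (raw)]:
  fixes g :: "'a \<times> 'a \<Rightarrow> real"
  assumes "g \<in> borel_measurable borel" shows "g \<in> borel_measurable (\<mu> \<Otimes>\<^sub>M \<mu>)"
proof -
  have [measurable]: "(\<lambda>x. x) \<in> \<mu> \<rightarrow>\<^sub>M borel"
    unfolding \<mu>_def by (rule measurable_restrict_space1) simp
  have "(\<lambda>z. (fst z, snd z)) \<in> \<mu> \<Otimes>\<^sub>M \<mu> \<rightarrow>\<^sub>M (borel \<Otimes>\<^sub>M borel :: ('a \<times> 'a) measure)"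
    by measurable
  then have "(\<lambda>z. z) \<in> \<mu> \<Otimes>\<^sub>M \<mu> \<rightarrow>\<^sub>M (borel :: ('a \<times> 'a) measure)"
    by (simp add: borel_prod)
  from measurable_compose[OF this assms] show ?thesis by simp
qed

lemma measurable_\<mu>\<mu>_coordinates [measurable (raw)]:
  fixes u :: "'a \<Rightarrow> real"
  assumes [measurable]: "u \<in> borel_measurable borel"
  shows "(\<lambda>z. u (fst z)) \<in> borel_measurable (\<mu> \<Otimes>\<^sub>M \<mu>)" "(\<lambda>z. u (snd z)) \<in> borel_measurable (\<mu> \<Otimes>\<^sub>M \<mu>)"
  by (rule measurable_\<mu>\<mu>, measurable)+

text \<open>The class on which \<open>F\<close> is studied. It has to contain the step functions,
  whose jumps across cube faces can make the Gagliardo seminorm infinite.\<close>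

definition critical :: "('a \<Rightarrow> real) \<Rightarrow> bool" where
  "critical w \<longleftrightarrow> w \<in> borel_measurable borel \<and> integrable \<mu> (\<lambda>x. \<bar>w x\<bar> powr \<sigma>)"

lemma critical_borel: "critical w \<Longrightarrow> w \<in> borel_measurable borel"
  by (simp add: critical_def)

lemma X_critical: "u \<in> X \<Longrightarrow> critical u"
  using X_borel X_powr(1)[of u \<sigma>] two_less_\<sigma> by (simp add: critical_def)

lemma critical_powr:
  assumes "critical w" "0 \<le> p" "p \<le> \<sigma>" shows "integrable \<mu> (\<lambda>x. \<bar>w x\<bar> powr p)"
proof -
  have [measurable]: "w \<in> borel_measurable borel" by (rule critical_borel[OF assms(1)])
  show ?thesis
    by (rule Bochner_Integration.integrable_bound[of \<mu> "\<lambda>x. 1 + \<bar>w x\<bar> powr \<sigma>"])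
      (use assms(1) powr_le_one_plus[OF assms(3,2)] in \<open>auto simp: critical_def abs_of_nonneg add_nonneg_nonneg\<close>)
qed

lemma critical_abs: "critical w \<Longrightarrow> integrable \<mu> (\<lambda>x. \<bar>w x\<bar>)"
  using critical_powr[of w 1] two_less_\<sigma> by simp

lemma critical_mult:
  assumes w: "critical w" and v: "critical v" and p: "1 < p" "p \<le> \<sigma>"
  shows "integrable \<mu> (\<lambda>x. \<bar>w x\<bar> powr (p - 1) * \<bar>v x\<bar>)"
proof (rule holder_bound(1)[OF _ _ p(1)])
  let ?n = "\<lambda>u. (LINT x|\<mu>. \<bar>u x\<bar> powr p) powr (1 / p)"
  show "w \<in> borel_measurable \<mu>" "v \<in> borel_measurable \<mu>"
    using critical_borel w v by auto
  show "integrable \<mu> (\<lambda>x. \<bar>w x\<bar> powr p)" "integrable \<mu> (\<lambda>x. \<bar>v x\<bar> powr p)"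
    using critical_powr w v p by auto
  show "(LINT x|\<mu>. \<bar>w x\<bar> powr p) \<le> (?n w) powr p" "(LINT x|\<mu>. \<bar>v x\<bar> powr p) \<le> (?n v) powr p"
    using p by (simp_all add: powr_powr integral_nonneg_AE)
qed auto

end

text \<open>The data are Borel and bounded at every point. Essentially bounded data are replaced by
  such representatives in the final theorem, with \<open>kK\<close>, \<open>kQ\<close>,
  \<open>ka\<close> their L^infinity norms.\<close>

locale perturbed_problem = dirichlet_space \<Omega> s \<sigma> CS
  for \<Omega> :: "'a::euclidean_space set" and s \<sigma> :: real and CS :: "real \<Rightarrow> real" +
  fixes K Q :: "'a \<times> 'a \<Rightarrow> real" and a :: "'a \<Rightarrow> real" and kK kQ ka lam q :: real
  assumes K_borel [measurable]: "K \<in> borel_measurable borel" and K_bound: "\<And>z. \<bar>K z\<bar> \<le> kK"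
    and Q_borel [measurable]: "Q \<in> borel_measurable borel" and Q_bound: "\<And>z. \<bar>Q z\<bar> \<le> kQ"
    and a_borel [measurable]: "a \<in> borel_measurable borel" and a_bound: "\<And>x. \<bar>a x\<bar> \<le> ka"
    and q_range: "1 < q" "q < \<sigma>"
begin

text \<open>The terms with T_K and N_Q are encoded as integrands on pairs z = (x, y), with x the
  outer and y the inner variable. As \<open>\<mu> \<Otimes>\<^sub>M \<mu>\<close> is again a finite
  measure, one convergence theorem serves for them and for the term with \<open>a\<close>.\<close>

definition FK :: "('a \<Rightarrow> real) \<Rightarrow> ('a \<Rightarrow> real) \<Rightarrow> 'a \<times> 'a \<Rightarrow> real" where
  "FK w \<phi> z = K z * w (snd z) * \<phi> (fst z)"

definition FQ :: "('a \<Rightarrow> real) \<Rightarrow> ('a \<Rightarrow> real) \<Rightarrow> 'a \<times> 'a \<Rightarrow> real" where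
  "FQ w \<phi> z = Q z * \<bar>w (snd z)\<bar> powr q * (\<bar>w (fst z)\<bar> powr (q - 2) * w (fst z)) * \<phi> (fst z)"

definition F :: "('a \<Rightarrow> real) \<Rightarrow> ('a \<Rightarrow> real) \<Rightarrow> real" where
  "F w \<phi> = (LINT z|(\<mu> \<Otimes>\<^sub>M \<mu>). FK w \<phi> z) + (LINT x|\<mu>. a x * w x * \<phi> x)
     + lam * (LINT z|(\<mu> \<Otimes>\<^sub>M \<mu>). FQ w \<phi> z)"

lemma k_nonneg: "0 \<le> kK" "0 \<le> kQ" "0 \<le> ka"
  using K_bound[of undefined] Q_bound[of undefined] a_bound[of undefined] by linarith+

lemma FK_measurable [measurable]:
  assumes [measurable]: "w \<in> borel_measurable borel" "\<phi> \<in> borel_measurable borel"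
  shows "FK w \<phi> \<in> borel_measurable (\<mu> \<Otimes>\<^sub>M \<mu>)" "FQ w \<phi> \<in> borel_measurable (\<mu> \<Otimes>\<^sub>M \<mu>)"
  unfolding FK_def FQ_def by measurable

lemma FK_abs: "\<bar>FK w \<phi> (x, y)\<bar> \<le> (kK * \<bar>\<phi> x\<bar>) * \<bar>w y\<bar>"
proof -
  have "\<bar>FK w \<phi> (x, y)\<bar> = \<bar>K (x, y)\<bar> * (\<bar>\<phi> x\<bar> * \<bar>w y\<bar>)" by (simp add: FK_def abs_mult)
  also have "\<dots> \<le> kK * (\<bar>\<phi> x\<bar> * \<bar>w y\<bar>)" by (intro mult_right_mono K_bound) auto
  finally show ?thesis by (simp add: mult.assoc)
qed

lemma FQ_abs: "\<bar>FQ w \<phi> (x, y)\<bar> \<le> (kQ * (\<bar>w x\<bar> powr (q - 1) * \<bar>\<phi> x\<bar>)) * \<bar>w y\<bar> powr q"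
proof -
  have "\<bar>FQ w \<phi> (x, y)\<bar> = \<bar>Q (x, y)\<bar> * (\<bar>w x\<bar> powr (q - 1) * \<bar>\<phi> x\<bar> * \<bar>w y\<bar> powr q)"
    by (simp only: FQ_def abs_mult[of _ "\<phi> _"] abs_mult[of _ "_ * w _"] abs_signed_powr fst_conv snd_conv)
       (simp add: abs_mult)
  also have "\<dots> \<le> kQ * (\<bar>w x\<bar> powr (q - 1) * \<bar>\<phi> x\<bar> * \<bar>w y\<bar> powr q)" by (intro mult_right_mono Q_bound) auto
  finally show ?thesis by (simp add: mult.assoc)
qed

lemma a_abs: "\<bar>a x * w x * \<phi> x\<bar> \<le> ka * (\<bar>w x\<bar> * \<bar>\<phi> x\<bar>)"
  using mult_right_mono[OF a_bound[of x], of "\<bar>w x\<bar> * \<bar>\<phi> x\<bar>"] by (simp add: abs_mult mult.assoc)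

lemma F_integrable:
  assumes w: "critical w" and \<phi>: "critical \<phi>"
  shows "integrable (\<mu> \<Otimes>\<^sub>M \<mu>) (FK w \<phi>)" "integrable \<mu> (\<lambda>x. a x * w x * \<phi> x)"
    "integrable (\<mu> \<Otimes>\<^sub>M \<mu>) (FQ w \<phi>)"
proof -
  have [measurable]: "w \<in> borel_measurable borel" "\<phi> \<in> borel_measurable borel"
    using w \<phi> critical_borel by auto
  show "integrable (\<mu> \<Otimes>\<^sub>M \<mu>) (FK w \<phi>)"
    by (rule \<mu>\<mu>.integral_pair_bound(1)[where g = "FK w \<phi>" and a = "\<lambda>x. kK * \<bar>\<phi> x\<bar>" and b = "\<lambda>y. \<bar>w y\<bar>"])
      (use FK_abs critical_abs w \<phi> k_nonneg in auto)
  show "integrable (\<mu> \<Otimes>\<^sub>M \<mu>) (FQ w \<phi>)"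
    by (rule \<mu>\<mu>.integral_pair_bound(1)[where g = "FQ w \<phi>" and a = "\<lambda>x. kQ * (\<bar>w x\<bar> powr (q - 1) * \<bar>\<phi> x\<bar>)" and b = "\<lambda>y. \<bar>w y\<bar> powr q"])
      (use FQ_abs critical_powr[OF w] critical_mult[OF w \<phi>] k_nonneg q_range in auto)
  have "integrable \<mu> (\<lambda>x. ka * (\<bar>w x\<bar> * \<bar>\<phi> x\<bar>))"
    using critical_mult[OF w \<phi>, of 2] two_less_\<sigma> by simp
  then show "integrable \<mu> (\<lambda>x. a x * w x * \<phi> x)"
    by (rule Bochner_Integration.integrable_bound) (use a_abs[of _ w \<phi>] k_nonneg in \<open>auto simp: abs_mult\<close>)
qed

lemma F_add:
  assumes "critical w" "critical \<phi>" "critical \<psi>"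
  shows "F w (\<lambda>x. \<phi> x + \<psi> x) = F w \<phi> + F w \<psi>"
proof -
  have "FK w (\<lambda>x. \<phi> x + \<psi> x) = (\<lambda>z. FK w \<phi> z + FK w \<psi> z)" "FQ w (\<lambda>x. \<phi> x + \<psi> x) = (\<lambda>z. FQ w \<phi> z + FQ w \<psi> z)"
    by (auto simp: FK_def FQ_def algebra_simps)
  then show ?thesis
    using F_integrable[OF assms(1,2)] F_integrable[OF assms(1,3)]
    by (simp add: F_def algebra_simps)
qed

lemma F_scale: "F w (\<lambda>x. c * \<phi> x) = c * F w \<phi>"
proof -
  have 1: "FK w (\<lambda>x. c * \<phi> x) = (\<lambda>z. c * FK w \<phi> z)" "FQ w (\<lambda>x. c * \<phi> x) = (\<lambda>z. c * FQ w \<phi> z)"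
    by (auto simp: FK_def FQ_def algebra_simps)
  have 2: "(\<lambda>x. a x * w x * (c * \<phi> x)) = (\<lambda>x. c * (a x * w x * \<phi> x))" by (auto simp: algebra_simps)
  show ?thesis unfolding F_def 1 2 integral_mult_right_zero by (simp add: algebra_simps)
qed

text \<open>The bounds on \<open>w\<close> are free parameters because \<open>w\<close> may be a
  step function of infinite energy. The factor |Omega| comes from estimating both L^1 norms in the
  \<open>K\<close> term by sqrt |Omega| times L^2 norms; the exponent 2 q - 1 is q - 1 from the
  signed power plus q from B_Q.\<close>

lemma F_bound:
  assumes w: "critical w" and \<phi>: "critical \<phi>" and nn: "0 \<le> \<alpha>2" "0 \<le> \<alpha>q" "0 \<le> \<beta>2" "0 \<le> \<beta>q"
    and w2: "(LINT x|\<mu>. \<bar>w x\<bar> powr 2) \<le> \<alpha>2 powr 2" and wq: "(LINT x|\<mu>. \<bar>w x\<bar> powr q) \<le> \<alpha>q powr q"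
    and \<phi>2: "(LINT x|\<mu>. \<bar>\<phi> x\<bar> powr 2) \<le> \<beta>2 powr 2" and \<phi>q: "(LINT x|\<mu>. \<bar>\<phi> x\<bar> powr q) \<le> \<beta>q powr q"
  shows "\<bar>F w \<phi>\<bar> \<le> (ka + measure lebesgue \<Omega> * kK) * \<alpha>2 * \<beta>2 + \<bar>lam\<bar> * kQ * (\<alpha>q powr (2 * q - 1)) * \<beta>q"
proof -
  have [measurable]: "w \<in> borel_measurable borel" "\<phi> \<in> borel_measurable borel"
    using w \<phi> critical_borel by auto
  let ?m = "measure lebesgue \<Omega>"
  have m0: "0 \<le> ?m" by simp
  \<comment> \<open>Hoelder's inequality with p = 2 and the constant 1 as first factor will bound
    L^1 norms by L^2 norms.\<close>
  have one: "(LINT x|\<mu>. \<bar>1\<bar> powr 2) \<le> (sqrt ?m) powr 2"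
    using measure_\<mu> by (simp add: lebesgue_integral_const powr_half_sqrt[symmetric] powr_powr)
  have L1: "(LINT x|\<mu>. \<bar>v x\<bar>) \<le> sqrt ?m * \<beta>"
    if "critical v" "0 \<le> \<beta>" "(LINT x|\<mu>. \<bar>v x\<bar> powr 2) \<le> \<beta> powr 2" for v \<beta>
    using holder_bound(2)[OF _ _ _ _ one _ _ that(3,2)] critical_powr[OF that(1), of 2]
      critical_borel[OF that(1)] two_less_\<sigma> by simp
  have FK: "\<bar>LINT z|(\<mu> \<Otimes>\<^sub>M \<mu>). FK w \<phi> z\<bar> \<le> ?m * kK * \<alpha>2 * \<beta>2"
  proof -
    have "\<bar>LINT z|(\<mu> \<Otimes>\<^sub>M \<mu>). FK w \<phi> z\<bar> \<le> (LINT x|\<mu>. kK * \<bar>\<phi> x\<bar>) * (LINT y|\<mu>. \<bar>w y\<bar>)"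
      by (rule \<mu>\<mu>.integral_pair_bound(2)[where g = "FK w \<phi>" and a = "\<lambda>x. kK * \<bar>\<phi> x\<bar>" and b = "\<lambda>y. \<bar>w y\<bar>"])
        (use FK_abs critical_abs w \<phi> k_nonneg in auto)
    also have "\<dots> \<le> (kK * (sqrt ?m * \<beta>2)) * (sqrt ?m * \<alpha>2)"
      unfolding integral_mult_right_zero
      by (intro mult_mono L1 w \<phi> nn w2 \<phi>2 order_refl mult_nonneg_nonneg k_nonneg real_sqrt_ge_zero)
        (auto intro: integral_nonneg_AE)
    also have "\<dots> = (sqrt ?m * sqrt ?m) * kK * \<alpha>2 * \<beta>2" by (simp only: algebra_simps)
    finally show ?thesis by simp
  qed
  have Fa: "\<bar>LINT x|\<mu>. a x * w x * \<phi> x\<bar> \<le> ka * \<alpha>2 * \<beta>2"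
  proof -
    have h: "(LINT x|\<mu>. \<bar>w x\<bar> * \<bar>\<phi> x\<bar>) \<le> \<alpha>2 * \<beta>2"
      using holder_bound(2)[OF _ _ _ _ w2 nn(1) _ \<phi>2 nn(3)] critical_powr[OF w, of 2]
        critical_powr[OF \<phi>, of 2] two_less_\<sigma> nn by simp
    have i: "integrable \<mu> (\<lambda>x. ka * (\<bar>w x\<bar> * \<bar>\<phi> x\<bar>))"
      using critical_mult[OF w \<phi>, of 2] two_less_\<sigma> by simp
    have "\<bar>LINT x|\<mu>. a x * w x * \<phi> x\<bar> \<le> (LINT x|\<mu>. \<bar>a x * w x * \<phi> x\<bar>)" by (rule integral_abs_bound)
    also have "\<dots> \<le> (LINT x|\<mu>. ka * (\<bar>w x\<bar> * \<bar>\<phi> x\<bar>))"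
      using F_integrable(2)[OF w \<phi>] i a_abs by (intro integral_mono) auto
    also have "\<dots> \<le> ka * (\<alpha>2 * \<beta>2)"
      unfolding integral_mult_right_zero using h k_nonneg by (intro mult_left_mono)
    finally show ?thesis by (simp add: mult.assoc)
  qed
  have FQ: "\<bar>LINT z|(\<mu> \<Otimes>\<^sub>M \<mu>). FQ w \<phi> z\<bar> \<le> kQ * \<alpha>q powr (2 * q - 1) * \<beta>q"
  proof -
    have h: "(LINT x|\<mu>. \<bar>w x\<bar> powr (q - 1) * \<bar>\<phi> x\<bar>) \<le> \<alpha>q powr (q - 1) * \<beta>q"
      using holder_bound(2)[OF _ _ q_range(1) _ wq nn(2) _ \<phi>q nn(4)] critical_powr[OF w, of q]
        critical_powr[OF \<phi>, of q] q_range by simp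
    have "\<bar>LINT z|(\<mu> \<Otimes>\<^sub>M \<mu>). FQ w \<phi> z\<bar> \<le>
        (LINT x|\<mu>. kQ * (\<bar>w x\<bar> powr (q - 1) * \<bar>\<phi> x\<bar>)) * (LINT y|\<mu>. \<bar>w y\<bar> powr q)"
      by (rule \<mu>\<mu>.integral_pair_bound(2)[where g = "FQ w \<phi>" and a = "\<lambda>x. kQ * (\<bar>w x\<bar> powr (q - 1) * \<bar>\<phi> x\<bar>)" and b = "\<lambda>y. \<bar>w y\<bar> powr q"])
        (use FQ_abs critical_powr[OF w] critical_mult[OF w \<phi>] k_nonneg q_range in auto)
    also have "\<dots> \<le> (kQ * (\<alpha>q powr (q - 1) * \<beta>q)) * \<alpha>q powr q"
      unfolding integral_mult_right_zero
      by (intro mult_mono h wq order_refl mult_nonneg_nonneg k_nonneg nn)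
        (auto intro: integral_nonneg_AE)
    also have "\<dots> = kQ * (\<alpha>q powr (q - 1) * \<alpha>q powr q) * \<beta>q" by simp
    also have "\<alpha>q powr (q - 1) * \<alpha>q powr q = \<alpha>q powr (2 * q - 1)"
      by (subst powr_add[symmetric]) simp
    finally show ?thesis .
  qed
  have "\<bar>F w \<phi>\<bar> \<le> \<bar>LINT z|(\<mu> \<Otimes>\<^sub>M \<mu>). FK w \<phi> z\<bar> + \<bar>LINT x|\<mu>. a x * w x * \<phi> x\<bar> + \<bar>lam\<bar> * \<bar>LINT z|(\<mu> \<Otimes>\<^sub>M \<mu>). FQ w \<phi> z\<bar>"
    unfolding F_def abs_mult[symmetric] by linarith
  also have "\<dots> \<le> ?m * kK * \<alpha>2 * \<beta>2 + ka * \<alpha>2 * \<beta>2 + \<bar>lam\<bar> * (kQ * \<alpha>q powr (2 * q - 1) * \<beta>q)"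
    by (intro add_mono mult_left_mono FK Fa FQ) auto
  finally show ?thesis by (simp add: algebra_simps)
qed

text \<open>Each integrand is bounded in some L^theta with theta > 1, so almost everywhere
  convergence suffices: theta = sigma for the \<open>K\<close> term, whose variables separate, theta
  = sigma/q for the nonlinear term and theta = sigma/2 for the term with \<open>a\<close>. This is
  where q < sigma and 2 < sigma enter.\<close>

lemma F_tendsto:
  fixes w \<phi> :: "nat \<Rightarrow> 'a \<Rightarrow> real"
  assumes w: "\<And>n. critical (w n)" and \<phi>: "\<And>n. critical (\<phi> n)"
    and wB: "\<And>n. (LINT x|\<mu>. \<bar>w n x\<bar> powr \<sigma>) \<le> B" and \<phi>B: "\<And>n. (LINT x|\<mu>. \<bar>\<phi> n x\<bar> powr \<sigma>) \<le> B"
    and [measurable]: "w' \<in> borel_measurable borel" "\<phi>' \<in> borel_measurable borel"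
    and wl: "AE x in \<mu>. (\<lambda>n. w n x) \<longlonglongrightarrow> w' x" and \<phi>l: "AE x in \<mu>. (\<lambda>n. \<phi> n x) \<longlonglongrightarrow> \<phi>' x"
  shows "(\<lambda>n. F (w n) (\<phi> n)) \<longlonglongrightarrow> F w' \<phi>'"
proof -
  have [measurable]: "w n \<in> borel_measurable borel" "\<phi> n \<in> borel_measurable borel" for n
    using w \<phi> critical_borel by auto
  have ints: "integrable \<mu> (\<lambda>x. \<bar>w n x\<bar> powr \<sigma>)" "integrable \<mu> (\<lambda>x. \<bar>\<phi> n x\<bar> powr \<sigma>)" for n
    using w \<phi> by (auto simp: critical_def)
  have \<sigma>1: "1 < \<sigma>" using two_less_\<sigma> by simp
  have B0: "0 \<le> B" using order_trans[OF integral_nonneg_AE wB[of 0]] by simp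
  have both: "AE z in \<mu> \<Otimes>\<^sub>M \<mu>. ((\<lambda>n. w n (fst z)) \<longlonglongrightarrow> w' (fst z) \<and> (\<lambda>n. \<phi> n (fst z)) \<longlonglongrightarrow> \<phi>' (fst z)) \<and>
      ((\<lambda>n. w n (snd z)) \<longlonglongrightarrow> w' (snd z) \<and> (\<lambda>n. \<phi> n (snd z)) \<longlonglongrightarrow> \<phi>' (snd z))"
    by (rule AE_pair_both) (use wl \<phi>l \<mu>.sigma_finite_measure_axioms in auto)
  have "(\<lambda>n. LINT z|(\<mu> \<Otimes>\<^sub>M \<mu>). FK (w n) (\<phi> n) z) \<longlonglongrightarrow> (LINT z|(\<mu> \<Otimes>\<^sub>M \<mu>). FK w' \<phi>' z)"
  proof (rule \<mu>\<mu>.integral_tendsto_powr_bounded[OF _ _ _ \<sigma>1])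
    show "AE z in \<mu> \<Otimes>\<^sub>M \<mu>. (\<lambda>n. FK (w n) (\<phi> n) z) \<longlonglongrightarrow> FK w' \<phi>' z"
      using both by eventually_elim (auto simp: FK_def intro!: tendsto_intros)
    fix n
    have le: "\<bar>\<bar>FK (w n) (\<phi> n) (x, y)\<bar> powr \<sigma>\<bar> \<le> (kK powr \<sigma> * \<bar>\<phi> n x\<bar> powr \<sigma>) * (\<bar>w n y\<bar> powr \<sigma>)" for x y
      using powr_mono2[OF _ _ FK_abs[of "w n" "\<phi> n" x y], of \<sigma>] \<sigma>1 k_nonneg by (simp add: powr_mult)
    have "integrable (\<mu> \<Otimes>\<^sub>M \<mu>) (\<lambda>z. \<bar>FK (w n) (\<phi> n) z\<bar> powr \<sigma>) \<and>
       \<bar>LINT z|(\<mu> \<Otimes>\<^sub>M \<mu>). \<bar>FK (w n) (\<phi> n) z\<bar> powr \<sigma>\<bar> \<le>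
       (LINT x|\<mu>. kK powr \<sigma> * \<bar>\<phi> n x\<bar> powr \<sigma>) * (LINT y|\<mu>. \<bar>w n y\<bar> powr \<sigma>)" (is "_ \<and> _ \<le> ?R")
      by (intro conjI \<mu>\<mu>.integral_pair_bound[where g = "\<lambda>z. \<bar>FK (w n) (\<phi> n) z\<bar> powr \<sigma>"
          and a = "\<lambda>x. kK powr \<sigma> * \<bar>\<phi> n x\<bar> powr \<sigma>" and b = "\<lambda>y. \<bar>w n y\<bar> powr \<sigma>"] le)
        (use ints in auto)
    moreover have "?R \<le> (kK powr \<sigma> * B) * B"
      unfolding integral_mult_right_zero
      by (intro mult_mono order_refl wB \<phi>B mult_nonneg_nonneg B0) (auto intro: integral_nonneg_AE)
    ultimately show "integrable (\<mu> \<Otimes>\<^sub>M \<mu>) (\<lambda>z. \<bar>FK (w n) (\<phi> n) z\<bar> powr \<sigma>)"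
      "(LINT z|(\<mu> \<Otimes>\<^sub>M \<mu>). \<bar>FK (w n) (\<phi> n) z\<bar> powr \<sigma>) \<le> (kK powr \<sigma> * B) * B"
      by linarith+
  qed auto
  moreover have "(\<lambda>n. LINT z|(\<mu> \<Otimes>\<^sub>M \<mu>). FQ (w n) (\<phi> n) z) \<longlonglongrightarrow> (LINT z|(\<mu> \<Otimes>\<^sub>M \<mu>). FQ w' \<phi>' z)"
  proof (rule \<mu>\<mu>.integral_tendsto_powr_bounded)
    show \<theta>: "1 < \<sigma> / q" using q_range by simp
    show "AE z in \<mu> \<Otimes>\<^sub>M \<mu>. (\<lambda>n. FQ (w n) (\<phi> n) z) \<longlonglongrightarrow> FQ w' \<phi>' z"
      using both
    proof eventually_elim
      case (elim z)
      then show ?case unfolding FQ_def using q_range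
        by (intro tendsto_mult[OF tendsto_mult[OF tendsto_mult]] tendsto_const tendsto_signed_powr tendsto_powr' tendsto_rabs) auto
    qed
    fix n
    \<comment> \<open>The power sigma/q turns |w y|^q into |w y|^sigma and leaves a product of
      degree q in the variable x, to which \<open>powr_product_le\<close> applies.\<close>
    have le: "\<bar>\<bar>FQ (w n) (\<phi> n) (x, y)\<bar> powr (\<sigma> / q)\<bar> \<le>
        (kQ powr (\<sigma> / q) * (\<bar>w n x\<bar> powr \<sigma> + \<bar>\<phi> n x\<bar> powr \<sigma>)) * (\<bar>w n y\<bar> powr \<sigma>)" for x y
    proof -
      have "\<bar>\<bar>FQ (w n) (\<phi> n) (x, y)\<bar> powr (\<sigma> / q)\<bar> \<le>
          ((kQ * (\<bar>w n x\<bar> powr (q - 1) * \<bar>\<phi> n x\<bar>)) * \<bar>w n y\<bar> powr q) powr (\<sigma> / q)"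
        using FQ_abs[of "w n" "\<phi> n" x y] \<theta> by (simp only: abs_of_nonneg[OF powr_ge_zero]) (intro powr_mono2, auto)
      also have "\<dots> = kQ powr (\<sigma> / q) * (\<bar>w n x\<bar> powr (q - 1) * \<bar>\<phi> n x\<bar>) powr (\<sigma> / q) * \<bar>w n y\<bar> powr \<sigma>"
        using k_nonneg q_range by (simp add: powr_mult powr_powr)
      also have "\<dots> \<le> (kQ powr (\<sigma> / q) * (\<bar>w n x\<bar> powr \<sigma> + \<bar>\<phi> n x\<bar> powr \<sigma>)) * (\<bar>w n y\<bar> powr \<sigma>)"
        using q_range by (intro mult_right_mono mult_left_mono powr_product_le) auto
      finally show ?thesis .
    qed
    have "integrable (\<mu> \<Otimes>\<^sub>M \<mu>) (\<lambda>z. \<bar>FQ (w n) (\<phi> n) z\<bar> powr (\<sigma> / q)) \<and>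
       \<bar>LINT z|(\<mu> \<Otimes>\<^sub>M \<mu>). \<bar>FQ (w n) (\<phi> n) z\<bar> powr (\<sigma> / q)\<bar> \<le>
       (LINT x|\<mu>. kQ powr (\<sigma> / q) * (\<bar>w n x\<bar> powr \<sigma> + \<bar>\<phi> n x\<bar> powr \<sigma>)) * (LINT y|\<mu>. \<bar>w n y\<bar> powr \<sigma>)" (is "_ \<and> _ \<le> ?R")
      by (intro conjI \<mu>\<mu>.integral_pair_bound[where g = "\<lambda>z. \<bar>FQ (w n) (\<phi> n) z\<bar> powr (\<sigma> / q)"
          and a = "\<lambda>x. kQ powr (\<sigma> / q) * (\<bar>w n x\<bar> powr \<sigma> + \<bar>\<phi> n x\<bar> powr \<sigma>)" and b = "\<lambda>y. \<bar>w n y\<bar> powr \<sigma>"] le)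
        (use ints in auto)
    moreover have "?R \<le> (kQ powr (\<sigma> / q) * (B + B)) * B"
      unfolding integral_mult_right_zero Bochner_Integration.integral_add[OF ints]
      by (intro mult_mono add_mono order_refl wB \<phi>B mult_nonneg_nonneg add_nonneg_nonneg B0) (auto intro: integral_nonneg_AE)
    ultimately show "integrable (\<mu> \<Otimes>\<^sub>M \<mu>) (\<lambda>z. \<bar>FQ (w n) (\<phi> n) z\<bar> powr (\<sigma> / q))"
      "(LINT z|(\<mu> \<Otimes>\<^sub>M \<mu>). \<bar>FQ (w n) (\<phi> n) z\<bar> powr (\<sigma> / q)) \<le> (kQ powr (\<sigma> / q) * (B + B)) * B"
      by linarith+
  qed auto
  moreover have "(\<lambda>n. LINT x|\<mu>. a x * w n x * \<phi> n x) \<longlonglongrightarrow> (LINT x|\<mu>. a x * w' x * \<phi>' x)"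
  proof (rule \<mu>.integral_tendsto_powr_bounded)
    show \<theta>: "1 < \<sigma> / 2" using two_less_\<sigma> by simp
    show "AE x in \<mu>. (\<lambda>n. a x * w n x * \<phi> n x) \<longlonglongrightarrow> a x * w' x * \<phi>' x"
      using wl \<phi>l by eventually_elim (intro tendsto_intros)
    fix n
    have le: "\<bar>a x * w n x * \<phi> n x\<bar> powr (\<sigma> / 2) \<le> ka powr (\<sigma> / 2) * (\<bar>w n x\<bar> powr \<sigma> + \<bar>\<phi> n x\<bar> powr \<sigma>)" for x
    proof -
      have "\<bar>a x * w n x * \<phi> n x\<bar> powr (\<sigma> / 2) \<le> (ka * (\<bar>w n x\<bar> * \<bar>\<phi> n x\<bar>)) powr (\<sigma> / 2)"
        using \<theta> by (intro powr_mono2 a_abs) auto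
      also have "\<dots> = ka powr (\<sigma> / 2) * (\<bar>w n x\<bar> powr (2 - 1) * \<bar>\<phi> n x\<bar>) powr (\<sigma> / 2)"
        using k_nonneg by (simp add: powr_mult)
      also have "\<dots> \<le> ka powr (\<sigma> / 2) * (\<bar>w n x\<bar> powr \<sigma> + \<bar>\<phi> n x\<bar> powr \<sigma>)"
        using two_less_\<sigma> by (intro mult_left_mono powr_product_le) auto
      finally show ?thesis .
    qed
    have i: "integrable \<mu> (\<lambda>x. ka powr (\<sigma> / 2) * (\<bar>w n x\<bar> powr \<sigma> + \<bar>\<phi> n x\<bar> powr \<sigma>))"
      using ints by auto
    show i2: "integrable \<mu> (\<lambda>x. \<bar>a x * w n x * \<phi> n x\<bar> powr (\<sigma> / 2))"
      by (rule Bochner_Integration.integrable_bound[OF i]) (use le in auto)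
    have "(LINT x|\<mu>. \<bar>a x * w n x * \<phi> n x\<bar> powr (\<sigma> / 2)) \<le> (LINT x|\<mu>. ka powr (\<sigma> / 2) * (\<bar>w n x\<bar> powr \<sigma> + \<bar>\<phi> n x\<bar> powr \<sigma>))"
      by (intro integral_mono i i2 le)
    also have "\<dots> \<le> ka powr (\<sigma> / 2) * (B + B)"
      unfolding integral_mult_right_zero Bochner_Integration.integral_add[OF ints]
      by (intro mult_left_mono add_mono wB \<phi>B) auto
    finally show "(LINT x|\<mu>. \<bar>a x * w n x * \<phi> n x\<bar> powr (\<sigma> / 2)) \<le> ka powr (\<sigma> / 2) * (B + B)" .
  qed auto
  ultimately show ?thesis unfolding F_def by (intro tendsto_intros)
qed

end

section \<open>Averages over cubes\<close>

definition step :: "nat \<Rightarrow> (nat \<Rightarrow> 'a set) \<Rightarrow> (nat \<Rightarrow> real) \<Rightarrow> 'a \<Rightarrow> real" where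
  "step m A c x = (\<Sum>i<m. c i * indicator (A i) x)"

lemma step_eq:
  assumes "disjoint_family_on A {..<m}" "j < m" "x \<in> A j"
  shows "step m A c x = c j"
proof -
  have "indicator (A i) x = (if i = j then 1 else 0 :: real)" if "i < m" for i
    using assms that by (auto simp: disjoint_family_on_def indicator_def)
  then have "step m A c x = (\<Sum>i<m. if i = j then c i else 0)"
    unfolding step_def by (intro sum.cong) auto
  then show ?thesis using assms(2) by simp
qed

text \<open>At each point at most one summand is nonzero; \<open>f 0 = 0\<close> covers the points
  outside all cells.\<close>

lemma step_comp:
  assumes "disjoint_family_on A {..<m}" "f 0 = 0"
  shows "f (step m A c x) = step m A (\<lambda>i. f (c i)) x"
proof (cases "\<exists>j<m. x \<in> A j")
  case True
  then show ?thesis using step_eq[OF assms(1)] by metis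
next
  case False
  then have "step m A d x = 0" for d unfolding step_def by (intro sum.neutral) (auto simp: indicator_def)
  then show ?thesis using assms(2) by simp
qed

lemma step_diff: "step m A c x - step m A d x = step m A (\<lambda>i. c i - d i) x"
  by (simp add: step_def sum_subtractf left_diff_distrib)

lemma step_borel [measurable]:
  assumes "\<And>i. A i \<in> sets borel" shows "step m A c \<in> borel_measurable borel"
  unfolding step_def using assms by measurable

lemma step_integral:
  assumes "\<And>i. integrable M (\<lambda>x. indicator (A i) x * v x :: real)"
  shows "integrable M (\<lambda>x. step m A c x * v x)"
    and "(LINT x|M. step m A c x * v x) = (\<Sum>i<m. c i * (LINT x|M. indicator (A i) x * v x))"
proof -
  have *: "(\<lambda>x. step m A c x * v x) = (\<lambda>x. \<Sum>i<m. c i * (indicator (A i) x * v x))"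
    unfolding step_def sum_distrib_right mult.assoc ..
  show "integrable M (\<lambda>x. step m A c x * v x)"
    unfolding * by (intro Bochner_Integration.integrable_sum integrable_mult_right assms)
  show "(LINT x|M. step m A c x * v x) = (\<Sum>i<m. c i * (LINT x|M. indicator (A i) x * v x))"
    unfolding * by (subst Bochner_Integration.integral_sum) (intro integrable_mult_right assms, subst integral_mult_right_zero, rule refl)
qed

lemma step_integral_one:
  assumes "\<And>i. integrable M (indicator (A i) :: 'a \<Rightarrow> real)"
  shows "integrable M (step m A c)"
    and "(LINT x|M. step m A c x) = (\<Sum>i<m. c i * (LINT x|M. indicator (A i) x))"
  using step_integral[where M = M and A = A and m = m and c = c and v = "\<lambda>_. 1"] assms by (simp_all only: mult_1_right)

context dirichlet_space
begin

lemma Int_domain_sets: "B \<in> sets borel \<Longrightarrow> B \<inter> \<Omega> \<in> sets \<mu>"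
  unfolding \<mu>_def sets_restrict_space by (intro image_eqI[of _ _ B]) auto

lemma integrable_indicator_\<mu>: "B \<in> sets borel \<Longrightarrow> integrable \<mu> (indicator B :: 'a \<Rightarrow> real)"
  by (intro \<mu>.integrable_const_bound[where B = 1] measurable_\<mu>) auto

text \<open>\<open>V0\<close> bounds the total volume of the cubes. It will be chosen independently
  of \<open>h\<close>, which makes the approximation estimate uniform over the grids.\<close>

definition cubes :: "real \<Rightarrow> real \<Rightarrow> nat \<Rightarrow> (nat \<Rightarrow> 'a set) \<Rightarrow> bool" where
  "cubes V0 h m A \<longleftrightarrow> 0 < h \<and> h \<le> 1 \<and> (\<forall>i. A i \<in> sets borel) \<and> (\<forall>i. measure lborel (A i) = h ^ DIM('a))
     \<and> real m * h ^ DIM('a) \<le> V0 \<and> (\<forall>i x y. x \<in> A i \<longrightarrow> y \<in> A i \<longrightarrow> norm (x - y) \<le> real DIM('a) * h)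
     \<and> disjoint_family_on A {..<m} \<and> \<Omega> \<subseteq> (\<Union>i<m. A i)"

text \<open>The divisor is the volume of the whole cube, also for cubes that cross the boundary.
  This is the mean of the zero extension, and cubes with only a small part in
  \<open>\<Omega>\<close> need no special treatment.\<close>

definition avg :: "real \<Rightarrow> (nat \<Rightarrow> 'a set) \<Rightarrow> ('a \<Rightarrow> real) \<Rightarrow> nat \<Rightarrow> real" where
  "avg h A u i = (LINT x|\<mu>. indicator (A i) x * u x) / h ^ DIM('a)"

text \<open>Positivity of \<open>measure\<close> implies finiteness here, because an infinite
  measure would be converted to the real number 0.\<close>

lemma integrable_indicator_lborel:
  "A \<in> sets borel \<Longrightarrow> 0 < measure lborel A \<Longrightarrow> integrable lborel (indicator A :: 'a \<Rightarrow> real)"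
  by (intro integrable_real_indicator) (auto simp: measure_def less_top dest: enn2real_positive_iff[THEN iffD1])

lemma cubesD:
  assumes "cubes V0 h m A"
  shows "0 < h" "h \<le> 1" "A i \<in> sets borel" "measure lborel (A i) = h ^ DIM('a)" "real m * h ^ DIM('a) \<le> V0"
    "disjoint_family_on A {..<m}" "\<Omega> \<subseteq> (\<Union>i<m. A i)"
    "x \<in> A i \<Longrightarrow> y \<in> A i \<Longrightarrow> norm (x - y) \<le> real DIM('a) * h"
    "integrable lborel (indicator (A i) :: 'a \<Rightarrow> real)"
  using assms integrable_indicator_lborel[of "A i"] unfolding cubes_def by auto

text \<open>\<open>V0\<close> is the volume of a ball containing every cube of every grid with
  \<open>h \<le> 1\<close>. As the cubes are disjoint, their total volume m h^N is the integral of
  the step function with all values 1, which lies below the indicator of the ball.\<close>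

lemma cubes_exist: "\<exists>V0. \<forall>h. 0 < h \<longrightarrow> h \<le> 1 \<longrightarrow> (\<exists>m A. cubes V0 h m A)"
proof -
  obtain R where R: "\<And>x. x \<in> \<Omega> \<Longrightarrow> norm x \<le> R" using bounded_domain unfolding bounded_iff by blast
  let ?B = "cball (0 :: 'a) (R + real DIM('a))"
  have iB: "integrable lborel (indicator ?B :: 'a \<Rightarrow> real)"
    by (intro integrable_real_indicator) (auto simp: emeasure_bounded_finite[OF bounded_cball, unfolded infinity_ennreal_def])
  have "\<exists>(m :: nat) A. cubes (measure lborel ?B) h m A" if h: "0 < h" "h \<le> 1" for h
  proof -
    obtain m :: nat and A where A: "\<And>i. A i \<in> sets borel" "\<And>i. measure lborel (A i) = h ^ DIM('a)"
      "\<And>i. i < m \<Longrightarrow> A i \<subseteq> ?B"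
      "\<And>i x y. x \<in> A i \<Longrightarrow> y \<in> A i \<Longrightarrow> norm (x - y) \<le> real DIM('a) * h"
      "disjoint_family_on A {..<m}" "\<Omega> \<subseteq> (\<Union>i<m. A i)"
      using cube_partition[where R = R and h = h and \<Omega> = \<Omega>, OF R h] by metis
    have iA: "integrable lborel (indicator (A i) :: 'a \<Rightarrow> real)" for i
      using integrable_indicator_lborel[OF A(1)] A(2) h by simp
    have "real m * h ^ DIM('a) = (LINT x|lborel. step m A (\<lambda>_. 1) x)"
      using step_integral_one(2)[where A = A and m = m and c = "\<lambda>_. 1", OF iA] A(2) by simp
    also have "\<dots> \<le> (LINT x|lborel. indicator ?B x)"
    proof (rule integral_mono[OF _ iB])
      show "integrable lborel (step m A (\<lambda>_. 1))" by (rule step_integral_one(1)[OF iA])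
      show "step m A (\<lambda>_. 1) x \<le> indicator ?B x" for x
      proof (cases "\<exists>j<m. x \<in> A j")
        case True
        then obtain j where "j < m" "x \<in> A j" by blast
        then show ?thesis using step_eq[OF A(5), of j x] A(3)[of j] by auto
      next
        case False
        then have "step m A (\<lambda>_. 1) x = 0" unfolding step_def by (intro sum.neutral) (auto simp: indicator_def)
        then show ?thesis by simp
      qed
    qed
    finally have "real m * h ^ DIM('a) \<le> measure lborel ?B" by simp
    then show ?thesis using A h unfolding cubes_def by blast
  qed
  then show ?thesis by blast
qed

lemma step_critical:
  assumes "cubes V0 h m A" shows "critical (step m A c)"
  unfolding critical_def
proof
  note A = cubesD[OF assms]
  have [measurable]: "A i \<in> sets borel" for i by (rule A)
  show [measurable]: "step m A c \<in> borel_measurable borel" by measurable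
  have "(\<lambda>x. \<bar>step m A c x\<bar> powr \<sigma>) = step m A (\<lambda>i. \<bar>c i\<bar> powr \<sigma>)"
    using step_comp[OF A(6), of "\<lambda>t. \<bar>t\<bar> powr \<sigma>"] two_less_\<sigma> by (auto simp: fun_eq_iff)
  moreover have "integrable \<mu> (step m A (\<lambda>i. \<bar>c i\<bar> powr \<sigma>))"
    by (intro step_integral_one(1) integrable_indicator_\<mu> A)
  ultimately show "integrable \<mu> (\<lambda>x. \<bar>step m A c x\<bar> powr \<sigma>)" by simp
qed

lemma measure_\<mu>_cube:
  assumes "cubes V0 h m A" shows "measure \<mu> (A i \<inter> \<Omega>) \<le> h ^ DIM('a)" "(LINT x|\<mu>. indicator (A i) x) \<le> h ^ DIM('a)"
proof -
  note A = cubesD[OF assms]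
  have [measurable]: "A i \<in> sets borel" by (rule A)
  have "(LINT x|\<mu>. indicator (A i) x :: real) = (LINT x|lborel. indicator \<Omega> x * indicator (A i) x)"
    by (rule integral_\<mu>)
  also have "\<dots> \<le> (LINT x|lborel. indicator (A i) x)"
    by (rule integral_mono_AE'[OF A(9)]) (auto simp: indicator_def)
  also have "\<dots> = h ^ DIM('a)" using A(4) by simp
  finally show 1: "(LINT x|\<mu>. indicator (A i) x) \<le> h ^ DIM('a)" .
  have "(LINT x|\<mu>. indicator (A i) x) = (LINT x|\<mu>. indicator (A i \<inter> \<Omega>) x :: real)"
    by (intro Bochner_Integration.integral_cong) (auto simp: indicator_def)
  also have "\<dots> = measure \<mu> (A i \<inter> \<Omega>)"
  proof -
    have "A i \<inter> \<Omega> \<in> sets \<mu>" by (intro Int_domain_sets A)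
    then show ?thesis by simp
  qed
  finally show "measure \<mu> (A i \<inter> \<Omega>) \<le> h ^ DIM('a)" using 1 by simp
qed

lemma integrable_\<mu>_indicator:
  assumes "integrable \<mu> u" "B \<in> sets borel" shows "integrable \<mu> (\<lambda>x. indicator B x * (u x :: real))"
proof -
  have [measurable]: "(indicator B :: 'a \<Rightarrow> real) \<in> borel_measurable \<mu>" "u \<in> borel_measurable \<mu>"
    using assms by (auto intro: measurable_\<mu>)
  show ?thesis
  proof (rule Bochner_Integration.integrable_bound[OF assms(1)])
    show "(\<lambda>x. indicator B x * u x) \<in> borel_measurable \<mu>" by measurable
  qed (auto simp: indicator_def)
qed

text \<open>Jensen's inequality on each cube.\<close>

lemma step_avg_powr:
  assumes C: "cubes V0 h m A" and u: "u \<in> X" and p: "1 < p" "p \<le> \<sigma>"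
  shows "(LINT x|\<mu>. \<bar>step m A (avg h A u) x\<bar> powr p) \<le> (CS p * X0_norm s u) powr p"
proof -
  note A = cubesD[OF C]
  let ?V = "h ^ DIM('a)"
  have V: "?V > 0" using A(1) by simp
  have [measurable]: "A i \<in> sets borel" "u \<in> borel_measurable borel" for i
    using A X_borel[OF u] by auto
  have up: "integrable \<mu> (\<lambda>x. \<bar>u x\<bar> powr p)" using X_powr(1)[OF u] p by simp
  have ii: "integrable \<mu> (indicator (A i) :: 'a \<Rightarrow> real)" for i
    by (intro integrable_indicator_\<mu> A)
  have iu: "integrable \<mu> (\<lambda>x. indicator (A i) x * \<bar>u x\<bar> powr p)" for i
    by (rule integrable_\<mu>_indicator[OF up A(3)])
  \<comment> \<open>The part of the cube inside \<open>\<Omega>\<close> has volume at most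
    \<open>?V\<close>. This is used once for the mean and once for the integral on the left, after
    which the powers of \<open>?V\<close> cancel.\<close>
  have cell: "\<bar>avg h A u i\<bar> powr p * (LINT x|\<mu>. indicator (A i) x) \<le> (LINT x|\<mu>. indicator (A i) x * \<bar>u x\<bar> powr p)" for i
  proof -
    let ?J = "LINT x|\<mu>. indicator (A i) x * \<bar>u x\<bar> powr p"
    have As: "A i \<inter> \<Omega> \<in> sets \<mu>" by (intro Int_domain_sets A)
    have e: "(LINT x|\<mu>. indicator (A i \<inter> \<Omega>) x * v x) = (LINT x|\<mu>. indicator (A i) x * (v x :: real))" for v
      by (intro Bochner_Integration.integral_cong) (auto simp: indicator_def)
    have J0: "0 \<le> ?J" by (intro integral_nonneg_AE) auto
    have "\<bar>LINT x|\<mu>. indicator (A i) x * u x\<bar> powr p \<le> measure \<mu> (A i \<inter> \<Omega>) powr (p - 1) * ?J"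
      using \<mu>.set_integral_powr_le(2)[OF _ As p(1) up] unfolding e by simp
    also have "\<dots> \<le> ?V powr (p - 1) * ?J"
      using p J0 measure_\<mu>_cube(1)[OF C, of i] by (intro mult_right_mono powr_mono2) auto
    finally have 1: "\<bar>LINT x|\<mu>. indicator (A i) x * u x\<bar> powr p \<le> ?V powr (p - 1) * ?J" .
    have "\<bar>avg h A u i\<bar> powr p * (LINT x|\<mu>. indicator (A i) x) \<le> \<bar>avg h A u i\<bar> powr p * ?V"
      by (intro mult_left_mono measure_\<mu>_cube(2)[OF C]) auto
    also have "\<dots> = \<bar>LINT x|\<mu>. indicator (A i) x * u x\<bar> powr p / ?V powr p * ?V"
      using V by (simp add: avg_def powr_divide)
    also have "\<dots> \<le> ?V powr (p - 1) * ?J / ?V powr p * ?V"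
      using V 1 by (intro mult_right_mono divide_right_mono) auto
    also have "\<dots> = ?J"
      using V A(1) by (simp add: powr_diff)
    finally show ?thesis .
  qed
  have "(\<lambda>x. \<bar>step m A (avg h A u) x\<bar> powr p) = step m A (\<lambda>i. \<bar>avg h A u i\<bar> powr p)"
    using step_comp[OF A(6), of "\<lambda>t. \<bar>t\<bar> powr p"] p by (auto simp: fun_eq_iff)
  then have "(LINT x|\<mu>. \<bar>step m A (avg h A u) x\<bar> powr p) = (\<Sum>i<m. \<bar>avg h A u i\<bar> powr p * (LINT x|\<mu>. indicator (A i) x))"
    using step_integral_one(2)[OF ii] by simp
  also have "\<dots> \<le> (\<Sum>i<m. LINT x|\<mu>. indicator (A i) x * \<bar>u x\<bar> powr p)"
    by (intro sum_mono cell)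
  also have "\<dots> = (LINT x|\<mu>. step m A (\<lambda>_. 1) x * \<bar>u x\<bar> powr p)"
    using step_integral(2)[where A = A and m = m and c = "\<lambda>_. 1", OF iu] by (simp only: mult_1_left)
  also have "\<dots> = (LINT x|\<mu>. \<bar>u x\<bar> powr p)"
  proof (intro Bochner_Integration.integral_cong refl)
    fix x assume "x \<in> space \<mu>"
    then obtain j where "j < m" "x \<in> A j" using A(7) by auto
    then show "step m A (\<lambda>_. 1) x * \<bar>u x\<bar> powr p = \<bar>u x\<bar> powr p"
      using step_eq[OF A(6), of j x] by simp
  qed
  also have "\<dots> \<le> (CS p * X0_norm s u) powr p" using X_powr(2)[OF u] p by simp
  finally show ?thesis .
qed

text \<open>Gives the size of the box for Brouwer's theorem, and the boundedness of
  \<open>avg\<close> as a linear functional on \<open>X\<close>.\<close>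

lemma avg_bound:
  assumes C: "cubes V0 h m A" and u: "u \<in> X"
  shows "\<bar>avg h A u i\<bar> \<le> CS 1 * X0_norm s u / h ^ DIM('a)"
proof -
  note A = cubesD[OF C]
  have [measurable]: "A i \<in> sets borel" "u \<in> borel_measurable borel"
    using A X_borel[OF u] by auto
  have "\<bar>LINT x|\<mu>. indicator (A i) x * u x\<bar> \<le> (LINT x|\<mu>. \<bar>indicator (A i) x * u x\<bar>)"
    by (rule integral_abs_bound)
  also have "\<dots> \<le> (LINT x|\<mu>. \<bar>u x\<bar>)"
    using integrable_\<mu>_indicator[OF X_L1(1)[OF u] A(3)] X_L1(1)[OF u]
    by (intro integral_mono) (auto simp: indicator_def)
  also have "\<dots> \<le> CS 1 * X0_norm s u" by (rule X_L1(2)[OF u])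
  finally show ?thesis using A(1) by (simp add: avg_def divide_right_mono)
qed

text \<open>On a cube of side \<open>h\<close> the Gagliardo kernel is at least \<open>(N h) powr -(N + 2 s)\<close>, so the seminorm bounds the
  mean oscillation.\<close>

lemma step_avg_approx:
  assumes C: "cubes V0 h m A" and u: "u \<in> X"
  shows "(LINT x|\<mu>. \<bar>u x - step m A (avg h A u) x\<bar>) \<le>
    h powr s * (V0 + real DIM('a) powr (real DIM('a) + 2 * s) * (LINT z|lborel. gagliardo s u u z))"
proof -
  note A = cubesD[OF C]
  let ?N = "real DIM('a)" and ?V = "h ^ DIM('a)"
  have V: "?V > 0" using A(1) by simp
  have N: "?N > 0" by simp
  have [measurable]: "A i \<in> sets borel" "u \<in> borel_measurable borel" for i
    using A X_borel[OF u] by auto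
  \<comment> \<open>The weights come from |t| <= h^s + h^(-s) t^2. The first term costs h^s times a
    volume, the second h^(-s) (N h)^(N + 2 s) / h^N = N^(N + 2 s) h^s times the seminorm, so both
    have order h^s.\<close>
  define \<kappa> where "\<kappa> = h powr (- s) * (?N * h) powr (?N + 2 * s)"
  have \<kappa>0: "0 \<le> \<kappa>" by (simp add: \<kappa>_def)
  \<comment> \<open>As the cubes are disjoint, this is the indicator of the pairs whose two points
    share a cube.\<close>
  define I where "I z = (\<Sum>i<m. indicator (A i) (fst z) * indicator (A i) (snd z) :: real)" for z
  define H where "H z = h powr s * I z + \<kappa> * gagliardo s u u z" for z
  have Ii: "integrable lborel I" "(LINT z|lborel. I z) \<le> real m * (?V * ?V)"
  proof -
    have b: "integrable lborel (\<lambda>z. indicator (A i) (fst z) * indicator (A i) (snd z) :: real)"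
      "\<bar>LINT z|lborel. indicator (A i) (fst z) * indicator (A i) (snd z) :: real\<bar> \<le> ?V * ?V" for i
      using lborel_pair.integral_pair_bound[where g = "\<lambda>z. indicator (A i) (fst z) * indicator (A i) (snd z)"
          and a = "indicator (A i)" and b = "indicator (A i)"] A(4)[of i] A(9)[of i]
      by (auto simp: lborel_prod)
    show "integrable lborel I" unfolding I_def by (intro Bochner_Integration.integrable_sum b(1))
    have "(LINT z|lborel. I z) = (\<Sum>i<m. LINT z|lborel. indicator (A i) (fst z) * indicator (A i) (snd z))"
      unfolding I_def by (intro Bochner_Integration.integral_sum b(1))
    also have "\<dots> \<le> (\<Sum>i<m. ?V * ?V)" using b(2) by (intro sum_mono) (auto simp: abs_le_iff)
    finally show "(LINT z|lborel. I z) \<le> real m * (?V * ?V)" by simp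
  qed
  have Hi: "integrable lborel H" unfolding H_def using Ii(1) X_gagliardo[OF u] by simp
  then have Hp: "integrable (lborel \<Otimes>\<^sub>M lborel) H" by (simp add: lborel_prod)
  have I0: "0 \<le> I z" for z unfolding I_def by (intro sum_nonneg) auto
  have H0: "0 \<le> H z" for z unfolding H_def by (intro add_nonneg_nonneg mult_nonneg_nonneg I0 \<kappa>0 gagliardo_nonneg) simp
  have I1: "1 \<le> I (x, y)" if "i < m" "x \<in> A i" "y \<in> A i" for i x y
  proof -
    have "indicator (A i) x * indicator (A i) y \<le> I (x, y)"
      unfolding I_def fst_conv snd_conv using that
      by (intro member_le_sum[of i "{..<m}" "\<lambda>i. indicator (A i) x * indicator (A i) y"]) auto
    then show ?thesis using that by simp
  qed
  have osc: "\<bar>u x - u y\<bar> \<le> H (x, y)" if i: "i < m" "x \<in> A i" "y \<in> A i" for i x y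
  proof (cases "x = y")
    case True then show ?thesis using H0 by simp
  next
    case False
    then have n0: "0 < norm (x - y)" by simp
    have nb: "norm (x - y) powr (?N + 2 * s) \<le> (?N * h) powr (?N + 2 * s)"
      using A(8)[OF i(2,3)] s_range by (intro powr_mono2) auto
    have "(u x - u y)\<^sup>2 = norm (x - y) powr (?N + 2 * s) * gagliardo s u u (x, y)"
      using n0 by (simp add: gagliardo_def power2_eq_square)
    also have "\<dots> \<le> (?N * h) powr (?N + 2 * s) * gagliardo s u u (x, y)"
      by (intro mult_right_mono nb gagliardo_nonneg)
    finally have sq: "h powr (- s) * (u x - u y)\<^sup>2 \<le> \<kappa> * gagliardo s u u (x, y)"
      unfolding \<kappa>_def mult.assoc by (intro mult_left_mono) auto
    have hp: "0 < h powr s" using A(1) by simp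
    have "\<bar>t\<bar> \<le> y + t\<^sup>2 / y" if "0 < y" for t y :: real
    proof (cases "\<bar>t\<bar> \<le> y")
      case True
      then show ?thesis using that by (simp add: add_increasing2)
    next
      case False
      then have "\<bar>t\<bar> * y \<le> \<bar>t\<bar> * \<bar>t\<bar>" by (intro mult_left_mono) auto
      then have "\<bar>t\<bar> \<le> t\<^sup>2 / y" using that by (simp add: pos_le_divide_eq power2_eq_square)
      then show ?thesis using that by simp
    qed
    from this[OF hp, of "u x - u y"] have "\<bar>u x - u y\<bar> \<le> h powr s + h powr (- s) * (u x - u y)\<^sup>2"
      by (simp add: powr_minus field_simps)
    also have "\<dots> \<le> H (x, y)"
      unfolding H_def using sq mult_left_mono[OF I1[OF i], of "h powr s"] by simp
    finally show ?thesis .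
  qed
  have u_lb: "integrable lborel u"
  proof -
    have "(\<lambda>x. indicator \<Omega> x * u x) = u" using X_outside[OF u] by (force simp: indicator_def)
    then show ?thesis using X_L1(1)[OF u] by (simp add: integrable_\<mu>_iff)
  qed
  have uA: "integrable lborel (\<lambda>y. indicator (A i) y * u y)" for i
    using integrable_mult_indicator[OF _ u_lb, of "A i"] by simp
  \<comment> \<open>\<open>u\<close> vanishes outside \<open>\<Omega>\<close>, so the average is a
    mean over the full cube; hence u x minus the average is the mean of u x - u y over y in the
    cube.\<close>
  have avg_lb: "avg h A u i = (LINT y|lborel. indicator (A i) y * u y) / ?V" for i
  proof -
    have "(\<lambda>x. indicator \<Omega> x * (indicator (A i) x * u x)) = (\<lambda>x. indicator (A i) x * u x)"
      using X_outside[OF u] by (force simp: indicator_def)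
    then show ?thesis by (simp add: avg_def integral_\<mu>)
  qed
  have ae: "AE x in lborel. indicator \<Omega> x * \<bar>u x - step m A (avg h A u) x\<bar> \<le> (LINT y|lborel. H (x, y)) / ?V"
    using lborel_pair.AE_integrable_fst'[OF Hp]
  proof eventually_elim
    case (elim x)
    show ?case
    proof (cases "x \<in> \<Omega>")
      case False
      then show ?thesis using V H0 by (simp add: integral_nonneg_AE)
    next
      case True
      then obtain i where i: "i < m" "x \<in> A i" using A(7) by auto
      have c: "integrable lborel (\<lambda>y. indicator (A i) y * u x)" using A(9)[of i] by simp
      have "u x - avg h A u i = (u x * ?V - (LINT y|lborel. indicator (A i) y * u y)) / ?V"
        using V A(1) by (simp add: avg_lb diff_divide_distrib)
      also have "u x * ?V = (LINT y|lborel. indicator (A i) y * u x)"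
        using A(4)[of i] by simp
      also have "\<dots> - (LINT y|lborel. indicator (A i) y * u y) = (LINT y|lborel. indicator (A i) y * u x - indicator (A i) y * u y)"
        using c uA by simp
      finally have "\<bar>u x - avg h A u i\<bar> = \<bar>LINT y|lborel. indicator (A i) y * u x - indicator (A i) y * u y\<bar> / ?V"
        using V by simp
      also have "\<dots> \<le> (LINT y|lborel. H (x, y)) / ?V"
      proof (rule divide_right_mono)
        have "\<bar>LINT y|lborel. indicator (A i) y * u x - indicator (A i) y * u y\<bar> \<le>
            (LINT y|lborel. \<bar>indicator (A i) y * u x - indicator (A i) y * u y\<bar>)" by (rule integral_abs_bound)
        also have "\<dots> \<le> (LINT y|lborel. H (x, y))"
          using c uA[of i] elim osc[OF i] H0
          by (intro integral_mono) (auto simp: indicator_def)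
        finally show "\<bar>LINT y|lborel. indicator (A i) y * u x - indicator (A i) y * u y\<bar> \<le> (LINT y|lborel. H (x, y))" .
      qed (use V in simp)
      finally show ?thesis using True step_eq[OF A(6) i, of "avg h A u"] by simp
    qed
  qed
  have "(LINT x|\<mu>. \<bar>u x - step m A (avg h A u) x\<bar>) = (LINT x|lborel. indicator \<Omega> x * \<bar>u x - step m A (avg h A u) x\<bar>)"
    by (rule integral_\<mu>)
  also have "\<dots> \<le> (LINT x|lborel. (LINT y|lborel. H (x, y)) / ?V)"
    by (rule integral_mono_AE'[OF _ ae])
      (use lborel_pair.integrable_fst'[OF Hp] H0 V in \<open>auto intro!: AE_I2 divide_nonneg_nonneg integral_nonneg_AE\<close>)
  also have "\<dots> = (LINT z|lborel. H z) / ?V"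
    using lborel_pair.integral_fst'[OF Hp] by (simp add: lborel_prod)
  also have "(LINT z|lborel. H z) = h powr s * (LINT z|lborel. I z) + \<kappa> * (LINT z|lborel. gagliardo s u u z)"
    unfolding H_def using Ii(1) X_gagliardo[OF u] by simp
  also have "\<dots> / ?V \<le> (h powr s * (real m * (?V * ?V)) + \<kappa> * (LINT z|lborel. gagliardo s u u z)) / ?V"
    using V Ii(2) by (intro divide_right_mono add_right_mono mult_left_mono) auto
  also have "\<dots> = h powr s * (real m * ?V) + \<kappa> / ?V * (LINT z|lborel. gagliardo s u u z)"
    using V A(1) by (simp add: add_divide_distrib)
  also have "\<kappa> / ?V = h powr s * ?N powr (?N + 2 * s)"
  proof -
    have "?V = h powr ?N" using A(1) by (simp add: powr_realpow)
    moreover have "h powr (- s) * h powr (?N + 2 * s) = h powr s * h powr ?N"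
      by (simp flip: powr_add)
    ultimately show ?thesis
      using A(1) by (simp add: \<kappa>_def powr_mult field_simps)
  qed
  also have "h powr s * (real m * ?V) + h powr s * ?N powr (?N + 2 * s) * (LINT z|lborel. gagliardo s u u z) \<le>
      h powr s * V0 + h powr s * ?N powr (?N + 2 * s) * (LINT z|lborel. gagliardo s u u z)"
    using A(5) by (intro add_right_mono mult_left_mono) auto
  finally show ?thesis by (simp add: algebra_simps)
qed

end

section \<open>Existence for Borel data\<close>

context dirichlet_space
begin

lemma X0_norm_sq: "u \<in> X \<Longrightarrow> (X0_norm s u)\<^sup>2 = energy s u u"
  by (simp add: X0_norm_def energy_nonneg)

lemma avg_add:
  assumes "u \<in> X" "v \<in> X" "A i \<in> sets borel"
  shows "avg h A (\<lambda>x. u x + v x) i = avg h A u i + avg h A v i"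
  using integrable_\<mu>_indicator[OF X_L1(1)[OF assms(1)] assms(3)] integrable_\<mu>_indicator[OF X_L1(1)[OF assms(2)] assms(3)]
  by (simp add: avg_def distrib_left add_divide_distrib)

lemma avg_scale: "avg h A (\<lambda>x. c * u x) i = c * avg h A u i"
proof -
  have "(\<lambda>x. indicator (A i) x * (c * u x)) = (\<lambda>x. c * (indicator (A i) x * u x))" by auto
  then show ?thesis by (simp add: avg_def)
qed

lemma step_abs_integral:
  assumes C: "cubes V0 h m A"
  shows "integrable \<mu> (\<lambda>x. \<bar>step m A c x\<bar>)" "(LINT x|\<mu>. \<bar>step m A c x\<bar>) \<le> (\<Sum>i<m. \<bar>c i\<bar>) * h ^ DIM('a)"
proof -
  note A = cubesD[OF C]
  have e: "(\<lambda>x. \<bar>step m A c x\<bar>) = step m A (\<lambda>i. \<bar>c i\<bar>)"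
    using step_comp[OF A(6), of abs] by (auto simp: fun_eq_iff)
  have ii: "integrable \<mu> (indicator (A i) :: 'a \<Rightarrow> real)" for i by (intro integrable_indicator_\<mu> A)
  show "integrable \<mu> (\<lambda>x. \<bar>step m A c x\<bar>)" unfolding e by (intro step_integral_one ii)
  have "(LINT x|\<mu>. \<bar>step m A c x\<bar>) = (\<Sum>i<m. \<bar>c i\<bar> * (LINT x|\<mu>. indicator (A i) x))"
    unfolding e by (intro step_integral_one ii)
  also have "\<dots> \<le> (\<Sum>i<m. \<bar>c i\<bar> * h ^ DIM('a))"
    by (intro sum_mono mult_left_mono measure_\<mu>_cube(2)[OF C]) auto
  finally show "(LINT x|\<mu>. \<bar>step m A c x\<bar>) \<le> (\<Sum>i<m. \<bar>c i\<bar>) * h ^ DIM('a)" by (simp add: sum_distrib_right)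
qed

lemma step_integrable: "cubes V0 h m A \<Longrightarrow> integrable \<mu> (step m A c)"
  by (intro step_integral_one integrable_indicator_\<mu> cubesD)

text \<open>Rellich--Kondrachov: a diagonal argument makes all cube averages converge along a subsequence,
  and the averages approximate the functions uniformly in \<open>L\<^sup>1\<close>.\<close>

lemma compact_embedding:
  fixes u :: "nat \<Rightarrow> 'a \<Rightarrow> real"
  assumes u: "\<And>n. u n \<in> X" and bd: "\<And>n. X0_norm s (u n) \<le> \<rho>"
    and C: "\<And>j. cubes V0 (h j) (m j) (A j)" and h0: "h \<longlonglongrightarrow> 0"
  shows "\<exists>r v. strict_mono r \<and> v \<in> borel_measurable borel \<and> (AE x in \<mu>. (\<lambda>n. u (r n) x) \<longlonglongrightarrow> v x) \<and>
    (AE x in \<mu>. (\<lambda>n. step (m (r n)) (A (r n)) (avg (h (r n)) (A (r n)) (u (r n))) x) \<longlonglongrightarrow> v x)"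
proof -
  note A = cubesD[OF C]
  define P where "P j w = step (m j) (A j) (avg (h j) (A j) w)" for j w
  \<comment> \<open>The constant of \<open>step_avg_approx\<close>, with the seminorm integral
    replaced by its bound: \<rho>^2 divided by the factor in front of the energy.\<close>
  define D where "D = V0 + real DIM('a) powr (real DIM('a) + 2 * s) * (\<rho>\<^sup>2 / (frac_const DIM('a) s / 2))"
  have \<rho>0: "0 \<le> \<rho>" using bd[of 0] X0_norm_nonneg[OF u, of 0] by simp
  have C1: "CS 1 > 0" using CS_pos[of 1] two_less_\<sigma> by simp
  have approx: "(LINT x|\<mu>. \<bar>u n x - P j (u n) x\<bar>) \<le> h j powr s * D" for n j
  proof -
    have "(X0_norm s (u n))\<^sup>2 \<le> \<rho>\<^sup>2" using bd X0_norm_nonneg[OF u] by (intro power_mono)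
    then have "frac_const DIM('a) s / 2 * (LINT z|lborel. gagliardo s (u n) (u n) z) \<le> \<rho>\<^sup>2"
      using X0_norm_sq[OF u, of n] energy_eq[OF u u, of n n] by simp
    then have "(LINT z|lborel. gagliardo s (u n) (u n) z) \<le> \<rho>\<^sup>2 / (frac_const DIM('a) s / 2)"
      using energy_const_pos by (simp add: pos_le_divide_eq mult.commute)
    then show ?thesis
      unfolding P_def D_def
      by (intro order_trans[OF step_avg_approx[OF C u]] mult_left_mono add_left_mono) auto
  qed
  have hs0: "(\<lambda>j. h j powr s * D) \<longlonglongrightarrow> 0"
  proof -
    have "(\<lambda>j. h j powr s * D) \<longlonglongrightarrow> 0 powr s * D"
      using s_range A(1) by (intro tendsto_mult tendsto_powr' h0 tendsto_const) (auto intro!: always_eventually less_imp_le)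
    then show ?thesis by simp
  qed
  have Pint: "integrable \<mu> (P j w)" for j w unfolding P_def by (rule step_integrable[OF C])
  \<comment> \<open>A single index for the pairs (grid j, cube i), so that one diagonal argument
    treats the averages on all grids at once.\<close>
  define avgs where "avgs n k = (case prod_decode k of (j, i) \<Rightarrow> avg (h j) (A j) (u n) i)" for n k
  have "bounded (range (\<lambda>n. avgs n k))" for k
  proof -
    obtain j i where ji: "prod_decode k = (j, i)" by (cases "prod_decode k") auto
    have "\<bar>avgs n k\<bar> \<le> CS 1 * \<rho> / h j ^ DIM('a)" for n
    proof -
      have "\<bar>avgs n k\<bar> \<le> CS 1 * X0_norm s (u n) / h j ^ DIM('a)"
        using avg_bound[OF C u] by (simp add: avgs_def ji)
      also have "\<dots> \<le> CS 1 * \<rho> / h j ^ DIM('a)"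
        using A(1)[of j] C1 bd by (intro divide_right_mono mult_left_mono) auto
      finally show ?thesis .
    qed
    then show ?thesis by (intro boundedI[where B = "CS 1 * \<rho> / h j ^ DIM('a)"]) auto
  qed
  then obtain r1 where r1: "strict_mono r1" "\<And>k. convergent (\<lambda>n. avgs (r1 n) k)"
    using diagonal_convergent_subsequence[of avgs] by blast
  have avg_conv: "convergent (\<lambda>n. avg (h j) (A j) (u (r1 n)) i)" for j i
    using r1(2)[of "prod_encode (j, i)"] by (simp add: avgs_def)
  have "\<exists>N. \<forall>p\<ge>N. \<forall>q\<ge>N. (LINT x|\<mu>. \<bar>u (r1 p) x - u (r1 q) x\<bar>) < e" if "e > 0" for e
  proof -
    have "\<forall>\<^sub>F j in sequentially. h j powr s * D < e / 3"
      using hs0 \<open>e > 0\<close> by (intro order_tendstoD) auto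
    then obtain j where j: "h j powr s * D < e / 3" by (auto dest: eventually_happens)
    let ?a = "\<lambda>n. avg (h j) (A j) (u (r1 n))" and ?V = "h j ^ DIM('a)"
    \<comment> \<open>Chosen so that \<open>m j\<close> cubes of volume \<open>?V\<close> contribute
      at most e/3 in total; the added 1 covers \<open>m j = 0\<close>.\<close>
    define \<delta> where "\<delta> = e / (3 * (real (m j) + 1) * ?V)"
    have V: "?V > 0" using A(1) by simp
    then have \<delta>: "\<delta> > 0" using \<open>e > 0\<close> by (simp add: \<delta>_def)
    have "\<exists>N. \<forall>p\<ge>N. \<forall>q\<ge>N. \<bar>?a p i - ?a q i\<bar> < \<delta>" for i
      using convergent_Cauchy[OF avg_conv[of j i]] \<delta> unfolding Cauchy_def dist_real_def by blast
    then obtain N where N: "\<And>i p q. p \<ge> N i \<Longrightarrow> q \<ge> N i \<Longrightarrow> \<bar>?a p i - ?a q i\<bar> < \<delta>" by metis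
    have "(LINT x|\<mu>. \<bar>u (r1 p) x - u (r1 q) x\<bar>) < e"
      if pq: "p \<ge> Max (N ` {..m j})" "q \<ge> Max (N ` {..m j})" for p q
    proof -
      have "(LINT x|\<mu>. \<bar>u (r1 p) x - u (r1 q) x\<bar>) \<le> (LINT x|\<mu>. \<bar>u (r1 p) x - P j (u (r1 p)) x\<bar> +
          \<bar>P j (u (r1 p)) x - P j (u (r1 q)) x\<bar> + \<bar>u (r1 q) x - P j (u (r1 q)) x\<bar>)"
        using X_L1(1)[OF u] Pint by (intro integral_mono) (auto simp: abs_triangle_ineq)
      also have "\<dots> = (LINT x|\<mu>. \<bar>u (r1 p) x - P j (u (r1 p)) x\<bar>) +
          (LINT x|\<mu>. \<bar>P j (u (r1 p)) x - P j (u (r1 q)) x\<bar>) + (LINT x|\<mu>. \<bar>u (r1 q) x - P j (u (r1 q)) x\<bar>)"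
        using X_L1(1)[OF u] Pint by simp
      also have "(LINT x|\<mu>. \<bar>P j (u (r1 p)) x - P j (u (r1 q)) x\<bar>) \<le> (\<Sum>i<m j. \<bar>?a p i - ?a q i\<bar>) * ?V"
        unfolding P_def step_diff by (rule step_abs_integral(2)[OF C])
      also have "\<dots> \<le> (\<Sum>i<m j. \<delta>) * ?V"
      proof (intro mult_right_mono sum_mono)
        fix i assume "i \<in> {..<m j}"
        then have "N i \<le> Max (N ` {..m j})" by (intro Max_ge) auto
        from N[OF order_trans[OF this pq(1)] order_trans[OF this pq(2)]]
        show "\<bar>?a p i - ?a q i\<bar> \<le> \<delta>" by (rule less_imp_le)
      qed (use V in auto)
      also have "(\<Sum>i<m j. \<delta>) * ?V \<le> e / 3"
      proof -
        have "(\<Sum>i<m j. \<delta>) * ?V = real (m j) * (e / (3 * (real (m j) + 1)))"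
          using V A(1)[of j] by (simp add: \<delta>_def)
        also have "\<dots> \<le> e / 3" using \<open>e > 0\<close> by (simp add: field_simps)
        finally show ?thesis .
      qed
      finally show ?thesis using j approx[of "r1 p" j] approx[of "r1 q" j] by linarith
    qed
    then show ?thesis by blast
  qed
  from L1_limit_representative[of "\<lambda>n. u (r1 n)", OF u this] obtain r2 v where r2: "strict_mono r2"
    and v: "v \<in> borel_measurable borel" and lim: "AE x in lborel. (\<lambda>n. u (r1 (r2 n)) x) \<longlonglongrightarrow> v x" by blast
  define r12 where "r12 = r1 \<circ> r2"
  have r12: "strict_mono r12" unfolding r12_def by (rule strict_mono_o[OF r1(1) r2])
  \<comment> \<open>From here on the grid is refined along with the sequence: the error of each
    function on its own grid is at most h^s D and tends to 0, so a further subsequence of the errors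
    vanishes almost everywhere.\<close>
  have "(\<lambda>n. LINT x|\<mu>. norm (u (r12 n) x - P (r12 n) (u (r12 n)) x)) \<longlonglongrightarrow> 0"
  proof (rule Lim_null_comparison)
    show "\<forall>\<^sub>F n in sequentially. norm (LINT x|\<mu>. norm (u (r12 n) x - P (r12 n) (u (r12 n)) x)) \<le> h (r12 n) powr s * D"
      using approx by (intro always_eventually allI) (simp add: integral_nonneg_AE)
    show "(\<lambda>n. h (r12 n) powr s * D) \<longlonglongrightarrow> 0"
      using LIMSEQ_subseq_LIMSEQ[OF hs0 r12] by (simp add: o_def)
  qed
  then obtain r3 where r3: "strict_mono r3"
    and lim3: "AE x in \<mu>. (\<lambda>n. u (r12 (r3 n)) x - P (r12 (r3 n)) (u (r12 (r3 n))) x) \<longlonglongrightarrow> 0"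
    using tendsto_L1_AE_subseq[of \<mu> "\<lambda>n x. u (r12 n) x - P (r12 n) (u (r12 n)) x"] X_L1(1)[OF u] Pint
    by (auto simp: fun_eq_iff)
  define r where "r = r12 \<circ> r3"
  have lim_u: "AE x in \<mu>. (\<lambda>n. u (r n) x) \<longlonglongrightarrow> v x"
  proof -
    have "AE x in \<mu>. (\<lambda>n. u (r12 n) x) \<longlonglongrightarrow> v x" using lim by (auto simp: AE_\<mu>_iff r12_def)
    then show ?thesis
    proof eventually_elim
      case (elim x)
      from LIMSEQ_subseq_LIMSEQ[OF this r3] show ?case by (simp add: r_def o_def)
    qed
  qed
  have "AE x in \<mu>. (\<lambda>n. P (r n) (u (r n)) x) \<longlonglongrightarrow> v x"
    using lim_u lim3
  proof eventually_elim
    case (elim x)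
    from tendsto_diff[OF elim] show ?case by (simp add: r_def o_def)
  qed
  moreover have "strict_mono r" unfolding r_def by (rule strict_mono_o[OF r12 r3])
  ultimately show ?thesis using v lim_u unfolding P_def by blast
qed

lemma powr_fatou:
  fixes w :: "nat \<Rightarrow> 'a \<Rightarrow> real"
  assumes w: "\<And>n. integrable \<mu> (\<lambda>x. \<bar>w n x\<bar> powr p)" and B: "\<And>n. (LINT x|\<mu>. \<bar>w n x\<bar> powr p) \<le> B" and "0 < p"
    and v: "v \<in> borel_measurable borel" and lim: "AE x in \<mu>. (\<lambda>n. w n x) \<longlonglongrightarrow> v x"
  shows "integrable \<mu> (\<lambda>x. \<bar>v x\<bar> powr p)" "(LINT x|\<mu>. \<bar>v x\<bar> powr p) \<le> B"
proof -
  have l: "AE x in \<mu>. (\<lambda>n. \<bar>w n x\<bar> powr p) \<longlonglongrightarrow> \<bar>v x\<bar> powr p"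
    using lim
  proof eventually_elim
    case (elim x)
    then show ?case using \<open>0 < p\<close> by (intro tendsto_powr' tendsto_rabs tendsto_const) auto
  qed
  have "(\<lambda>x. \<bar>v x\<bar> powr p) \<in> borel_measurable \<mu>"
    using v by (intro measurable_\<mu>) measurable
  from fatou_integral_bound[OF w this _ l B]
  show "integrable \<mu> (\<lambda>x. \<bar>v x\<bar> powr p)" "(LINT x|\<mu>. \<bar>v x\<bar> powr p) \<le> B" by auto
qed

end

text \<open>The constant sequence \<open>v\<close> converges almost everywhere to \<open>t\<close>
  as well, so \<open>F_tendsto\<close> makes the constant \<open>F v \<psi>\<close> converge to
  \<open>F t \<psi>\<close>.\<close>

lemma (in perturbed_problem) F_cong_AE:
  assumes v: "critical v" and t: "t \<in> borel_measurable borel" and \<psi>: "critical \<psi>" and ae: "AE x in \<mu>. v x = t x"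
  shows "F v \<psi> = F t \<psi>"
proof -
  define B where "B = max (LINT x|\<mu>. \<bar>v x\<bar> powr \<sigma>) (LINT x|\<mu>. \<bar>\<psi> x\<bar> powr \<sigma>)"
  have "(\<lambda>n::nat. F v \<psi>) \<longlonglongrightarrow> F t \<psi>"
    by (rule F_tendsto[where B = B, OF v \<psi> _ _ t critical_borel[OF \<psi>]]) (use ae in \<open>auto simp: B_def\<close>)
  then show ?thesis using LIMSEQ_unique tendsto_const by blast
qed

text \<open>\<open>small\<close> is the smallness condition multiplied by \<open>r\<close>, with eta
  and gamma written out and \<open>nf\<close> in the place of the dual norm of
  \<open>f\<close>.\<close>

locale small_problem = perturbed_problem \<Omega> s \<sigma> CS K Q a kK kQ ka lam q
  for \<Omega> :: "'a::euclidean_space set" and s \<sigma> :: real and CS :: "real \<Rightarrow> real"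
    and K Q :: "'a \<times> 'a \<Rightarrow> real" and a :: "'a \<Rightarrow> real" and kK kQ ka lam q :: real +
  fixes f :: "('a \<Rightarrow> real) \<Rightarrow> real" and nf r :: real
  assumes f_add: "\<lbrakk>u \<in> X; v \<in> X\<rbrakk> \<Longrightarrow> f (\<lambda>x. u x + v x) = f u + f v"
    and f_scale: "u \<in> X \<Longrightarrow> f (\<lambda>x. c * u x) = c * f u"
    and f_bound: "u \<in> X \<Longrightarrow> \<bar>f u\<bar> \<le> nf * X0_norm s u"
    and r_pos: "0 < r"
    and small: "(CS 2)\<^sup>2 * (ka + measure lebesgue \<Omega> * kK) * r + \<bar>lam\<bar> * kQ * CS q powr (2 * q) * r powr (2 * q - 1) + nf \<le> r"
begin

text \<open>The bounds that the ball of radius \<open>r\<close> in the energy norm inherits through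
  the embeddings. Unlike a bound on the energy, they survive averaging over cubes.\<close>

definition admissible :: "('a \<Rightarrow> real) \<Rightarrow> bool" where
  "admissible w \<longleftrightarrow> critical w \<and> (LINT x|\<mu>. \<bar>w x\<bar> powr 2) \<le> (CS 2 * r) powr 2 \<and>
    (LINT x|\<mu>. \<bar>w x\<bar> powr q) \<le> (CS q * r) powr q"

lemma CS2: "0 < CS 2" "0 < CS q"
  using CS_pos[of 2] CS_pos[of q] two_less_\<sigma> q_range by auto

text \<open>\<open>F_bound\<close> with the embedding bounds for radius \<open>r\<close> on
  \<open>w\<close> and for the norm of \<open>\<phi>\<close> on \<open>\<phi>\<close>. The constants
  of the two arguments multiply to (CS 2)^2 and to the power 2 q of \<open>CS q\<close>, which are
  exactly those in \<open>small\<close>.\<close>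

lemma admissible_bound:
  assumes w: "admissible w" and \<phi>: "\<phi> \<in> X"
  shows "\<bar>F w \<phi> + f \<phi>\<bar> \<le> r * X0_norm s \<phi>"
proof -
  let ?n = "X0_norm s \<phi>"
  have n0: "0 \<le> ?n" by (rule X0_norm_nonneg[OF \<phi>])
  have "\<bar>F w \<phi>\<bar> \<le> (ka + measure lebesgue \<Omega> * kK) * (CS 2 * r) * (CS 2 * ?n) +
      \<bar>lam\<bar> * kQ * (CS q * r) powr (2 * q - 1) * (CS q * ?n)"
    using w CS2 r_pos n0 q_range two_less_\<sigma> X_powr(2)[OF \<phi>, of 2] X_powr(2)[OF \<phi>, of q]
    by (intro F_bound[of w \<phi>] X_critical[OF \<phi>]) (auto simp: admissible_def)
  moreover have "(CS q * r) powr (2 * q - 1) * (CS q * ?n) = CS q powr (2 * q) * r powr (2 * q - 1) * ?n"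
  proof -
    have "CS q powr (2 * q - 1) * CS q = CS q powr (2 * q)"
      using CS2 powr_add[of "CS q" "2 * q - 1" 1] by simp
    then show ?thesis using CS2 r_pos by (simp add: powr_mult algebra_simps)
  qed
  ultimately have "\<bar>F w \<phi>\<bar> \<le> (ka + measure lebesgue \<Omega> * kK) * (CS 2 * r) * (CS 2 * ?n) +
      \<bar>lam\<bar> * kQ * (CS q powr (2 * q) * r powr (2 * q - 1) * ?n)"
    by (simp only: mult.assoc)
  then have "\<bar>F w \<phi>\<bar> + \<bar>f \<phi>\<bar> \<le> ((CS 2)\<^sup>2 * (ka + measure lebesgue \<Omega> * kK) * r +
      \<bar>lam\<bar> * kQ * CS q powr (2 * q) * r powr (2 * q - 1) + nf) * ?n"
    using f_bound[OF \<phi>] by (simp add: algebra_simps power2_eq_square)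
  also have "\<dots> \<le> r * ?n" by (intro mult_right_mono small n0)
  finally show ?thesis by linarith
qed

lemma admissible_solution:
  assumes w: "admissible w"
  shows "\<exists>u\<in>X. (\<forall>\<phi>\<in>X. energy s u \<phi> = F w \<phi> + f \<phi>) \<and> X0_norm s u \<le> r"
proof -
  have wc: "critical w" using w by (simp add: admissible_def)
  have "\<exists>u\<in>X. \<forall>\<phi>\<in>X. energy s u \<phi> = F w \<phi> + f \<phi>"
  proof (rule riesz_representation)
    show "\<And>u v. u \<in> X \<Longrightarrow> v \<in> X \<Longrightarrow> F w (\<lambda>x. u x + v x) + f (\<lambda>x. u x + v x) = F w u + f u + (F w v + f v)"
      using F_add[OF wc X_critical X_critical] f_add by simp
    show "\<And>c u. u \<in> X \<Longrightarrow> F w (\<lambda>x. c * u x) + f (\<lambda>x. c * u x) = c * (F w u + f u)"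
      using F_scale f_scale by (simp add: algebra_simps)
    show "\<And>u. u \<in> X \<Longrightarrow> \<bar>F w u + f u\<bar> \<le> r * sqrt (energy s u u)"
      using admissible_bound[OF w] by (simp add: X0_norm_def)
  qed
  then obtain u where u: "u \<in> X" "\<forall>\<phi>\<in>X. energy s u \<phi> = F w \<phi> + f \<phi>" by blast
  \<comment> \<open>Test the equation with \<open>u\<close> itself; cancelling one factor gives the
    bound.\<close>
  have "X0_norm s u * X0_norm s u \<le> r * X0_norm s u"
    using X0_norm_sq[OF u(1)] u admissible_bound[OF w u(1)] by (simp add: power2_eq_square)
  then have "X0_norm s u \<le> r"
    using X0_norm_nonneg[OF u(1)] r_pos by (cases "X0_norm s u = 0") auto
  then show ?thesis using u by blast
qed

text \<open>The solution operator, preceded by a radial cut-off into the admissible functions and followed by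
  the averages over the cubes, is a continuous map of a box into itself; at a fixed point the cut-off
  is inactive.\<close>

lemma discrete_solution:
  assumes C: "cubes V0 h m A"
  shows "\<exists>u\<in>X. X0_norm s u \<le> r \<and> (\<forall>\<phi>\<in>X. energy s u \<phi> = F (step m A (avg h A u)) \<phi> + f \<phi>)"
proof -
  note A = cubesD[OF C]
  let ?V = "h ^ DIM('a)"
  have V: "?V > 0" using A(1) by simp
  have [measurable]: "A i \<in> sets borel" for i by (rule A)
  define vol where "vol i = (LINT x|\<mu>. indicator (A i) x :: real)" for i
  have vol0: "0 \<le> vol i" for i unfolding vol_def by (intro integral_nonneg_AE) auto
  have step_powr: "(LINT x|\<mu>. \<bar>step m A c x\<bar> powr p) = (\<Sum>i<m. \<bar>c i\<bar> powr p * vol i)" if "0 < p" for c p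
  proof -
    have "(\<lambda>x. \<bar>step m A c x\<bar> powr p) = step m A (\<lambda>i. \<bar>c i\<bar> powr p)"
      using step_comp[OF A(6), of "\<lambda>t. \<bar>t\<bar> powr p"] that by (auto simp: fun_eq_iff)
    then show ?thesis
      unfolding vol_def using step_integral_one(2)[of \<mu> A m "\<lambda>i. \<bar>c i\<bar> powr p"] integrable_indicator_\<mu>[OF A(3)] by simp
  qed
  define np where "np p c = (\<Sum>i<m. \<bar>c i\<bar> powr p * vol i) powr (1 / p)" for p c
  have np0: "0 \<le> np p c" for p c by (simp add: np_def)
  have np_powr: "np p c powr p = (\<Sum>i<m. \<bar>c i\<bar> powr p * vol i)" if "0 < p" for p c
    using that vol0 by (simp add: np_def powr_powr sum_nonneg)
  \<comment> \<open>\<open>np p c\<close> is the L^p norm of the step function with values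
    \<open>c\<close>, and the quotients compare it with the admissible bound. Division by
    \<open>d c\<close> makes the step function admissible, is continuous in \<open>c\<close>, and
    changes nothing if the bounds hold already.\<close>
  define d where "d c = max 1 (max (np 2 c / (CS 2 * r)) (np q c / (CS q * r)))" for c
  have d1: "1 \<le> d c" for c by (simp add: d_def)
  define w where "w c = step m A (\<lambda>i. c i / d c)" for c
  have w_powr: "(LINT x|\<mu>. \<bar>w c x\<bar> powr p) \<le> (CS p * r) powr p"
    if p: "0 < p" "0 < CS p" "np p c / (CS p * r) \<le> d c" for p c
  proof -
    have "(LINT x|\<mu>. \<bar>w c x\<bar> powr p) = (\<Sum>i<m. \<bar>c i\<bar> powr p * vol i) / d c powr p"
      unfolding w_def step_powr[OF p(1)] sum_divide_distrib
      using d1[of c] by (intro sum.cong) (auto simp: powr_divide)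
    also have "\<dots> = (np p c / d c) powr p"
      using np_powr[OF p(1)] np0 d1[of c] by (simp add: powr_divide)
    also have "\<dots> \<le> (CS p * r) powr p"
    proof (intro powr_mono2)
      have "np p c \<le> d c * (CS p * r)" using p r_pos by (simp add: pos_divide_le_eq)
      then show "np p c / d c \<le> CS p * r" using d1[of c] by (simp add: pos_divide_le_eq mult.commute)
    qed (use p np0 d1[of c] in auto)
    finally show ?thesis .
  qed
  have wc: "critical (w c)" for c unfolding w_def by (rule step_critical[OF C])
  have w_adm: "admissible (w c)" for c
    unfolding admissible_def using wc CS2 q_range by (intro conjI w_powr) (auto simp: d_def)
  have "\<forall>c. \<exists>u. u \<in> X \<and> (\<forall>\<phi>\<in>X. energy s u \<phi> = F (w c) \<phi> + f \<phi>) \<and> X0_norm s u \<le> r"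
    using admissible_solution[OF w_adm] by blast
  from choice[OF this] obtain S where S: "\<And>c. S c \<in> X" "\<And>c \<phi>. \<phi> \<in> X \<Longrightarrow> energy s (S c) \<phi> = F (w c) \<phi> + f \<phi>"
    "\<And>c. X0_norm s (S c) \<le> r" by blast
  have C1: "CS 1 > 0" using CS_pos[of 1] two_less_\<sigma> by simp
  define M where "M = CS 1 * r / ?V"
  have M: "M > 0" using C1 r_pos V by (simp add: M_def)
  have "\<exists>c. (\<forall>j. \<bar>c j\<bar> \<le> M) \<and> (\<forall>i<m. avg h A (S c) i = c i)"
  proof (rule brouwer_box[OF M])
    fix c :: "nat \<Rightarrow> real" and i
    have "\<bar>avg h A (S c) i\<bar> \<le> CS 1 * X0_norm s (S c) / ?V" by (rule avg_bound[OF C S(1)])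
    also have "\<dots> \<le> M" unfolding M_def using V C1 S(3) by (intro divide_right_mono mult_left_mono) auto
    finally show "\<bar>avg h A (S c) i\<bar> \<le> M" .
  next
    fix c :: "nat \<Rightarrow> nat \<Rightarrow> real" and c' i
    assume cM: "\<And>k j. \<bar>c k j\<bar> \<le> M" and lim: "\<And>j. (\<lambda>k. c k j) \<longlonglongrightarrow> c' j"
    \<comment> \<open>Continuity is checked without studying \<open>S\<close> itself: the i-th
      average is represented by an energy element \<open>e\<close>, and by symmetry
      \<open>avg h A (S b) i\<close> becomes \<open>F (w b) e + f e\<close>, where only the first
      argument of \<open>F\<close> varies.\<close>
    have "\<exists>e\<in>X. \<forall>v\<in>X. energy s e v = avg h A v i"
    proof (rule riesz_representation)
      show "\<And>u v. u \<in> X \<Longrightarrow> v \<in> X \<Longrightarrow> avg h A (\<lambda>x. u x + v x) i = avg h A u i + avg h A v i"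
        by (intro avg_add) auto
      show "\<And>u. u \<in> X \<Longrightarrow> \<bar>avg h A u i\<bar> \<le> CS 1 / ?V * sqrt (energy s u u)"
        using avg_bound[OF C] by (simp add: X0_norm_def)
    qed (rule avg_scale)
    then obtain e where e: "e \<in> X" "\<And>v. v \<in> X \<Longrightarrow> energy s e v = avg h A v i" by blast
    have repr: "avg h A (S b) i = F (w b) e + f e" for b
      using e(2)[OF S(1)] S(2)[OF e(1)] energy_sym[OF e(1) S(1)] by simp
    have np_lim: "(\<lambda>k. np p (c k)) \<longlonglongrightarrow> np p c'" if "0 < p" for p
      unfolding np_def using that vol0
      by (intro tendsto_powr' tendsto_sum tendsto_mult tendsto_rabs lim tendsto_const)
        (auto intro!: always_eventually sum_nonneg)
    have d_lim: "(\<lambda>k. d (c k)) \<longlonglongrightarrow> d c'"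
      unfolding d_def using np_lim q_range CS2 r_pos by (intro tendsto_max tendsto_divide tendsto_const) auto
    have w_lim: "(\<lambda>k. w (c k) x) \<longlonglongrightarrow> w c' x" for x
      unfolding w_def step_def using d1[of c'] by (intro tendsto_sum tendsto_mult tendsto_divide lim d_lim tendsto_const) auto
    define B where "B = max ((\<Sum>i<m. M powr \<sigma> * vol i)) ((CS \<sigma> * X0_norm s e) powr \<sigma>)"
    have "(\<lambda>k. F (w (c k)) e) \<longlonglongrightarrow> F (w c') e"
    proof (rule F_tendsto[where B = B])
      fix k
      show "critical (w (c k))" by (rule wc)
      show "critical e" by (rule X_critical[OF e(1)])
      show "(LINT x|\<mu>. \<bar>e x\<bar> powr \<sigma>) \<le> B"
        unfolding B_def using X_powr(2)[OF e(1), of \<sigma>] two_less_\<sigma> by simp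
      have \<sigma>0: "0 < \<sigma>" using two_less_\<sigma> by simp
      have le: "\<bar>c k i / d (c k)\<bar> \<le> M" for i
      proof -
        have "\<bar>c k i / d (c k)\<bar> \<le> \<bar>c k i\<bar>"
          using divide_left_mono[of 1 "d (c k)" "\<bar>c k i\<bar>"] d1[of "c k"] by simp
        then show ?thesis using cM order_trans by blast
      qed
      have "(LINT x|\<mu>. \<bar>w (c k) x\<bar> powr \<sigma>) \<le> (\<Sum>i<m. M powr \<sigma> * vol i)"
        unfolding w_def step_powr[OF \<sigma>0] using le \<sigma>0 vol0
        by (intro sum_mono mult_right_mono powr_mono2) auto
      then show "(LINT x|\<mu>. \<bar>w (c k) x\<bar> powr \<sigma>) \<le> B" by (simp add: B_def)
    next
      show "w c' \<in> borel_measurable borel" "e \<in> borel_measurable borel"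
        using critical_borel[OF wc] X_borel[OF e(1)] by auto
    qed (use w_lim in auto)
    then show "(\<lambda>k. avg h A (S (c k)) i) \<longlonglongrightarrow> avg h A (S c') i"
      unfolding repr by (intro tendsto_intros)
  qed
  then obtain c where fixed: "\<And>i. i < m \<Longrightarrow> avg h A (S c) i = c i" by blast
  have eq: "step m A (avg h A (S c)) = step m A c"
    unfolding step_def using fixed by (auto intro!: sum.cong)
  \<comment> \<open>At the fixed point \<open>c\<close> consists of the averages of
    \<open>S c\<close>, which lies in the ball of radius \<open>r\<close>. By Jensen's inequality
    the step function already satisfies both bounds, so the cut-off factor is 1.\<close>
  have np_le: "np p c / (CS p * r) \<le> 1" if p: "1 < p" "p \<le> \<sigma>" for p
  proof -
    have Cp: "0 < CS p" using CS_pos p by simp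
    have "np p c powr p = (LINT x|\<mu>. \<bar>step m A (avg h A (S c)) x\<bar> powr p)"
      unfolding eq using step_powr np_powr p by simp
    also have "\<dots> \<le> (CS p * X0_norm s (S c)) powr p" by (rule step_avg_powr[OF C S(1) p])
    also have "\<dots> \<le> (CS p * r) powr p"
      using Cp S(3)[of c] X0_norm_nonneg[OF S(1), of c] p by (intro powr_mono2 mult_left_mono) auto
    finally have "np p c powr p \<le> (CS p * r) powr p" .
    from powr_mono2[OF _ _ this, of "1 / p"]
    have "(np p c powr p) powr (1 / p) \<le> ((CS p * r) powr p) powr (1 / p)"
      using p by simp
    then have "np p c \<le> CS p * r"
      using p np0 Cp r_pos by (simp add: powr_powr)
    then show ?thesis using Cp r_pos by simp
  qed
  have "d c = 1"
    unfolding d_def using np_le[of 2] np_le[of q] two_less_\<sigma> q_range by simp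
  then have "w c = step m A (avg h A (S c))" unfolding w_def eq by simp
  then show ?thesis using S(1)[of c] S(2)[of _ c] S(3)[of c] by (intro bexI[of _ "S c"]) auto
qed

text \<open>The limit \<open>v\<close> of the discrete solutions is an almost everywhere limit; no
  weak convergence is used. Let \<open>t\<close> be the Riesz representative of
  \<open>F v + f\<close>. Subtracting the equations and testing with \<phi> = u - t gives the energy
  of \<phi> as F w \<phi> - F v \<phi>, where w is the averaged function. It tends to 0 because
  \<open>F_tendsto\<close> lets both arguments vary. Hence v = t almost everywhere, and
  \<open>t\<close> is a solution.\<close>

lemma weak_solution_exists:
  "\<exists>u\<in>X. X0_norm s u \<le> r \<and> (\<forall>\<phi>\<in>X. energy s u \<phi> = F u \<phi> + f \<phi>)"
proof -
  obtain V0 where V0: "\<And>h. 0 < h \<Longrightarrow> h \<le> 1 \<Longrightarrow> \<exists>m A. cubes V0 h m A"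
    using cubes_exist by blast
  define h where "h j = inverse (real (Suc j))" for j
  have "\<forall>j. \<exists>m A. cubes V0 (h j) m A" by (intro allI V0) (auto simp: h_def field_simps)
  then obtain m A where C: "\<And>j. cubes V0 (h j) (m j) (A j)" by metis
  have "\<forall>j. \<exists>u. u \<in> X \<and> X0_norm s u \<le> r \<and> (\<forall>\<phi>\<in>X. energy s u \<phi> = F (step (m j) (A j) (avg (h j) (A j) u)) \<phi> + f \<phi>)"
    using discrete_solution[OF C] by blast
  from choice[OF this] obtain u where u: "\<And>j. u j \<in> X" and ur: "\<And>j. X0_norm s (u j) \<le> r"
    and ueq: "\<And>j \<phi>. \<phi> \<in> X \<Longrightarrow> energy s (u j) \<phi> = F (step (m j) (A j) (avg (h j) (A j) (u j))) \<phi> + f \<phi>" by blast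
  have "h \<longlonglongrightarrow> 0" unfolding h_def by (rule LIMSEQ_inverse_real_of_nat)
  from compact_embedding[of u, OF u ur C this] obtain k v where v: "v \<in> borel_measurable borel"
    and lim_u: "AE x in \<mu>. (\<lambda>n. u (k n) x) \<longlonglongrightarrow> v x"
    and lim_P: "AE x in \<mu>. (\<lambda>n. step (m (k n)) (A (k n)) (avg (h (k n)) (A (k n)) (u (k n))) x) \<longlonglongrightarrow> v x"
    by blast
  define w where "w n = step (m (k n)) (A (k n)) (avg (h (k n)) (A (k n)) (u (k n)))" for n
  have C\<sigma>: "0 < CS \<sigma>" using CS_pos[of \<sigma>] two_less_\<sigma> by simp
  have u_powr: "(LINT x|\<mu>. \<bar>u n x\<bar> powr p) \<le> (CS p * r) powr p" if "1 \<le> p" "p \<le> \<sigma>" for n p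
    using X_powr(2)[OF u that, of n] powr_mono2[of p "CS p * X0_norm s (u n)" "CS p * r"] that
      CS_pos[OF that] X0_norm_nonneg[OF u, of n] ur[of n] by auto
  have v_powr: "integrable \<mu> (\<lambda>x. \<bar>v x\<bar> powr p) \<and> (LINT x|\<mu>. \<bar>v x\<bar> powr p) \<le> (CS p * r) powr p"
    if "1 \<le> p" "p \<le> \<sigma>" for p
    using powr_fatou[OF X_powr(1)[OF u that] u_powr[OF that] _ v lim_u] that by auto
  have v_crit: "critical v" using v v_powr[of \<sigma>] two_less_\<sigma> by (simp add: critical_def)
  then have v_adm: "admissible v"
    using v_powr[of 2] v_powr[of q] two_less_\<sigma> q_range by (simp add: admissible_def)
  obtain t where t: "t \<in> X" "\<And>\<phi>. \<phi> \<in> X \<Longrightarrow> energy s t \<phi> = F v \<phi> + f \<phi>" "X0_norm s t \<le> r"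
    using admissible_solution[OF v_adm] by blast
  define \<phi> where "\<phi> n = (\<lambda>x. u (k n) x - t x)" for n
  have \<phi>X: "\<phi> n \<in> X" for n unfolding \<phi>_def by (rule X_diff[OF u t(1)])
  \<comment> \<open>Twice the radius, because \<open>\<phi> n\<close> is a difference of two
    elements of the ball; the same \<open>B\<close> also serves for \<open>w n\<close> and
    \<open>v\<close>.\<close>
  define B where "B = (CS \<sigma> * (2 * r)) powr \<sigma>"
  have B_ge: "(CS \<sigma> * x) powr \<sigma> \<le> B" if "0 \<le> x" "x \<le> 2 * r" for x
    unfolding B_def using that C\<sigma> two_less_\<sigma> by (intro powr_mono2 mult_left_mono) auto
  have \<phi>_norm: "X0_norm s (\<phi> n) \<le> 2 * r" for n
  proof -
    have "energy s (\<phi> n) (\<phi> n) = energy s (u (k n)) (u (k n)) - 2 * energy s (u (k n)) t + energy s t t"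
      unfolding \<phi>_def using B_square_combination[OF u t(1), of "k n" "-1"] by simp
    also have "\<dots> \<le> (X0_norm s (u (k n)))\<^sup>2 + 2 * (X0_norm s (u (k n)) * X0_norm s t) + (X0_norm s t)\<^sup>2"
      using Cauchy_Schwarz[OF u t(1), of "k n"] X0_norm_sq[OF u, of "k n"] X0_norm_sq[OF t(1)]
      unfolding X0_norm_def by linarith
    also have "\<dots> = (X0_norm s (u (k n)) + X0_norm s t)\<^sup>2" by (simp add: power2_sum)
    finally have "X0_norm s (\<phi> n) \<le> X0_norm s (u (k n)) + X0_norm s t"
      unfolding X0_norm_def[of s "\<phi> n"] using X0_norm_nonneg[OF u] X0_norm_nonneg[OF t(1)]
      by (intro real_le_lsqrt add_nonneg_nonneg)
    then show ?thesis using ur[of "k n"] t(3) by linarith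
  qed
  have \<phi>_lim: "AE x in \<mu>. (\<lambda>n. \<phi> n x) \<longlonglongrightarrow> v x - t x"
    using lim_u unfolding \<phi>_def by eventually_elim (intro tendsto_intros)
  have \<phi>B: "(LINT x|\<mu>. \<bar>\<phi> n x\<bar> powr \<sigma>) \<le> B" for n
    using X_powr(2)[OF \<phi>X, of \<sigma> n] B_ge[OF X0_norm_nonneg[OF \<phi>X] \<phi>_norm, of n] two_less_\<sigma> by simp
  have vt: "(\<lambda>x. v x - t x) \<in> borel_measurable borel"
    using v X_borel[OF t(1)] by measurable
  have "(\<lambda>n. F (w n) (\<phi> n)) \<longlonglongrightarrow> F v (\<lambda>x. v x - t x)"
  proof (rule F_tendsto[where B = B, OF _ X_critical[OF \<phi>X] _ \<phi>B v vt _ \<phi>_lim])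
    show "critical (w n)" for n unfolding w_def by (rule step_critical[OF C])
    show "(LINT x|\<mu>. \<bar>w n x\<bar> powr \<sigma>) \<le> B" for n
      unfolding w_def using step_avg_powr[OF C u, of \<sigma> "k n" "k n"] two_less_\<sigma>
        B_ge[OF X0_norm_nonneg[OF u, of "k n"]] ur[of "k n"] r_pos by simp
  qed (use lim_P in \<open>simp add: w_def\<close>)
  moreover have "(\<lambda>n. F v (\<phi> n)) \<longlonglongrightarrow> F v (\<lambda>x. v x - t x)"
  proof (rule F_tendsto[where B = B, OF v_crit X_critical[OF \<phi>X] _ \<phi>B v vt _ \<phi>_lim])
    show "(LINT x|\<mu>. \<bar>v x\<bar> powr \<sigma>) \<le> B"
      using v_powr[of \<sigma>] two_less_\<sigma> B_ge[of r] r_pos by simp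
  qed auto
  ultimately have "(\<lambda>n. F (w n) (\<phi> n) - F v (\<phi> n)) \<longlonglongrightarrow> 0"
    using tendsto_diff by fastforce
  moreover have "energy s (\<phi> n) (\<phi> n) = F (w n) (\<phi> n) - F v (\<phi> n)" for n
    using B_diff[OF u t(1) \<phi>X, of "k n" n] ueq[OF \<phi>X, of "k n" n] t(2)[OF \<phi>X, of n]
    by (simp add: \<phi>_def w_def)
  ultimately have "(\<lambda>n. CS 1 * sqrt (energy s (\<phi> n) (\<phi> n))) \<longlonglongrightarrow> CS 1 * sqrt 0"
    by (intro tendsto_intros) simp
  then have sq0: "(\<lambda>n. CS 1 * sqrt (energy s (\<phi> n) (\<phi> n))) \<longlonglongrightarrow> 0" by simp
  \<comment> \<open>The embedding with p = 1 passes from energy to L^1 convergence; an almost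
    everywhere convergent subsequence then identifies \<open>v\<close> with
    \<open>t\<close>.\<close>
  have "(\<lambda>n. LINT x|\<mu>. norm (\<phi> n x)) \<longlonglongrightarrow> 0"
    by (rule Lim_null_comparison[OF _ sq0])
      (use X_L1(2)[OF \<phi>X] in \<open>auto simp: X0_norm_def integral_nonneg_AE\<close>)
  then obtain l where l: "strict_mono l" "AE x in \<mu>. (\<lambda>n. \<phi> (l n) x) \<longlonglongrightarrow> 0"
    using tendsto_L1_AE_subseq[of \<mu> \<phi>] X_L1(1)[OF \<phi>X] by blast
  have vt_eq: "AE x in \<mu>. v x = t x"
    using \<phi>_lim l(2)
  proof eventually_elim
    case (elim x)
    have "(\<lambda>n. \<phi> (l n) x) \<longlonglongrightarrow> v x - t x"
      using LIMSEQ_subseq_LIMSEQ[OF elim(1) l(1)] by (simp add: o_def)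
    then show ?case using LIMSEQ_unique[OF elim(2)] by fastforce
  qed
  have "F v \<psi> = F t \<psi>" if \<psi>: "\<psi> \<in> X" for \<psi>
    by (rule F_cong_AE[OF v_crit X_borel[OF t(1)] X_critical[OF \<psi>] vt_eq])
  then show ?thesis using t by auto
qed

end

section \<open>Almost everywhere representatives\<close>

lemma lebesgue_borel_representative:
  fixes u v :: "'a::euclidean_space \<Rightarrow> real"
  assumes v[measurable]: "v \<in> borel_measurable borel" and ae: "AE x in lborel. u x = v x"
  shows "u \<in> borel_measurable lebesgue" "integrable lebesgue u \<longleftrightarrow> integrable lborel v"
    "(LINT x|lebesgue. u x) = (LINT x|lborel. v x)"
proof -
  have vl[measurable]: "v \<in> borel_measurable lebesgue" by (rule measurable_completion) simp
  have ae': "AE x in lebesgue. v x = u x" using ae by (auto intro!: AE_completion)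
  then show u[measurable]: "u \<in> borel_measurable lebesgue" by (rule borel_measurable_AE[OF vl])
  have "integrable lebesgue u \<longleftrightarrow> integrable lebesgue v"
    using ae' by (intro integrable_cong_AE) auto
  also have "\<dots> \<longleftrightarrow> integrable lborel v" by (rule integrable_completion) simp
  finally show "integrable lebesgue u \<longleftrightarrow> integrable lborel v" .
  have "(LINT x|lebesgue. u x) = (LINT x|lebesgue. v x)"
    using ae' by (intro integral_cong_AE) auto
  also have "\<dots> = (LINT x|lborel. v x)" by (rule integral_completion) simp
  finally show "(LINT x|lebesgue. u x) = (LINT x|lborel. v x)" .
qed

lemma Linf_borel_representative:
  fixes u :: "'a::euclidean_space \<Rightarrow> real"
  assumes S: "S \<in> sets borel" and u: "u \<in> Linf S"
  shows "\<exists>v\<in>borel_measurable borel. (\<forall>x. \<bar>v x\<bar> \<le> Linf_norm S u) \<and> (AE x in lborel. x \<in> S \<longrightarrow> u x = v x)"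
proof -
  have SL: "S \<in> sets lebesgue" using S by simp
  let ?k = "Linf_norm S u" and ?e = "esssup (lebesgue_on S) (\<lambda>x. ereal \<bar>u x\<bar>)"
  have um: "u \<in> borel_measurable (lebesgue_on S)" and efin: "?e < \<infinity>" using u by (auto simp: Linf_def)
  have "AE x in lebesgue_on S. ereal \<bar>u x\<bar> \<le> ?e" by (rule esssup_AE)
  then have ae: "AE x in lebesgue_on S. \<bar>u x\<bar> \<le> ?k"
    unfolding Linf_norm_def by eventually_elim (use efin in \<open>cases ?e; auto\<close>)
  \<comment> \<open>On a null set the essential supremum is \<open>- \<infinity>\<close>, whose real
    value is 0; a finite essential supremum of an absolute value cannot be negative.\<close>
  have k0: "0 \<le> ?k"
  proof (cases ?e)
    case (real e)
    show ?thesis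
    proof (rule ccontr)
      assume neg: "\<not> 0 \<le> ?k"
      have "AE x in lebesgue_on S. ereal \<bar>u x\<bar> \<le> - \<infinity>"
        using ae by eventually_elim (use neg in auto)
      then have "?e \<le> - \<infinity>" using um by (intro esssup_I) auto
      then show False using real by simp
    qed
  qed (use efin in \<open>auto simp: Linf_norm_def\<close>)
  have "(\<lambda>x. if x \<in> S then u x else 0) \<in> borel_measurable lebesgue"
    using um SL by (simp add: borel_measurable_if)
  from completion_ex_borel_measurable_real[OF this]
  obtain g where g: "g \<in> borel_measurable lborel" "AE x in lborel. (if x \<in> S then u x else 0) = g x" by blast
  have ae': "AE x in lborel. x \<in> S \<longrightarrow> \<bar>u x\<bar> \<le> ?k"
    using ae SL by (simp add: AE_restrict_space_iff AE_completion_iff)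
  \<comment> \<open>The truncation makes the bound hold at every point and not only almost
    everywhere.\<close>
  define v where "v x = max (- ?k) (min ?k (g x))" for x
  have "v \<in> borel_measurable borel" unfolding v_def using g(1) by measurable
  moreover have "\<bar>v x\<bar> \<le> ?k" for x using k0 by (auto simp: v_def)
  moreover have "AE x in lborel. x \<in> S \<longrightarrow> u x = v x"
    using g(2) ae' by eventually_elim (auto simp: v_def)
  ultimately show ?thesis by blast
qed

context dirichlet_space
begin

lemma lebesgue_on_representative:
  assumes v: "v \<in> borel_measurable \<mu>" and ae: "AE x in \<mu>. u x = v x"
  shows "(LINT x|lebesgue_on \<Omega>. u x) = (LINT x|\<mu>. (v x :: real))"
proof -
  have "(\<lambda>x. indicator \<Omega> x * v x) \<in> borel_measurable borel"
    using v borel_measurable_restrict_space_iff[of \<Omega> lborel v] by (simp add: \<mu>_def mult.commute)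
  moreover have "AE x in lborel. indicator \<Omega> x * u x = indicator \<Omega> x * v x"
    using ae unfolding AE_\<mu>_iff by eventually_elim (auto simp: indicator_def)
  ultimately have "(LINT x|lebesgue. indicator \<Omega> x * u x) = (LINT x|lborel. indicator \<Omega> x * v x)"
    by (rule lebesgue_borel_representative(3))
  then show ?thesis by (simp add: integral_\<mu> integral_restrict_space)
qed

lemma gagliardo_AE:
  assumes "AE x in lborel. u x = u' x" "AE x in lborel. v x = v' x"
  shows "AE z in lborel. gagliardo s u v z = gagliardo s u' v' z"
  using AE_lborel_both[OF assms(1)] AE_lborel_both[OF assms(2)]
  by eventually_elim (simp add: gagliardo_def)

lemma X0_representative:
  assumes u: "u \<in> X0 s \<Omega>" shows "\<exists>u'\<in>X. AE x in lborel. u x = u' x"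
proof -
  have um: "u \<in> borel_measurable lebesgue" and ui: "integrable lebesgue (\<lambda>x. \<bar>u x\<bar> powr 2)"
    and gi: "integrable lebesgue (\<lambda>(x, y). (u x - u y)\<^sup>2 / norm (x - y) powr (real DIM('a) + 2 * s))"
    and u0: "AE x in lborel. x \<notin> \<Omega> \<longrightarrow> u x = 0"
    using u by (auto simp: X0_def Hs_def Lp_def lebesgue_on_UNIV_eq AE_completion_iff)
  obtain g where g[measurable]: "g \<in> borel_measurable borel" and ug: "AE x in lborel. u x = g x"
    using completion_ex_borel_measurable_real[OF um] by auto
  define u' where "u' x = indicator \<Omega> x * g x" for x
  have u'm[measurable]: "u' \<in> borel_measurable borel" unfolding u'_def by measurable
  have ae: "AE x in lborel. u x = u' x"
    using u0 ug by eventually_elim (auto simp: u'_def indicator_def)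
  have "integrable lborel (\<lambda>x. \<bar>u' x\<bar> powr 2)"
  proof (subst lebesgue_borel_representative(2)[symmetric])
    show "AE x in lborel. \<bar>u x\<bar> powr 2 = \<bar>u' x\<bar> powr 2" using ae by eventually_elim simp
  qed (use ui in measurable)
  moreover have "(\<lambda>x. indicator \<Omega> x * \<bar>u' x\<bar> powr 2) = (\<lambda>x. \<bar>u' x\<bar> powr 2)"
    by (auto simp: u'_def indicator_def)
  ultimately have "integrable \<mu> (\<lambda>x. \<bar>u' x\<bar> powr 2)" by (simp add: integrable_\<mu>_iff)
  moreover have "integrable lborel (gagliardo s u' u')"
  proof (subst lebesgue_borel_representative(2)[symmetric, OF gagliardo_measurable[OF u'm u'm] gagliardo_AE[OF ae ae]])
    show "integrable lebesgue (gagliardo s u u)"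
      using gi by (rule back_subst[of "integrable lebesgue"]) (auto simp: gagliardo_def power2_eq_square)
  qed
  ultimately have "u' \<in> X" by (intro XI u'm) (auto simp: u'_def)
  then show ?thesis using ae by blast
qed

lemma X0_of_AE_eq:
  assumes u': "u' \<in> X" and ae: "AE x in lborel. u x = u' x"
  shows "u \<in> X0 s \<Omega>"
proof -
  have u'm[measurable]: "u' \<in> borel_measurable borel" by (rule X_borel[OF u'])
  have "integrable lborel (\<lambda>x. \<bar>u' x\<bar> powr 2)"
  proof -
    have "(\<lambda>x. indicator \<Omega> x * \<bar>u' x\<bar> powr 2) = (\<lambda>x. \<bar>u' x\<bar> powr 2)"
      using X_outside[OF u'] by (force simp: indicator_def)
    then show ?thesis using X_powr(1)[OF u', of 2] two_less_\<sigma> by (simp add: integrable_\<mu>_iff)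
  qed
  then have 1: "integrable lebesgue (\<lambda>x. \<bar>u x\<bar> powr 2)"
  proof (subst lebesgue_borel_representative(2))
    show "AE x in lborel. \<bar>u x\<bar> powr 2 = \<bar>u' x\<bar> powr 2" using ae by eventually_elim simp
  qed (auto intro: u'm)
  have "integrable lebesgue (gagliardo s u u)"
    by (subst lebesgue_borel_representative(2)[OF gagliardo_measurable[OF u'm u'm] gagliardo_AE[OF ae ae]])
      (rule X_gagliardo[OF u'])
  then have 2: "integrable lebesgue (\<lambda>(x, y). (u x - u y)\<^sup>2 / norm (x - y) powr (real DIM('a) + 2 * s))"
    by (rule back_subst[of "integrable lebesgue"]) (auto simp: gagliardo_def power2_eq_square)
  have 3: "AE x in lborel. x \<notin> \<Omega> \<longrightarrow> u x = 0"
    using ae by eventually_elim (simp add: X_outside[OF u'])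
  show ?thesis
    using 1 2 3 lebesgue_borel_representative(1)[OF u'm ae]
    by (auto simp: X0_def Hs_def Lp_def lebesgue_on_UNIV_eq AE_completion_iff)
qed

lemma energy_cong_AE:
  assumes "u' \<in> X" "v' \<in> X" "AE x in lborel. u x = u' x" "AE x in lborel. v x = v' x"
  shows "energy s u v = energy s u' v'"
proof -
  have "(LINT (x, y)|lebesgue. (u x - u y) * (v x - v y) / norm (x - y) powr (real DIM('a) + 2 * s))
      = (LINT z|lebesgue. gagliardo s u v z)"
    by (rule arg_cong[of _ _ "integral\<^sup>L lebesgue"]) (auto simp: gagliardo_def)
  also have "\<dots> = (LINT z|lborel. gagliardo s u' v' z)"
    by (intro lebesgue_borel_representative(3) gagliardo_measurable gagliardo_AE X_borel assms)
  finally show ?thesis using assms by (simp add: energy_eq energy_def[of s u v])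
qed

lemma X0_norm_scale: "u \<in> X \<Longrightarrow> X0_norm s (\<lambda>x. c * u x) = \<bar>c\<bar> * X0_norm s u"
  using energy_scale[of u "\<lambda>x. c * u x" c] energy_sym[of u "\<lambda>x. c * u x"] energy_scale[of u u c] X_scale[of u c]
  by (simp add: X0_norm_def real_sqrt_mult)

lemma dual_bound:
  assumes f: "f \<in> dual_X0 s \<Omega>" and u: "u \<in> X"
  shows "\<bar>f u\<bar> \<le> dual_norm s \<Omega> f * X0_norm s u"
proof -
  obtain C where C: "\<And>v. v \<in> X0 s \<Omega> \<Longrightarrow> \<bar>f v\<bar> \<le> C * X0_norm s v"
    using f unfolding dual_X0_def by blast
  show ?thesis
  proof (cases "X0_norm s u = 0")
    case True
    then show ?thesis using C[OF X_X0[OF u]] by simp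
  next
    case False
    then have n: "X0_norm s u > 0" using X0_norm_nonneg[OF u] by simp
    define v where "v = (\<lambda>x. (1 / X0_norm s u) * u x)"
    have vX: "v \<in> X" unfolding v_def by (rule X_scale[OF u])
    have v1: "X0_norm s v = 1" unfolding v_def X0_norm_scale[OF u] using n by simp
    have "\<bar>f v\<bar> \<le> dual_norm s \<Omega> f"
      unfolding dual_norm_def
    proof (rule cSUP_upper)
      show "v \<in> {u \<in> X0 s \<Omega>. X0_norm s u \<le> 1}" using X_X0[OF vX] v1 by simp
      \<comment> \<open>The supremum ranges over \<open>X0\<close> and not over \<open>X\<close>, so
        nonnegativity of the norm is taken from a representative.\<close>
      show "bdd_above ((\<lambda>u. \<bar>f u\<bar>) ` {u \<in> X0 s \<Omega>. X0_norm s u \<le> 1})"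
      proof (rule bdd_aboveI2[where M = "\<bar>C\<bar>"])
        fix w assume "w \<in> {u \<in> X0 s \<Omega>. X0_norm s u \<le> 1}"
        then have w: "w \<in> X0 s \<Omega>" "X0_norm s w \<le> 1" by auto
        obtain w' where w': "w' \<in> X" "AE x in lborel. w x = w' x" using X0_representative[OF w(1)] by blast
        have "X0_norm s w = X0_norm s w'"
          unfolding X0_norm_def using energy_cong_AE[OF w'(1,1) w'(2,2)] by simp
        then have "0 \<le> X0_norm s w" using X0_norm_nonneg[OF w'(1)] by simp
        then have "C * X0_norm s w \<le> \<bar>C\<bar> * 1" using w(2) by (intro mult_mono) auto
        then show "\<bar>f w\<bar> \<le> \<bar>C\<bar>" using C[OF w(1)] by simp
      qed
    qed
    moreover have "f v = (1 / X0_norm s u) * f u"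
      using f X_X0[OF u] unfolding v_def dual_X0_def by blast
    ultimately show ?thesis using n by (simp add: abs_mult field_simps)
  qed
qed

lemma dual_cong_AE:
  assumes f: "f \<in> dual_X0 s \<Omega>" and u: "u \<in> X0 s \<Omega>" and u': "u' \<in> X" and ae: "AE x in lborel. u x = u' x"
  shows "f u = f u'"
proof -
  obtain C where C: "\<And>v. v \<in> X0 s \<Omega> \<Longrightarrow> \<bar>f v\<bar> \<le> C * X0_norm s v"
    using f unfolding dual_X0_def by blast
  define d where "d = (\<lambda>x. u x + - 1 * u' x)"
  have dae: "AE x in lborel. d x = 0" using ae by eventually_elim (simp add: d_def)
  have "X0_norm s d = X0_norm s (\<lambda>_::'a. 0)"
    unfolding X0_norm_def using energy_cong_AE[OF X_zero X_zero dae dae] by simp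
  also have "\<dots> = 0" using X0_norm_scale[OF X_zero, of 0] by simp
  finally have "f d = 0" using C[OF X0_of_AE_eq[OF X_zero dae]] by simp
  moreover have f_add: "f (\<lambda>x. v x + w x) = f v + f w" if "v \<in> X0 s \<Omega>" "w \<in> X0 s \<Omega>" for v w
    using f that unfolding dual_X0_def by blast
  moreover have f_scale: "f (\<lambda>x. - 1 * u' x) = - 1 * f u'"
    using f X_X0[OF u'] unfolding dual_X0_def by blast
  ultimately show ?thesis
    using f_add[OF u X_X0[OF X_scale[OF u', of "-1"]]] by (simp add: d_def)
qed

end

section \<open>Comparison of \<open>F\<close> with the terms of the weak formulation\<close>

context perturbed_problem
begin

text \<open>\<open>K'\<close> is only measurable for the completed measure on the product, so its sections are controlled only
  for almost every \<open>x\<close>.\<close>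

lemma F_eq_weak_terms:
  assumes u: "u \<in> X" and \<phi>: "\<phi> \<in> X" and ae\<phi>: "AE x in lborel. \<phi>' x = \<phi> x"
    and aeK: "AE z in lborel. z \<in> \<Omega> \<times> \<Omega> \<longrightarrow> K' z = K z" and aeQ: "AE z in lborel. z \<in> \<Omega> \<times> \<Omega> \<longrightarrow> Q' z = Q z"
    and aea: "AE x in lborel. x \<in> \<Omega> \<longrightarrow> a' x = a x"
  shows "F u \<phi> = (LINT x|lebesgue_on \<Omega>. T_op \<Omega> K' u x * \<phi>' x) + (LINT x|lebesgue_on \<Omega>. a' x * u x * \<phi>' x)
    + lam * (LINT x|lebesgue_on \<Omega>. N_op \<Omega> q Q' u x * \<phi>' x)"
proof -
  have [measurable]: "u \<in> borel_measurable borel" "\<phi> \<in> borel_measurable borel" using X_borel u \<phi> by auto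
  have ae\<phi>\<mu>: "AE x in \<mu>. \<phi>' x = \<phi> x" using ae\<phi> by (auto simp: AE_\<mu>_iff)
  \<comment> \<open>Fubini for null sets: for almost every x the two sections agree for almost every
    y.\<close>
  have iter: "AE x in \<mu>. AE y in \<mu>. G' (x, y) = G (x, y)"
    if "AE z in lborel. z \<in> \<Omega> \<times> \<Omega> \<longrightarrow> G' z = G z" for G G' :: "'a \<times> 'a \<Rightarrow> real"
  proof -
    have "AE z in lborel \<Otimes>\<^sub>M lborel. z \<in> \<Omega> \<times> \<Omega> \<longrightarrow> G' z = G z" unfolding lborel_prod by (rule that)
    from lborel_pair.AE_pair[OF this]
    have "AE x in lborel. AE y in lborel. (x, y) \<in> \<Omega> \<times> \<Omega> \<longrightarrow> G' (x, y) = G (x, y)" .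
    then show ?thesis unfolding AE_\<mu>_iff by eventually_elim auto
  qed
  \<comment> \<open>Common form of both kernel terms: b = u and c = 1 give T_K, while b = |u|^q and
    c = |u|^(q-2) u give N_Q.\<close>
  have kernel: "(LINT x|lebesgue_on \<Omega>. (LINT y|lebesgue_on \<Omega>. G' (x, y) * b y) * c x * \<phi>' x) =
      (LINT z|(\<mu> \<Otimes>\<^sub>M \<mu>). G z * b (snd z) * c (fst z) * \<phi> (fst z))"
    if G: "G \<in> borel_measurable borel" and ae: "AE z in lborel. z \<in> \<Omega> \<times> \<Omega> \<longrightarrow> G' z = G z"
      and b: "b \<in> borel_measurable borel" and c: "c \<in> borel_measurable borel"
      and int: "integrable (\<mu> \<Otimes>\<^sub>M \<mu>) (\<lambda>z. G z * b (snd z) * c (fst z) * \<phi> (fst z))" for G G' and b c :: "'a \<Rightarrow> real"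
  proof -
    note [measurable] = G b c
    have m: "(\<lambda>x. (LINT y|\<mu>. G (x, y) * b y) * c x * \<phi> x) \<in> borel_measurable \<mu>"
    proof -
      have "(\<lambda>z. G z * b (snd z)) \<in> borel_measurable (\<mu> \<Otimes>\<^sub>M \<mu>)" by measurable
      then have "(\<lambda>x. LINT y|\<mu>. G (x, y) * b y) \<in> borel_measurable \<mu>"
        by (intro \<mu>.borel_measurable_lebesgue_integral) (simp add: split_beta')
      moreover have "c \<in> borel_measurable \<mu>" "\<phi> \<in> borel_measurable \<mu>" by (auto intro: measurable_\<mu>)
      ultimately show ?thesis by (intro borel_measurable_times)
    qed
    have ae2: "AE x in \<mu>. (LINT y|lebesgue_on \<Omega>. G' (x, y) * b y) * c x * \<phi>' x = (LINT y|\<mu>. G (x, y) * b y) * c x * \<phi> x"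
      using iter[OF ae] ae\<phi>\<mu>
    proof eventually_elim
      case (elim x)
      have "(LINT y|lebesgue_on \<Omega>. G' (x, y) * b y) = (LINT y|\<mu>. G (x, y) * b y)"
      proof (rule lebesgue_on_representative)
        have "(\<lambda>y. G (x, y)) \<in> borel_measurable borel"
          using G by (intro measurable_compose[OF _ G] borel_measurable_continuous_onI continuous_intros)
        then show "(\<lambda>y. G (x, y) * b y) \<in> borel_measurable \<mu>"
          using b by (intro borel_measurable_times measurable_\<mu>)
        show "AE y in \<mu>. G' (x, y) * b y = G (x, y) * b y" using elim(1) by eventually_elim simp
      qed
      then show ?case using elim(2) by simp
    qed
    have "(LINT x|lebesgue_on \<Omega>. (LINT y|lebesgue_on \<Omega>. G' (x, y) * b y) * c x * \<phi>' x) =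
        (LINT x|\<mu>. (LINT y|\<mu>. G (x, y) * b y) * c x * \<phi> x)"
      by (rule lebesgue_on_representative[OF m ae2])
    also have "\<dots> = (LINT x|\<mu>. (LINT y|\<mu>. G (x, y) * b y * c x * \<phi> x))"
      by (simp only: integral_mult_left_zero)
    also have "\<dots> = (LINT z|(\<mu> \<Otimes>\<^sub>M \<mu>). G z * b (snd z) * c (fst z) * \<phi> (fst z))"
      using \<mu>\<mu>.integral_fst'[OF int] by simp
    finally show ?thesis .
  qed
  have 1: "(LINT x|lebesgue_on \<Omega>. T_op \<Omega> K' u x * \<phi>' x) = (LINT z|(\<mu> \<Otimes>\<^sub>M \<mu>). FK u \<phi> z)"
    using kernel[OF K_borel aeK, of u "\<lambda>_. 1"] F_integrable(1)[OF X_critical[OF u] X_critical[OF \<phi>]]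
    by (simp add: T_op_def FK_def[abs_def])
  have 2: "(LINT x|lebesgue_on \<Omega>. N_op \<Omega> q Q' u x * \<phi>' x) = (LINT z|(\<mu> \<Otimes>\<^sub>M \<mu>). FQ u \<phi> z)"
    using kernel[OF Q_borel aeQ, of "\<lambda>y. \<bar>u y\<bar> powr q" "\<lambda>x. \<bar>u x\<bar> powr (q - 2) * u x"]
      F_integrable(3)[OF X_critical[OF u] X_critical[OF \<phi>]]
    by (simp add: N_op_def B_op_def FQ_def[abs_def] mult.commute mult.left_commute)
  have 3: "(LINT x|lebesgue_on \<Omega>. a' x * u x * \<phi>' x) = (LINT x|\<mu>. a x * u x * \<phi> x)"
  proof (rule lebesgue_on_representative)
    show "(\<lambda>x. a x * u x * \<phi> x) \<in> borel_measurable \<mu>" by (intro measurable_\<mu>) measurable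
    have "AE x in \<mu>. a' x = a x" using aea by (simp add: AE_\<mu>_iff)
    then show "AE x in \<mu>. a' x * u x * \<phi>' x = a x * u x * \<phi> x" using ae\<phi>\<mu> by eventually_elim simp
  qed
  show ?thesis unfolding F_def 1 2 3 ..
qed

lemma F_zero: "F (\<lambda>_. 0) \<phi> = 0"
  by (simp add: F_def FK_def FQ_def)

end

section \<open>Existence for essentially bounded data\<close>

theorem theorem4p2:
  fixes \<Omega> :: "(real ^ 'n) set"
    and s q lam eta gamma r :: real
    and CS :: "real \<Rightarrow> real"
    and a :: "real ^ 'n \<Rightarrow> real"
    and K Q :: "(real ^ 'n) \<times> (real ^ 'n) \<Rightarrow> real"
    and f :: "(real ^ 'n \<Rightarrow> real) \<Rightarrow> real"
  assumes "CARD('n) \<ge> 2"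
    and "bounded_lipschitz_domain \<Omega>"
    and "0 < s" "s < 1"
    and "1 < q" "q < crit_exponent CARD('n) s"
    and "\<And>p. 1 \<le> p \<Longrightarrow> p \<le> crit_exponent CARD('n) s \<Longrightarrow> embedding_const s \<Omega> p (CS p)"
    and "a \<in> Linf \<Omega>"
    and "K \<in> Linf (\<Omega> \<times> \<Omega>)"
    and "Q \<in> Linf (\<Omega> \<times> \<Omega>)"
    and "f \<in> dual_X0 s \<Omega>"
    and "eta = (CS 2)\<^sup>2 * (Linf_norm \<Omega> a + measure lebesgue \<Omega> * Linf_norm (\<Omega> \<times> \<Omega>) K)"
    and "gamma = \<bar>lam\<bar> * Linf_norm (\<Omega> \<times> \<Omega>) Q * CS q powr (2 * q)"
    and "eta < 1"
    and "r > 0"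
    and "gamma * r powr (2 * q - 2) + dual_norm s \<Omega> f / r \<le> 1 - eta"
  shows "\<exists>u. weak_solution s \<Omega> K a lam q Q f u \<and> X0_norm s u \<le> r \<and>
           ((\<exists>\<phi>\<in>X0 s \<Omega>. f \<phi> \<noteq> 0) \<longrightarrow> \<not> (AE x in lebesgue. u x = 0))"
proof -
  let ?\<sigma> = "crit_exponent CARD('n) s"
  have op: "open \<Omega>" and bd: "bounded \<Omega>" using assms(2) by (auto simp: bounded_lipschitz_domain_def)
  \<comment> \<open>2 N / (N - 2 s) > 2 because 0 < 2 s < 2 <= N.\<close>
  have "2 < ?\<sigma>"
    using assms(1,3,4) by (auto simp: crit_exponent_def field_simps)
  then interpret dirichlet_space \<Omega> s ?\<sigma> CS
    by unfold_locales (use op bd assms(3,4,7) in auto)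
  have \<Omega>2: "\<Omega> \<times> \<Omega> \<in> sets borel" using open_Times[OF op op] by simp
  obtain a' where a': "a' \<in> borel_measurable borel" "\<And>x. \<bar>a' x\<bar> \<le> Linf_norm \<Omega> a"
    "AE x in lborel. x \<in> \<Omega> \<longrightarrow> a x = a' x"
    using Linf_borel_representative[OF domain_borel assms(8)] by blast
  obtain K' where K': "K' \<in> borel_measurable borel" "\<And>x. \<bar>K' x\<bar> \<le> Linf_norm (\<Omega> \<times> \<Omega>) K"
    "AE x in lborel. x \<in> \<Omega> \<times> \<Omega> \<longrightarrow> K x = K' x"
    using Linf_borel_representative[OF \<Omega>2 assms(9)] by blast
  obtain Q' where Q': "Q' \<in> borel_measurable borel" "\<And>x. \<bar>Q' x\<bar> \<le> Linf_norm (\<Omega> \<times> \<Omega>) Q"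
    "AE x in lborel. x \<in> \<Omega> \<times> \<Omega> \<longrightarrow> Q x = Q' x"
    using Linf_borel_representative[OF \<Omega>2 assms(10)] by blast
  have small: "(CS 2)\<^sup>2 * (Linf_norm \<Omega> a + measure lebesgue \<Omega> * Linf_norm (\<Omega> \<times> \<Omega>) K) * r +
      \<bar>lam\<bar> * Linf_norm (\<Omega> \<times> \<Omega>) Q * CS q powr (2 * q) * r powr (2 * q - 1) + dual_norm s \<Omega> f \<le> r"
  proof -
    have "(gamma * r powr (2 * q - 2) + dual_norm s \<Omega> f / r) * r \<le> (1 - eta) * r"
      using assms(15,16) by (intro mult_right_mono) auto
    moreover have "r powr (2 * q - 2) * r = r powr (2 * q - 1)"
      using assms(15) powr_add[of r "2 * q - 2" 1] by simp
    ultimately have "gamma * r powr (2 * q - 1) + dual_norm s \<Omega> f \<le> r - eta * r"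
      using assms(15) by (simp add: algebra_simps)
    then show ?thesis unfolding assms(12,13)[symmetric] by simp
  qed
  interpret small_problem \<Omega> s ?\<sigma> CS K' Q' a' "Linf_norm (\<Omega> \<times> \<Omega>) K" "Linf_norm (\<Omega> \<times> \<Omega>) Q"
    "Linf_norm \<Omega> a" lam q f "dual_norm s \<Omega> f" r
  proof unfold_locales
    show "\<And>u v. u \<in> X \<Longrightarrow> v \<in> X \<Longrightarrow> f (\<lambda>x. u x + v x) = f u + f v"
      "\<And>u c. u \<in> X \<Longrightarrow> f (\<lambda>x. c * u x) = c * f u"
      using assms(11) X_X0 unfolding dual_X0_def by blast+
  qed (use a' K' Q' assms(5,6,15) small dual_bound[OF assms(11)] in auto)
  obtain u where u: "u \<in> X" "X0_norm s u \<le> r" and sol: "\<And>\<phi>. \<phi> \<in> X \<Longrightarrow> energy s u \<phi> = F u \<phi> + f \<phi>"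
    using weak_solution_exists by blast
  have "A_form s \<Omega> K a u \<phi> = lam * (LINT x|lebesgue_on \<Omega>. N_op \<Omega> q Q u x * \<phi> x) + f \<phi>"
    if \<phi>: "\<phi> \<in> X0 s \<Omega>" for \<phi>
  proof -
    obtain \<phi>' where \<phi>': "\<phi>' \<in> X" "AE x in lborel. \<phi> x = \<phi>' x" using X0_representative[OF \<phi>] by blast
    have "energy s u \<phi> = energy s u \<phi>'" by (rule energy_cong_AE[OF u(1) \<phi>'(1) _ \<phi>'(2)]) simp
    then show ?thesis
      using sol[OF \<phi>'(1)] F_eq_weak_terms[OF u(1) \<phi>' K'(3) Q'(3) a'(3)] dual_cong_AE[OF assms(11) \<phi> \<phi>']
      by (simp add: A_form_def)
  qed
  then have "weak_solution s \<Omega> K a lam q Q f u"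
    using X_X0[OF u(1)] by (simp add: weak_solution_def)
  \<comment> \<open>Nontriviality by contraposition: for u = 0 both the energy and \<open>F\<close>
    vanish, and the equation reduces to f = 0.\<close>
  moreover have "f \<phi> = 0" if "AE x in lebesgue. u x = 0" and \<phi>: "\<phi> \<in> X0 s \<Omega>" for \<phi>
  proof -
    have u0: "AE x in lborel. u x = 0" using that(1) by (simp add: AE_completion_iff)
    obtain \<phi>' where \<phi>': "\<phi>' \<in> X" "AE x in lborel. \<phi> x = \<phi>' x" using X0_representative[OF \<phi>] by blast
    have "energy s u \<phi>' = energy s (\<lambda>_. 0) \<phi>'" by (rule energy_cong_AE[OF X_zero \<phi>'(1) u0]) simp
    also have "\<dots> = 0" using energy_scale[OF X_zero \<phi>'(1), of 0] by simp
    finally have "energy s u \<phi>' = 0" .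
    moreover have "F u \<phi>' = F (\<lambda>_. 0) \<phi>'"
      by (rule F_cong_AE[OF X_critical[OF u(1)] _ X_critical[OF \<phi>'(1)]]) (use u0 in \<open>auto simp: AE_\<mu>_iff\<close>)
    ultimately show ?thesis
      using sol[OF \<phi>'(1)] F_zero dual_cong_AE[OF assms(11) \<phi> \<phi>'] by simp
  qed
  ultimately show ?thesis using u(2) by blast
qed

end
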